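(* Let $\boldsymbol{d}=\boldsymbol{d}(n)$ be a realisable near-regular degree sequence with $\Delta(\boldsymbol{d})\gg n/\sqrt{\log n}$, $n-\Delta(\boldsymbol{d})\gg n/\sqrt{\log n}$ and $\mathrm{range}(\boldsymbol{d})=O(\Delta(\boldsymbol{d})/\log n)$. Then there are $p_1=(1-o(1))\Delta(\boldsymbol{d})/n$ and $p_2=(1+o(1))\Delta(\boldsymbol{d})/n$ and a coupling $(G^L,G,G^U)$ such that $G^L\sim\mathcal{G}(n,p_1)$, $G^U\sim\mathcal{G}(n,p_2)$, $G\sim\mathcal{G}(n,\boldsymbol{d})$ and $\mathbb{P}(G^L\subseteq G\subseteq G^U)=1-o(1)$.
   Context: All asymptotics are as $n\to\infty$. $\mathcal{G}(n,p)$ is the binomial random graph on $[n]$; $\mathcal{G}(n,\boldsymbol{d})$ is the uniformly random simple graph on $[n]$ with degree sequence $\boldsymbol{d}$. $\Delta(\boldsymbol{d})=\max_jd_j$, $\mathrm{range}(\boldsymbol{d})=\max_jd_j-\min_jd_j$. $\boldsymbol{d}(n)$ is near-regular if $\mathrm{range}(\boldsymbol{d})=o(\Delta(\boldsymbol{d}))$ and $\mathrm{range}(\boldsymbol{d})=o(n-\Delta(\boldsymbol{d}))$. A coupling is a random tuple with the given marginals; containment refers to edge sets. *)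

theory Defs
  imports
    "HOL-Probability.Probability"
    "HOL-Library.Ramsey"
    "HOL-Library.Landau_Symbols"
begin

text \<open>
  A graph on the vertex set \<open>{1..n}\<close> is identified with its edge set, a set of two-element subsets
  of \<open>{1..n}\<close> (a subset of \<open>nsets {1..n} 2\<close>). A degree sequence on \<open>{1..n}\<close> is a function
  \<open>d :: nat \<Rightarrow> nat\<close> of which only the values on \<open>{1..n}\<close> are used.
\<close>

definition degree_in :: "nat set set \<Rightarrow> nat \<Rightarrow> nat" where
  "degree_in E v = card {e \<in> E. v \<in> e}"

definition graphs_with_degrees :: "nat \<Rightarrow> (nat \<Rightarrow> nat) \<Rightarrow> nat set set set" where
  "graphs_with_degrees n d =
     {E. E \<subseteq> nsets {1..n} 2 \<and> (\<forall>v\<in>{1..n}. degree_in E v = d v)}"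

definition realisable :: "nat \<Rightarrow> (nat \<Rightarrow> nat) \<Rightarrow> bool" where
  "realisable n d \<longleftrightarrow> graphs_with_degrees n d \<noteq> {}"

text \<open>
  \<^const>\<open>bernoulli_pmf\<close> truncates its parameter to the unit interval, so this is the binomial random
  graph only for \<open>0 \<le> p \<le> 1\<close>.
\<close>

definition binomial_random_graph :: "nat \<Rightarrow> real \<Rightarrow> nat set set pmf" where
  "binomial_random_graph n p =
     map_pmf (\<lambda>X. {e. X e}) (Pi_pmf (nsets {1..n} 2) False (\<lambda>_. bernoulli_pmf p))"

text \<open>\<^const>\<open>pmf_of_set\<close> is meaningful on nonempty sets only, that is, for realisable \<open>d\<close>.\<close>

definition degree_random_graph :: "nat \<Rightarrow> (nat \<Rightarrow> nat) \<Rightarrow> nat set set pmf" where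
  "degree_random_graph n d = pmf_of_set (graphs_with_degrees n d)"

text \<open>For \<open>n = 0\<close> the next two quantities are junk; they only enter asymptotically.\<close>

definition max_deg :: "nat \<Rightarrow> (nat \<Rightarrow> nat) \<Rightarrow> nat" where
  "max_deg n d = Max (d ` {1..n})"

definition deg_range :: "nat \<Rightarrow> (nat \<Rightarrow> nat) \<Rightarrow> nat" where
  "deg_range n d = Max (d ` {1..n}) - Min (d ` {1..n})"

definition near_regular :: "(nat \<Rightarrow> nat \<Rightarrow> nat) \<Rightarrow> bool" where
  "near_regular d \<longleftrightarrow>
     (\<lambda>n. real (deg_range n (d n))) \<in> o(\<lambda>n. real (max_deg n (d n))) \<and>
     (\<lambda>n. real (deg_range n (d n))) \<in> o(\<lambda>n. real n - real (max_deg n (d n)))"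

text \<open>A coupling is represented by the joint law of the random triple.\<close>

definition is_coupling3 ::
    "('a \<times> 'b \<times> 'c) pmf \<Rightarrow> 'a pmf \<Rightarrow> 'b pmf \<Rightarrow> 'c pmf \<Rightarrow> bool" where
  "is_coupling3 J P Q R \<longleftrightarrow>
     map_pmf (\<lambda>(x, y, z). x) J = P \<and>
     map_pmf (\<lambda>(x, y, z). y) J = Q \<and>
     map_pmf (\<lambda>(x, y, z). z) J = R"

end

theory Submission
  imports Defs "HOL-Real_Asymp.Real_Asymp"
begin

text \<open>
  Let \<open>G\<close> be uniform with degrees \<open>d\<close>, of density \<open>\<alpha>\<close>, and let \<open>R\<close> be an independent random set of
  pairs of small density \<open>\<delta>\<close>. Expose the pairs outside \<open>R\<close> one by one. If at every step the next pair
  is an edge with conditional probability in \<open>[a, b]\<close>, then the exposure can be coupled with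
  independent coin flips of bias \<open>a\<close> and \<open>b\<close>; the lower graph takes nothing from \<open>R\<close> and the upper
  graph takes all of \<open>R\<close>, so both are exactly binomial.

  The conditional probability of \<open>{j, k}\<close> is found by switching \<open>{j, k}, {a, b}\<close> to
  \<open>{j, a}, {k, b}\<close> with the other three pairs in \<open>R\<close>: the numbers of switchings in the two
  directions are edge counts between neighbourhoods inside \<open>R\<close>, and their ratio is close to
  \<open>\<alpha> / (1 - \<alpha>)\<close> as soon as edge counts between large vertex sets are close to their means.
  This holds in the binomial graph of density \<open>\<alpha>\<close> up to a probability so small that
  it survives conditioning on the degree sequence, because that sequence is not too unlikely: tilt the
  edge probabilities so that the expected degrees lie slightly below \<open>d\<close> and repair the few missing
  degrees by local edits.
\<close>


section \<open>Random subsets\<close>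

text \<open>Why \<open>R\<close> is needed: a switching must not touch exposed pairs, and few pairs
  stay unexposed in the end. Pairs of \<open>R\<close> are never exposed, so every history leaves
  the same supply of switchings. The price is \<open>\<delta>\<close> in the upper density, hence
  \<open>\<delta>\<close> must be o(\<alpha>). A history may still be atypical. It is abandoned once
  bad graphs fill more than a fraction \<open>q\<close> of its class; by a Markov argument this has
  probability at most P(bad) / q, so \<open>q\<close> may be as small as a power of 1 / ln n. The
  hypotheses enter through conditioning on the degrees. With w = (ln n) powr (-1/16), both \<alpha>
  and 1 - \<alpha> are at least of order \<open>w ^ 8\<close> and the range is at most of order
  \<open>\<alpha> * n * w ^ 16\<close>. Discrepancy fails with probability O(4^n exp (- l)), where l
  is at least of order \<open>w ^ 36 * n ^ 2\<close>. Two losses compete with l: the tilt, of order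
  range^2 / (\<alpha> (1 - \<alpha>)), which is below l by a factor of order \<open>w ^ 4\<close>,
  and the repairs, of order \<open>w ^ 48 * n ^ 2\<close> in the exponent when degrees are lowered
  by about \<open>n * w ^ 64\<close>.\<close>

definition random_subset :: "'a set \<Rightarrow> ('a \<Rightarrow> real) \<Rightarrow> 'a set pmf" where
  "random_subset P f = map_pmf Collect (Pi_pmf P False (\<lambda>e. bernoulli_pmf (f e)))"

lemma binomial_random_graph_eq: "binomial_random_graph n p = random_subset (nsets {1..n} 2) (\<lambda>_. p)"
  by (simp add: binomial_random_graph_def random_subset_def)

lemma set_random_subset:
  assumes "finite P" "A \<in> set_pmf (random_subset P f)" shows "A \<subseteq> P"
  using set_Pi_pmf_subset[OF assms(1), of False "\<lambda>e. bernoulli_pmf (f e)"] assms(2)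
  by (auto simp: random_subset_def)

lemma random_subset_empty [simp]: "random_subset {} f = return_pmf {}"
  by (simp add: random_subset_def)

lemma random_subset_insert:
  assumes "finite P" "x \<notin> P"
  shows "random_subset (insert x P) f =
    bernoulli_pmf (f x) \<bind> (\<lambda>l. map_pmf (\<lambda>A. if l then insert x A else A) (random_subset P f))"
proof -
  have *: "Pi_pmf P False (\<lambda>e. bernoulli_pmf (f e)) \<bind> (\<lambda>g. return_pmf (Collect (g(x := l)))) =
     map_pmf (\<lambda>A. if l then insert x A else A) (random_subset P f)" for l
    unfolding random_subset_def map_pmf_comp
    unfolding map_pmf_def
  proof (intro bind_pmf_cong refl arg_cong[where f = return_pmf])
    fix g assume "g \<in> set_pmf (Pi_pmf P False (\<lambda>e. bernoulli_pmf (f e)))"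
    then have "\<not> g x"
      using set_Pi_pmf_subset[OF assms(1), of False "\<lambda>e. bernoulli_pmf (f e)"] assms(2) by auto
    then show "Collect (g(x := l)) = (if l then insert x (Collect g) else Collect g)"
      by (auto split: if_splits)
  qed
  have "random_subset (insert x P) f = map_pmf Collect
     (bernoulli_pmf (f x) \<bind> (\<lambda>l. Pi_pmf P False (\<lambda>e. bernoulli_pmf (f e)) \<bind>
        (\<lambda>g. return_pmf (g(x := l)))))"
    using assms by (simp add: random_subset_def Pi_pmf_insert')
  also have "\<dots> = bernoulli_pmf (f x) \<bind>
     (\<lambda>l. Pi_pmf P False (\<lambda>e. bernoulli_pmf (f e)) \<bind> (\<lambda>g. return_pmf (Collect (g(x := l)))))"
    by (simp add: map_bind_pmf)
  finally show ?thesis using * by simp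
qed

lemma pmf_random_subset:
  assumes "finite P" "A \<subseteq> P" "\<And>e. e \<in> P \<Longrightarrow> 0 \<le> f e \<and> f e \<le> 1"
  shows "pmf (random_subset P f) A = (\<Prod>e\<in>P. if e \<in> A then f e else 1 - f e)"
proof -
  have "pmf (random_subset P f) A = pmf (random_subset P f) (Collect (\<lambda>e. e \<in> A))" by simp
  also have "\<dots> = pmf (Pi_pmf P False (\<lambda>e. bernoulli_pmf (f e))) (\<lambda>e. e \<in> A)"
    unfolding random_subset_def by (rule pmf_map_inj') (auto simp: inj_def fun_eq_iff)
  also have "\<dots> = (\<Prod>e\<in>P. pmf (bernoulli_pmf (f e)) (e \<in> A))"
    using assms by (subst pmf_Pi) auto
  also have "\<dots> = (\<Prod>e\<in>P. if e \<in> A then f e else 1 - f e)"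
    using assms by (intro prod.cong) auto
  finally show ?thesis .
qed

lemma prob_random_subset:
  assumes "finite P"
  shows "measure_pmf.prob (random_subset P f) X = (\<Sum>A\<in>X \<inter> Pow P. pmf (random_subset P f) A)"
proof -
  have "measure_pmf.prob (random_subset P f) X = measure_pmf.prob (random_subset P f) (X \<inter> Pow P)"
    by (rule measure_prob_cong_0) (use set_random_subset[OF assms, of _ f] in \<open>auto simp: pmf_eq_0_set_pmf\<close>)
  also have "\<dots> = (\<Sum>A\<in>X \<inter> Pow P. pmf (random_subset P f) A)"
    using assms by (intro measure_measure_pmf_finite) auto
  finally show ?thesis .
qed

lemma bernoulli_mix:
  assumes "0 \<le> t" "t \<le> 1" "0 \<le> a" "a \<le> 1"
  shows "bernoulli_pmf t \<bind> (\<lambda>l. if l then return_pmf b else bernoulli_pmf a) =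
     bernoulli_pmf ((1 - t) * a + of_bool b * t)"
proof (rule pmf_eqI)
  fix c
  have "0 \<le> (1 - t) * a" "0 \<le> (1 - t) * (1 - a)" using assms by auto
  then have "0 \<le> (1 - t) * a + of_bool b * t" "(1 - t) * a + of_bool b * t \<le> 1"
    using assms by (auto simp: algebra_simps)
  then show "pmf (bernoulli_pmf t \<bind> (\<lambda>l. if l then return_pmf b else bernoulli_pmf a)) c =
     pmf (bernoulli_pmf ((1 - t) * a + of_bool b * t)) c"
    using assms by (cases c; cases b) (auto simp: pmf_bind algebra_simps)
qed

text \<open>Element by element: with probability \<open>t\<close> the element lies in
  \<open>R\<close> and its membership is the fixed bit \<open>b\<close>, otherwise it is a coin of
  bias \<open>a\<close>. The value \<open>b = False\<close> gives the marginal of the lower graph,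
  \<open>b = True\<close> that of the upper graph.\<close>

lemma random_subset_mix:
  assumes "finite P" "0 \<le> t" "t \<le> 1" "0 \<le> a" "a \<le> 1"
  shows "random_subset P (\<lambda>_. t) \<bind>
      (\<lambda>R. map_pmf (\<lambda>U. if b then U \<union> R else U) (random_subset (P - R) (\<lambda>_. a))) =
    random_subset P (\<lambda>_. (1 - t) * a + of_bool b * t)"
  using assms(1)
proof (induction P)
  case empty
  then show ?case by (simp add: bind_return_pmf)
next
  case (insert x P)
  let ?ins = "\<lambda>l. \<lambda>A. if l then Set.insert x A else A"
  let ?add = "\<lambda>R. \<lambda>U. if b then U \<union> R else U"
  let ?Q = "random_subset P (\<lambda>_. t)"
  have step: "map_pmf (?add (?ins l R)) (random_subset (Set.insert x P - ?ins l R) (\<lambda>_. a)) =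
      (if l then return_pmf b else bernoulli_pmf a) \<bind>
         (\<lambda>m. map_pmf (\<lambda>U. ?ins m (?add R U)) (random_subset (P - R) (\<lambda>_. a)))"
    if "R \<in> set_pmf ?Q" for l R
  proof -
    have "x \<notin> R" using set_random_subset[OF insert.hyps(1) that] insert.hyps(2) by auto
    then have "Set.insert x P - R = Set.insert x (P - R)"
      "Set.insert x P - Set.insert x R = P - R"
      using insert.hyps by auto
    moreover have "(\<lambda>A. ?add R (?ins m A)) = (\<lambda>U. ?ins m (?add R U))" for m
      by (cases m; cases b) auto
    moreover have "(\<lambda>A. ?add (Set.insert x R) A) = (\<lambda>U. ?ins b (?add R U))"
      by (cases b) auto
    ultimately show ?thesis using insert.hyps \<open>x \<notin> R\<close>
      by (cases l) (simp_all add: random_subset_insert bind_return_pmf map_bind_pmf map_pmf_comp)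
  qed
  have "random_subset (Set.insert x P) (\<lambda>_. t) \<bind>
      (\<lambda>R. map_pmf (?add R) (random_subset (Set.insert x P - R) (\<lambda>_. a)))
    = bernoulli_pmf t \<bind> (\<lambda>l. ?Q \<bind> (\<lambda>R. map_pmf (?add (?ins l R))
        (random_subset (Set.insert x P - ?ins l R) (\<lambda>_. a))))"
    using insert.hyps by (simp add: random_subset_insert bind_assoc_pmf bind_map_pmf)
  also have "\<dots> = bernoulli_pmf t \<bind> (\<lambda>l. ?Q \<bind> (\<lambda>R.
      (if l then return_pmf b else bernoulli_pmf a) \<bind>
         (\<lambda>m. map_pmf (\<lambda>U. ?ins m (?add R U)) (random_subset (P - R) (\<lambda>_. a)))))"
    using step by (intro bind_pmf_cong refl)
  \<comment> \<open>Whether \<open>x\<close> is taken does not depend on the rest of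
    \<open>R\<close>, so this coin can be drawn first; what remains inside is the induction
    hypothesis.\<close>
  also have "\<dots> = bernoulli_pmf t \<bind> (\<lambda>l. (if l then return_pmf b else bernoulli_pmf a) \<bind>
      (\<lambda>m. ?Q \<bind> (\<lambda>R. map_pmf (\<lambda>U. ?ins m (?add R U)) (random_subset (P - R) (\<lambda>_. a)))))"
    by (subst bind_commute_pmf) simp
  also have "\<dots> = bernoulli_pmf ((1 - t) * a + of_bool b * t) \<bind>
      (\<lambda>m. map_pmf (?ins m) (random_subset P (\<lambda>_. (1 - t) * a + of_bool b * t)))"
    by (subst bind_assoc_pmf [symmetric])
       (simp add: bernoulli_mix assms insert.IH [symmetric] map_bind_pmf map_pmf_comp)
  finally show ?case using insert.hyps by (simp add: random_subset_insert)
qed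

lemma Hoeffding_random_subset:
  fixes w :: "'a \<Rightarrow> real"
  assumes fin: "finite P" and f: "\<And>e. e \<in> P \<Longrightarrow> 0 \<le> f e \<and> f e \<le> 1"
    and w: "\<And>e. e \<in> P \<Longrightarrow> 0 \<le> w e"
    and V: "(\<Sum>e\<in>P. (w e)\<^sup>2) \<le> V" and t: "0 < t"
  shows "measure_pmf.prob (random_subset P f)
     {A. \<bar>(\<Sum>e\<in>P \<inter> A. w e) - (\<Sum>e\<in>P. f e * w e)\<bar> \<ge> t} \<le> 2 * exp (- 2 * t\<^sup>2 / V)"
\<comment> \<open>Hoeffding's bound divides by the sum of squares. If that sum vanishes, all weights
  do, and a deviation of at least \<open>t > 0\<close> is impossible.\<close>
proof (cases "(\<Sum>e\<in>P. (w e)\<^sup>2) = 0")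
  case True
  then have "w e = 0" if "e \<in> P" for e
    using that fin by (subst (asm) sum_nonneg_eq_0_iff) auto
  then have *: "{A. \<bar>(\<Sum>e\<in>P \<inter> A. w e) - (\<Sum>e\<in>P. f e * w e)\<bar> \<ge> t} = {}" using t by auto
  show ?thesis unfolding * by simp
next
  case False
  then have pos: "(\<Sum>e\<in>P. (w e - 0)\<^sup>2) > 0"
    by (simp add: less_le sum_nonneg)
  let ?M = "Pi_pmf P False (\<lambda>e. bernoulli_pmf (f e))"
  let ?X = "\<lambda>e g. if g e then w e else 0"
  interpret Hoeffding_ineq ?M P ?X "\<lambda>_. 0" w "\<Sum>e\<in>P. f e * w e"
  proof unfold_locales
    show "prob_space.indep_vars (measure_pmf ?M) (\<lambda>_. borel) ?X P"
      by (intro prob_space.indep_vars_compose2[OF _ indep_vars_Pi_pmf, where Y="\<lambda>e b. if b then w e else 0"])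
         (auto simp: measure_pmf.prob_space_axioms fin)
    fix e assume e: "e \<in> P"
    show "AE x in measure_pmf ?M. ?X e x \<in> {0..w e}" using w[OF e] by auto
  next
    have "measure_pmf.expectation ?M (?X e) = f e * w e" if e: "e \<in> P" for e
    proof -
      have "measure_pmf.expectation ?M (?X e) =
         measure_pmf.expectation (map_pmf (\<lambda>g. g e) ?M) (\<lambda>b. if b then w e else 0)"
        by simp
      also have "map_pmf (\<lambda>g. g e) ?M = bernoulli_pmf (f e)"
        using fin e by (subst Pi_pmf_component) auto
      finally show ?thesis using f[OF e] by simp
    qed
    then show "(\<Sum>e\<in>P. f e * w e) \<equiv> \<Sum>i\<in>P. measure_pmf.expectation ?M (?X i)" by simp
  qed (use fin in auto)
  have eq: "(\<Sum>e\<in>P \<inter> Collect g. w e) = (\<Sum>e\<in>P. ?X e g)" for g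
    using fin by (simp add: sum.If_cases)
  have "measure_pmf.prob (random_subset P f)
     {A. \<bar>(\<Sum>e\<in>P \<inter> A. w e) - (\<Sum>e\<in>P. f e * w e)\<bar> \<ge> t}
     = measure_pmf.prob ?M {g\<in>space ?M. \<bar>(\<Sum>e\<in>P. ?X e g) - (\<Sum>e\<in>P. f e * w e)\<bar> \<ge> t}"
    unfolding random_subset_def measure_map_pmf vimage_def by (simp add: eq)
  also have "\<dots> \<le> 2 * exp (-2 * t\<^sup>2 / (\<Sum>e\<in>P. (w e - 0)\<^sup>2))"
    using Hoeffding_ineq_abs_ge[OF _ pos, of t] t by simp
  also have "\<dots> \<le> 2 * exp (- 2 * t\<^sup>2 / V)"
  proof -
    have "2 * t\<^sup>2 / V \<le> 2 * t\<^sup>2 / (\<Sum>e\<in>P. (w e - 0)\<^sup>2)"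
      using V pos by (intro divide_left_mono) auto
    then show ?thesis by simp
  qed
  finally show ?thesis .
qed


section \<open>Sequential coupling\<close>

lemma bernoulli_pmf_0: "bernoulli_pmf 0 = return_pmf False"
  by (intro pmf_eqI, rename_tac b, case_tac b) auto

lemma bernoulli_pmf_1: "bernoulli_pmf 1 = return_pmf True"
  by (intro pmf_eqI, rename_tac b, case_tac b) auto

text \<open>Thinning: a lower coin that can only succeed when the true one \<open>g\<close> does, so
  the lower graph stays inside \<open>G\<close>.\<close>

lemma bernoulli_coupling_lower:
  assumes "0 \<le> a" "a \<le> x" "x \<le> 1"
  shows "bernoulli_pmf x \<bind> (\<lambda>g. bernoulli_pmf (if g then a / x else 0)) = bernoulli_pmf a"
proof (cases "x = 0")
  case True
  then show ?thesis using assms by (simp add: bernoulli_pmf_0 bind_return_pmf)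
next
  case False
  then have *: "0 \<le> a / x" "a / x \<le> 1" using assms by auto
  show ?thesis
    by (rule pmf_eqI, rename_tac b, case_tac b)
       (use assms * False in \<open>auto simp: pmf_bind field_simps\<close>)
qed

text \<open>Sprinkling: the upper coin copies every success of \<open>g\<close> and adds some where
  \<open>g\<close> fails. For \<open>x = 1\<close> there are no failures, so the quotient with zero
  denominator is never consulted.\<close>

lemma bernoulli_coupling_upper:
  assumes "0 \<le> x" "x \<le> b" "b \<le> 1"
  shows "bernoulli_pmf x \<bind> (\<lambda>g. bernoulli_pmf (if g then 1 else (b - x) / (1 - x))) = bernoulli_pmf b"
proof (cases "x = 1")
  case True
  then show ?thesis using assms by (simp add: bernoulli_pmf_1 bind_return_pmf)
next
  case False
  then have *: "0 \<le> (b - x) / (1 - x)" "(b - x) / (1 - x) \<le> 1" "1 - x \<noteq> 0" using assms by auto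
  then have "(1 - x) * ((b - x) / (1 - x)) = b - x" by simp
  then have "x + (1 - x) * ((b - x) / (1 - x)) = b" 
    "(1 - x) * (1 - (b - x) / (1 - x)) = 1 - b" by (auto simp: right_diff_distrib)
  then show ?thesis
    by (intro pmf_eqI, rename_tac c, case_tac c)
       (use assms * False in \<open>auto simp: pmf_bind mult.commute\<close>)
qed

text \<open>One exposure step: reveal the bit \<open>Q G\<close> with its true probability and stay
  uniform on the compatible class. If one class is empty, the meaningless
  \<open>pmf_of_set {}\<close> carries weight 0, which is why emptiness is treated separately
  below.\<close>

lemma pmf_of_set_split:
  assumes "finite C" "C \<noteq> {}"
  shows "bernoulli_pmf (card {G \<in> C. Q G} / card C) \<bind> (\<lambda>g. pmf_of_set {G \<in> C. Q G = g}) = pmf_of_set C"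
proof (rule pmf_eqI)
  fix G
  define x :: real where "x = card {G \<in> C. Q G} / card C"
  have "card {G \<in> C. Q G} \<le> card C" by (rule card_mono) (use assms in auto)
  moreover have cC: "card C > 0" using assms by auto
  ultimately have x: "0 \<le> x" "x \<le> 1" by (auto simp: x_def)
  have "card C = card {G \<in> C. Q G} + card {G \<in> C. \<not> Q G}"
    using assms by (subst card_Un_disjoint [symmetric]) (auto intro: arg_cong[where f = card])
  then have "real (card {G \<in> C. \<not> Q G}) = real (card C) - real (card {G \<in> C. Q G})" by simp
  then have x': "1 - x = card {G \<in> C. \<not> Q G} / card C"
    using cC by (simp add: x_def diff_divide_distrib)
  have "pmf (bernoulli_pmf x \<bind> (\<lambda>g. pmf_of_set {G \<in> C. Q G = g})) G =
     x * pmf (pmf_of_set {G \<in> C. Q G}) G + (1 - x) * pmf (pmf_of_set {G \<in> C. \<not> Q G}) G"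
    using x by (simp add: pmf_bind)
  also have "x * pmf (pmf_of_set {G \<in> C. Q G}) G = indicator {G \<in> C. Q G} G / card C"
    using assms cC by (cases "{G \<in> C. Q G} = {}") (auto simp: x_def pmf_of_set indicator_def)
  also have "(1 - x) * pmf (pmf_of_set {G \<in> C. \<not> Q G}) G = indicator {G \<in> C. \<not> Q G} G / card C"
    unfolding x' using assms cC by (cases "{G \<in> C. \<not> Q G} = {}") (auto simp: pmf_of_set indicator_def)
  also have "indicator {G \<in> C. Q G} G / card C + indicator {G \<in> C. \<not> Q G} G / card C = pmf (pmf_of_set C) G"
    using assms by (auto simp: indicator_def)
  finally show "pmf (bernoulli_pmf (card {G \<in> C. Q G} / card C) \<bind> (\<lambda>g. pmf_of_set {G \<in> C. Q G = g})) G =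
     pmf (pmf_of_set C) G" by (simp add: x_def)
qed

text \<open>The set \<open>A\<close> consists of the exposed pairs, \<open>h\<close> of the edges
  found among them, and \<open>C'\<close> of the graphs compatible with this history. The edge
  probabilities are controlled only while \<open>B\<close> occupies at most the fraction
  \<open>q\<close> of \<open>C'\<close>. The first time this fails, the whole class is put into
  \<open>Bad\<close>. Abandoned classes are disjoint and each satisfies
  \<open>q * card C' < card (C' \<inter> B)\<close>, so the inequality for \<open>Bad\<close> adds
  up along the exposure tree.\<close>

lemma sequential_coupling:
  fixes a b q :: real
  assumes "finite C" "C \<noteq> {}" "distinct es" and ab: "0 \<le> a" "a \<le> b" "b \<le> 1"
    and "\<And>A h e C'. e \<in> set es \<Longrightarrow> A \<subseteq> set es - {e} \<Longrightarrow> C' = {G \<in> C. G \<inter> A = h} \<Longrightarrow> C' \<noteq> {} \<Longrightarrow>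
      card (C' \<inter> B) \<le> q * card C' \<Longrightarrow>
      a * card C' \<le> card {G \<in> C'. e \<in> G} \<and> card {G \<in> C'. e \<in> G} \<le> b * card C'"
  shows "\<exists>J Bad. is_coupling3 J (random_subset (set es) (\<lambda>_. a)) (pmf_of_set C)
       (random_subset (set es) (\<lambda>_. b)) \<and> Bad \<subseteq> C \<and> q * card Bad \<le> card (C \<inter> B) \<and>
     (\<forall>(L, G, U) \<in> set_pmf J. G \<notin> Bad \<longrightarrow> L \<subseteq> G \<and> G \<inter> set es \<subseteq> U)"
  using assms(1-3,7)
proof (induction es arbitrary: C)
  case Nil
  then show ?case
    by (intro exI[of _ "map_pmf (\<lambda>G. ({}, G, {})) (pmf_of_set C)"] exI[of _ "{}"])
       (auto simp: is_coupling3_def map_pmf_comp)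
next
  case (Cons e es C)
  let ?RL = "random_subset (set (e # es)) (\<lambda>_. a)" and ?RU = "random_subset (set (e # es)) (\<lambda>_. b)"
  show ?case
  proof (cases "card (C \<inter> B) \<le> q * card C")
    case False
    \<comment> \<open>An abandoned history: the three laws are made independent, and
      \<open>Bad\<close> is all of \<open>C\<close>.\<close>
    define J where "J = pmf_of_set C \<bind> (\<lambda>G. ?RL \<bind> (\<lambda>L. map_pmf (\<lambda>U. (L, G, U)) ?RU))"
    have "is_coupling3 J ?RL (pmf_of_set C) ?RU"
      by (simp add: is_coupling3_def J_def map_bind_pmf map_pmf_comp bind_return_pmf')
    moreover have "\<forall>(L, G, U) \<in> set_pmf J. G \<in> C" using Cons.prems by (auto simp: J_def)
    ultimately show ?thesis using False
      by (intro exI[of _ J] exI[of _ C]) auto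
  next
    case True
    define x :: real where "x = card {G \<in> C. e \<in> G} / card C"
    have cC: "card C > 0" using Cons.prems by auto
    have "a * card C \<le> card {G \<in> C. e \<in> G} \<and> card {G \<in> C. e \<in> G} \<le> b * card C"
      by (rule Cons.prems(4)[of e "{}" C "{}"]) (use Cons.prems True in auto)
    then have x: "a \<le> x" "x \<le> b" using cC by (auto simp: x_def field_simps)
    then have x01: "0 \<le> x" "x \<le> 1" using ab by auto
    define D where "D g = {G \<in> C. (e \<in> G) = g}" for g
    let ?rl = "random_subset (set es) (\<lambda>_. a)" and ?ru = "random_subset (set es) (\<lambda>_. b)"
    \<comment> \<open>Stated for both values of \<open>g\<close>, so that \<open>J\<close> and
      \<open>Bad\<close> can be chosen as functions of \<open>g\<close>. If \<open>D g\<close> is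
      empty this branch is entered with probability 0, and only the two binomial marginals have to
      be right.\<close>
    have "\<exists>J Bad. map_pmf (\<lambda>(x, y, z). x) J = ?rl \<and> map_pmf (\<lambda>(x, y, z). z) J = ?ru \<and>
        (D g \<noteq> {} \<longrightarrow> map_pmf (\<lambda>(x, y, z). y) J = pmf_of_set (D g)) \<and>
        Bad \<subseteq> D g \<and> q * card Bad \<le> card (D g \<inter> B) \<and>
        (D g \<noteq> {} \<longrightarrow> (\<forall>(L, G, U) \<in> set_pmf J. G \<notin> Bad \<longrightarrow> L \<subseteq> G \<and> G \<inter> set es \<subseteq> U))" for g
    proof (cases "D g = {}")
      case True
      then show ?thesis
        by (intro exI[of _ "?rl \<bind> (\<lambda>L. map_pmf (\<lambda>U. (L, {}, U)) ?ru)"] exI[of _ "{}"])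
           (auto simp: map_bind_pmf map_pmf_comp bind_return_pmf')
    next
      case False
      have "\<exists>J Bad. is_coupling3 J ?rl (pmf_of_set (D g)) ?ru \<and>
          Bad \<subseteq> D g \<and> q * card Bad \<le> card (D g \<inter> B) \<and>
          (\<forall>(L, G, U) \<in> set_pmf J. G \<notin> Bad \<longrightarrow> L \<subseteq> G \<and> G \<inter> set es \<subseteq> U)"
      proof (rule Cons.IH)
        fix A h e' C'
        assume *: "e' \<in> set es" "A \<subseteq> set es - {e'}" "C' = {G \<in> D g. G \<inter> A = h}" "C' \<noteq> {}"
          "card (C' \<inter> B) \<le> q * card C'"
        have eA: "e \<notin> A" using * Cons.prems(3) by auto
        then have "e \<notin> h" using * by auto
        \<comment> \<open>A history inside \<open>D g\<close> is a history inside \<open>C\<close>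
          with \<open>e\<close> exposed as well, recorded as an edge exactly if \<open>g\<close>
          holds.\<close>
        then have "C' = {G \<in> C. G \<inter> Set.insert e A = (if g then Set.insert e h else h)}"
          using eA by (auto simp: *(3) D_def split: if_splits)
        then show "a * card C' \<le> card {G \<in> C'. e' \<in> G} \<and> card {G \<in> C'. e' \<in> G} \<le> b * card C'"
          using * Cons.prems(3)
          by (intro Cons.prems(4)[of e' "Set.insert e A" C' "if g then Set.insert e h else h"]) auto
      qed (use Cons.prems False in \<open>auto simp: D_def\<close>)
      then show ?thesis by (auto simp: is_coupling3_def)
    qed
    then obtain J Bad where J: "\<And>g. map_pmf (\<lambda>(x, y, z). x) (J g) = ?rl"
        "\<And>g. map_pmf (\<lambda>(x, y, z). z) (J g) = ?ru"
        "\<And>g. D g \<noteq> {} \<Longrightarrow> map_pmf (\<lambda>(x, y, z). y) (J g) = pmf_of_set (D g)"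
      and Bad: "\<And>g. Bad g \<subseteq> D g" "\<And>g. q * card (Bad g) \<le> card (D g \<inter> B)"
      and sub: "\<And>g L G U. D g \<noteq> {} \<Longrightarrow> (L, G, U) \<in> set_pmf (J g) \<Longrightarrow> G \<notin> Bad g \<Longrightarrow>
        L \<subseteq> G \<and> G \<inter> set es \<subseteq> U"
      by (metis (no_types, lifting) case_prodD)
    let ?ins = "\<lambda>l. \<lambda>A. if l then Set.insert e A else A"
    define l1 where "l1 g = (if g then a / x else 0)" for g
    define u1 where "u1 g = (if g then 1 else (b - x) / (1 - x))" for g
    \<comment> \<open>The coin \<open>g\<close> decides \<open>e\<close> for \<open>G\<close>. The
      lower and upper coins depend on \<open>g\<close> alone, and
      \<open>l \<longrightarrow> g \<longrightarrow> u\<close> holds almost surely.\<close>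
    define K where "K = bernoulli_pmf x \<bind> (\<lambda>g. bernoulli_pmf (l1 g) \<bind> (\<lambda>l. bernoulli_pmf (u1 g) \<bind>
       (\<lambda>u. map_pmf (\<lambda>(L, G, U). (?ins l L, G, ?ins u U)) (J g))))"
    have D_nonempty: "D g \<noteq> {}" if "g \<in> set_pmf (bernoulli_pmf x)" for g
    proof -
      have fin: "finite C" using Cons.prems by auto
      have "{G \<in> C. e \<in> G} = {} \<Longrightarrow> x = 0"
        by (simp only: x_def card.empty of_nat_0 div_0)
      moreover have "D False = {} \<Longrightarrow> {G \<in> C. e \<in> G} = C" by (auto simp: D_def)
      then have "D False = {} \<Longrightarrow> x = 1" using cC by (simp add: x_def)
      ultimately show ?thesis using that x01
        by (cases g) (auto simp: D_def set_pmf_bernoulli bernoulli_pmf_0 bernoulli_pmf_1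
          simp del: Collect_empty_eq)
    qed
    have "map_pmf (\<lambda>(x, y, z). x) K = bernoulli_pmf x \<bind> (\<lambda>g. bernoulli_pmf (l1 g) \<bind>
       (\<lambda>l. map_pmf (?ins l) (map_pmf (\<lambda>(x, y, z). x) (J g))))"
      unfolding K_def by (simp add: map_bind_pmf map_pmf_comp case_prod_unfold)
    also have "\<dots> = (bernoulli_pmf x \<bind> (\<lambda>g. bernoulli_pmf (l1 g))) \<bind> (\<lambda>l. map_pmf (?ins l) ?rl)"
      by (simp add: bind_assoc_pmf J)
    also have "bernoulli_pmf x \<bind> (\<lambda>g. bernoulli_pmf (l1 g)) = bernoulli_pmf a"
      unfolding l1_def using ab x x01 by (intro bernoulli_coupling_lower) auto
    also have "bernoulli_pmf a \<bind> (\<lambda>l. map_pmf (?ins l) ?rl) = ?RL"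
      using Cons.prems(3) by (simp add: random_subset_insert)
    finally have m1: "map_pmf (\<lambda>(x, y, z). x) K = ?RL" .
    have "map_pmf (\<lambda>(x, y, z). z) K = bernoulli_pmf x \<bind> (\<lambda>g. bernoulli_pmf (u1 g) \<bind>
       (\<lambda>u. map_pmf (?ins u) (map_pmf (\<lambda>(x, y, z). z) (J g))))"
      unfolding K_def by (simp add: map_bind_pmf map_pmf_comp case_prod_unfold)
    also have "\<dots> = (bernoulli_pmf x \<bind> (\<lambda>g. bernoulli_pmf (u1 g))) \<bind> (\<lambda>l. map_pmf (?ins l) ?ru)"
      by (simp add: bind_assoc_pmf J)
    also have "bernoulli_pmf x \<bind> (\<lambda>g. bernoulli_pmf (u1 g)) = bernoulli_pmf b"
      unfolding u1_def using ab x x01 by (intro bernoulli_coupling_upper) auto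
    also have "bernoulli_pmf b \<bind> (\<lambda>l. map_pmf (?ins l) ?ru) = ?RU"
      using Cons.prems(3) by (simp add: random_subset_insert)
    finally have m3: "map_pmf (\<lambda>(x, y, z). z) K = ?RU" .
    have "map_pmf (\<lambda>(x, y, z). y) K = bernoulli_pmf x \<bind> (\<lambda>g. map_pmf (\<lambda>(x, y, z). y) (J g))"
      unfolding K_def by (simp add: map_bind_pmf map_pmf_comp case_prod_unfold)
    also have "\<dots> = bernoulli_pmf x \<bind> (\<lambda>g. pmf_of_set (D g))"
      using J(3) D_nonempty by (intro bind_pmf_cong) auto
    also have "\<dots> = pmf_of_set C"
      unfolding x_def D_def by (rule pmf_of_set_split) (use Cons.prems in auto)
    finally have m2: "map_pmf (\<lambda>(x, y, z). y) K = pmf_of_set C" .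
    have DC: "D True \<inter> D False = {}" "D True \<union> D False = C" "finite C"
      using Cons.prems by (auto simp: D_def)
    have finB: "finite (Bad g)" for g
      by (rule finite_subset[of _ C]) (use Bad(1)[of g] Cons.prems in \<open>auto simp: D_def\<close>)
    have "q * card (Bad True \<union> Bad False) = q * card (Bad True) + q * card (Bad False)"
      using Bad(1)[of True] Bad(1)[of False] DC finB
      by (subst card_Un_disjoint) (auto simp: algebra_simps)
    also have "\<dots> \<le> card (D True \<inter> B) + card (D False \<inter> B)"
      using Bad(2)[of True] Bad(2)[of False] by linarith
    also have "\<dots> = card (C \<inter> B)"
    proof -
      have fD: "finite (D g)" for g using Cons.prems by (auto simp: D_def)
      have "C \<inter> B = (D True \<inter> B) \<union> (D False \<inter> B)" using DC by auto
      then show ?thesis using DC fD by (simp add: card_Un_disjoint Int_ac disjoint_iff)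
    qed
    finally have cB: "q * card (Bad True \<union> Bad False) \<le> card (C \<inter> B)" .
    have s: "L \<subseteq> G \<and> G \<inter> set (e # es) \<subseteq> U"
      if "(L, G, U) \<in> set_pmf K" "G \<notin> Bad True \<union> Bad False" for L G U
    proof -
      from that(1) obtain g l u L' U' where g: "g \<in> set_pmf (bernoulli_pmf x)"
        and l: "l \<in> set_pmf (bernoulli_pmf (l1 g))" and u: "u \<in> set_pmf (bernoulli_pmf (u1 g))"
        and K: "(L', G, U') \<in> set_pmf (J g)" "L = ?ins l L'" "U = ?ins u U'"
        unfolding K_def by auto
      have ne: "D g \<noteq> {}" using g D_nonempty by auto
      have "L' \<subseteq> G \<and> G \<inter> set es \<subseteq> U'"
        by (rule sub[OF ne K(1)]) (use that(2) in \<open>cases g; simp\<close>)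
      moreover have "G \<in> D g"
      proof -
        have "G \<in> set_pmf (map_pmf (\<lambda>(x, y, z). y) (J g))" using K(1) by force
        then have "G \<in> set_pmf (pmf_of_set (D g))" using J(3)[OF ne] by simp
        then show ?thesis using ne DC(3) by (subst (asm) set_pmf_of_set) (auto simp: D_def)
      qed
      moreover have "l \<longrightarrow> g" using l by (cases g) (auto simp: l1_def bernoulli_pmf_0)
      moreover have "g \<longrightarrow> u" using u by (cases g) (auto simp: u1_def bernoulli_pmf_1)
      ultimately show ?thesis using K(2,3) by (auto simp: D_def)
    qed
    have "is_coupling3 K ?RL (pmf_of_set C) ?RU"
      unfolding is_coupling3_def by (intro conjI m1 m2 m3)
    moreover have "Bad True \<union> Bad False \<subseteq> C" using Bad(1)[of True] Bad(1)[of False] DC by auto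
    moreover have "\<forall>(L, G, U) \<in> set_pmf K. G \<notin> Bad True \<union> Bad False \<longrightarrow>
        L \<subseteq> G \<and> G \<inter> set (e # es) \<subseteq> U"
      using s by blast
    ultimately show ?thesis using cB by blast
  qed
qed

section \<open>Averaging over the unexposed set\<close>

lemma prob_pair_pmf:
  "measure_pmf.prob (pair_pmf M N) X =
    measure_pmf.expectation M (\<lambda>x. measure_pmf.prob N {y. (x, y) \<in> X})"
proof -
  have "emeasure (pair_pmf M N) X = (\<integral>\<^sup>+x. emeasure N {y. (x, y) \<in> X} \<partial>M)"
  proof -
    have "emeasure (pair_pmf M N) X = (\<integral>\<^sup>+z. indicator X z \<partial>pair_pmf M N)" by simp
    also have "\<dots> = (\<integral>\<^sup>+x. \<integral>\<^sup>+y. indicator X (x, y) \<partial>N \<partial>M)" by (rule nn_integral_pair_pmf')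
    also have "\<dots> = (\<integral>\<^sup>+x. \<integral>\<^sup>+y. indicator {y. (x, y) \<in> X} y \<partial>N \<partial>M)"
      by (intro nn_integral_cong) (auto simp: indicator_def)
    finally show ?thesis by simp
  qed
  also have "\<dots> = ennreal (measure_pmf.expectation M (\<lambda>x. measure_pmf.prob N {y. (x, y) \<in> X}))"
    by (subst nn_integral_eq_integral [symmetric])
       (auto simp: measure_pmf.emeasure_eq_measure intro!: measure_pmf.integrable_const_bound[where B = 1])
  finally show ?thesis
    by (simp add: measure_pmf.emeasure_eq_measure)
qed

text \<open>Sequential coupling for each fixed \<open>R\<close>, mixed over a random
  \<open>R\<close>. For every \<open>R\<close> the middle marginal is uniform on \<open>C\<close>,
  so \<open>R\<close> and \<open>G\<close> are independent, and the failure probability is computed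
  on a product law. Adding all of \<open>R\<close> to the upper graph and nothing of it to the lower
  one gives exact binomial marginals by \<open>random_subset_mix\<close>.\<close>

lemma sandwich_coupling:
  fixes a b q t :: real and B :: "'a set \<Rightarrow> 'a set set"
  assumes P: "finite P" and C: "C \<subseteq> Pow P" "C \<noteq> {}"
    and ab: "0 \<le> a" "a \<le> b" "b \<le> 1" and t: "0 \<le> t" "t \<le> 1" and q: "0 < q"
    and step: "\<And>R A h e C'. R \<subseteq> P \<Longrightarrow> e \<in> P - R \<Longrightarrow> A \<subseteq> P - R - {e} \<Longrightarrow>
      C' = {G \<in> C. G \<inter> A = h} \<Longrightarrow> C' \<noteq> {} \<Longrightarrow> card (C' \<inter> B R) \<le> q * card C' \<Longrightarrow>
      a * card C' \<le> card {G \<in> C'. e \<in> G} \<and> card {G \<in> C'. e \<in> G} \<le> b * card C'"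
  shows "\<exists>J. is_coupling3 J (random_subset P (\<lambda>_. (1 - t) * a)) (pmf_of_set C)
       (random_subset P (\<lambda>_. t + (1 - t) * b)) \<and>
     1 - measure_pmf.prob (pair_pmf (random_subset P (\<lambda>_. t)) (pmf_of_set C)) {(R, G). G \<in> B R} / q
       \<le> measure_pmf.prob J {(L, G, U). L \<subseteq> G \<and> G \<subseteq> U}"
proof -
  have finC: "finite C" using C P by (meson finite_Pow_iff finite_subset)
  let ?Q = "random_subset P (\<lambda>_. t)"
  have "\<exists>J Bad. is_coupling3 J (random_subset (P - R) (\<lambda>_. a)) (pmf_of_set C)
         (random_subset (P - R) (\<lambda>_. b)) \<and> Bad \<subseteq> C \<and> q * card Bad \<le> card (C \<inter> B R) \<and>
       (\<forall>(L, G, U) \<in> set_pmf J. G \<notin> Bad \<longrightarrow> L \<subseteq> G \<and> G \<inter> (P - R) \<subseteq> U)" if R: "R \<subseteq> P" for R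
  proof -
    obtain es where es: "set es = P - R" "distinct es"
      using finite_distinct_list[of "P - R"] P by auto
    show ?thesis unfolding es(1) [symmetric]
      by (rule sequential_coupling[OF finC C(2) es(2) ab], rule step[of R])
         (use R es in auto)
  qed
  then obtain J Bad where J: "\<And>R. R \<subseteq> P \<Longrightarrow> is_coupling3 (J R) (random_subset (P - R) (\<lambda>_. a))
       (pmf_of_set C) (random_subset (P - R) (\<lambda>_. b))"
    and Bad: "\<And>R. R \<subseteq> P \<Longrightarrow> Bad R \<subseteq> C" "\<And>R. R \<subseteq> P \<Longrightarrow> q * card (Bad R) \<le> card (C \<inter> B R)"
    and sub: "\<And>R L G U. R \<subseteq> P \<Longrightarrow> (L, G, U) \<in> set_pmf (J R) \<Longrightarrow> G \<notin> Bad R \<Longrightarrow>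
       L \<subseteq> G \<and> G \<inter> (P - R) \<subseteq> U"
    by (metis (no_types, lifting) case_prodD)
  have RP: "R \<subseteq> P" if "R \<in> set_pmf ?Q" for R using set_random_subset[OF P that] .
  define K where "K = ?Q \<bind> (\<lambda>R. map_pmf (Pair R) (J R))"
  define Jt where "Jt = map_pmf (\<lambda>(R, L, G, U). (L, G, U \<union> R)) K"
  have "map_pmf (\<lambda>(x, y, z). x) Jt = ?Q \<bind> (\<lambda>R. map_pmf (\<lambda>(x, y, z). x) (J R))"
    by (simp add: Jt_def K_def map_bind_pmf map_pmf_comp case_prod_unfold)
  also have "\<dots> = ?Q \<bind> (\<lambda>R. random_subset (P - R) (\<lambda>_. a))"
    using J RP by (intro bind_pmf_cong refl) (auto simp: is_coupling3_def)
  finally have m1: "map_pmf (\<lambda>(x, y, z). x) Jt = random_subset P (\<lambda>_. (1 - t) * a)"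
    using random_subset_mix[OF P t, of a False] ab by simp
  have "map_pmf (\<lambda>(x, y, z). z) Jt =
      ?Q \<bind> (\<lambda>R. map_pmf (\<lambda>U. U \<union> R) (map_pmf (\<lambda>(x, y, z). z) (J R)))"
    by (simp add: Jt_def K_def map_bind_pmf map_pmf_comp case_prod_unfold)
  also have "\<dots> = ?Q \<bind> (\<lambda>R. map_pmf (\<lambda>U. U \<union> R) (random_subset (P - R) (\<lambda>_. b)))"
    using J RP by (intro bind_pmf_cong refl) (auto simp: is_coupling3_def)
  finally have m3: "map_pmf (\<lambda>(x, y, z). z) Jt = random_subset P (\<lambda>_. t + (1 - t) * b)"
    using random_subset_mix[OF P t, of b True] ab by (simp add: add.commute)
  have "map_pmf (\<lambda>(R, L, G, U). (R, G)) K =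
      ?Q \<bind> (\<lambda>R. map_pmf (Pair R) (map_pmf (\<lambda>(x, y, z). y) (J R)))"
    by (simp add: K_def map_bind_pmf map_pmf_comp case_prod_unfold)
  also have "\<dots> = ?Q \<bind> (\<lambda>R. map_pmf (Pair R) (pmf_of_set C))"
    using J RP by (intro bind_pmf_cong refl) (auto simp: is_coupling3_def)
  finally have RG: "map_pmf (\<lambda>(R, L, G, U). (R, G)) K = pair_pmf ?Q (pmf_of_set C)"
    by (simp add: pair_pmf_def map_pmf_def)
  have "map_pmf (\<lambda>(x, y, z). y) Jt = map_pmf snd (map_pmf (\<lambda>(R, L, G, U). (R, G)) K)"
    by (simp add: Jt_def map_pmf_comp case_prod_unfold)
  then have m2: "map_pmf (\<lambda>(x, y, z). y) Jt = pmf_of_set C"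
    by (simp add: RG map_snd_pair_pmf)
  let ?Good = "{(L, G, U). L \<subseteq> G \<and> G \<subseteq> U}"
  have "measure_pmf.prob Jt (- ?Good) = measure_pmf.prob K ((\<lambda>(R, L, G, U). (L, G, U \<union> R)) -` (- ?Good))"
    by (simp add: Jt_def)
  also have "\<dots> \<le> measure_pmf.prob K ((\<lambda>(R, L, G, U). (R, G)) -` {(R, G). G \<in> Bad R})"
  proof (intro measure_pmf.finite_measure_mono_AE AE_pmfI impI)
    fix z assume z: "z \<in> set_pmf K" "z \<in> (\<lambda>(R, L, G, U). (L, G, U \<union> R)) -` (- ?Good)"
    obtain R L G U where zz: "z = (R, L, G, U)" by (cases z)
    have "R \<in> set_pmf ?Q" and K: "(L, G, U) \<in> set_pmf (J R)" using z zz by (auto simp: K_def)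
    then have R: "R \<subseteq> P" using RP by auto
    have "G \<in> set_pmf (map_pmf (\<lambda>(x, y, z). y) (J R))" using K by force
    then have "G \<in> set_pmf (pmf_of_set C)" using J[OF R] unfolding is_coupling3_def by metis
    then have "G \<in> C" using finC C by simp
    then have "G \<subseteq> P" using C by auto
    moreover have "\<not> (L \<subseteq> G \<and> G \<subseteq> U \<union> R)" using z zz by auto
    \<comment> \<open>Pairs in \<open>R\<close> cannot cause a failure, as they all belong to
      \<open>U \<union> R\<close>; on \<open>P - R\<close> the containments hold unless
      \<open>G\<close> is in \<open>Bad R\<close>.\<close>
    ultimately have "G \<in> Bad R" using sub[OF R K] by blast
    then show "z \<in> (\<lambda>(R, L, G, U). (R, G)) -` {(R, G). G \<in> Bad R}" using zz by auto
  qed auto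
  also have "\<dots> = measure_pmf.prob (pair_pmf ?Q (pmf_of_set C)) {(R, G). G \<in> Bad R}"
    by (simp flip: RG)
  also have "\<dots> = measure_pmf.expectation ?Q (\<lambda>R. measure_pmf.prob (pmf_of_set C) (Bad R))"
    by (simp add: prob_pair_pmf)
  also have "\<dots> \<le> measure_pmf.expectation ?Q (\<lambda>R. measure_pmf.prob (pmf_of_set C) (B R) / q)"
  proof (intro integral_mono_AE AE_pmfI)
    fix R assume "R \<in> set_pmf ?Q"
    then have R: "R \<subseteq> P" using RP by auto
    have cC: "card C > 0" using C finC by auto
    have "q * card (C \<inter> Bad R) \<le> card (C \<inter> B R)" using Bad[OF R] by (simp add: Int_absorb1)
    then have "card (C \<inter> Bad R) / card C \<le> card (C \<inter> B R) / q / card C"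
      using q by (intro divide_right_mono) (auto simp: field_simps)
    then show "measure_pmf.prob (pmf_of_set C) (Bad R) \<le> measure_pmf.prob (pmf_of_set C) (B R) / q"
      using finC C by (simp add: measure_pmf_of_set mult.commute)
  next
    show "integrable ?Q (\<lambda>R. measure_pmf.prob (pmf_of_set C) (B R) / q)"
    proof (rule measure_pmf.integrable_const_bound[where B = "1 / q"])
      show "AE R in ?Q. norm (measure_pmf.prob (pmf_of_set C) (B R) / q) \<le> 1 / q"
        by (intro AE_pmfI) (use q in \<open>simp add: divide_right_mono\<close>)
    qed auto
  qed (auto intro!: measure_pmf.integrable_const_bound[where B = 1])
  also have "\<dots> = measure_pmf.prob (pair_pmf ?Q (pmf_of_set C)) {(R, G). G \<in> B R} / q"
    by (simp add: prob_pair_pmf)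
  finally have "1 - measure_pmf.prob (pair_pmf ?Q (pmf_of_set C)) {(R, G). G \<in> B R} / q
      \<le> measure_pmf.prob Jt ?Good"
    using measure_pmf.prob_compl[of ?Good Jt] by (simp add: Compl_eq_Diff_UNIV)
  then show ?thesis
    using m1 m2 m3 unfolding is_coupling3_def by blast
qed


section \<open>Edge counts between vertex sets\<close>

abbreviation pairs :: "nat \<Rightarrow> nat set set" where
  "pairs n \<equiv> nsets {1..n} 2"

definition neighbours :: "nat set set \<Rightarrow> nat \<Rightarrow> nat set" where
  "neighbours H v = {u. {v, u} \<in> H}"

text \<open>Edges inside \<open>S \<inter> T\<close> are counted twice.\<close>

definition ecount :: "nat set set \<Rightarrow> nat set \<Rightarrow> nat set \<Rightarrow> nat" where
  "ecount H S T = card {(a, b) \<in> S \<times> T. {a, b} \<in> H}"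

text \<open>The contribution of a single pair to \<open>ecount\<close>, which is 0, 1 or 2. It turns
  \<open>ecount\<close> of a random set into a weighted sum of independent indicators.\<close>

definition pair_weight :: "nat set \<Rightarrow> nat set \<Rightarrow> nat set \<Rightarrow> nat" where
  "pair_weight S T e = card {(a, b) \<in> S \<times> T. {a, b} = e}"

lemma finite_nsets [simp, intro]: "finite V \<Longrightarrow> finite (nsets V k)"
  by (rule finite_imp_finite_nsets)

lemma finite_subset_pairs: "H \<subseteq> pairs n \<Longrightarrow> finite H"
  using finite_subset by blast

lemma neighbours_subset: "H \<subseteq> pairs n \<Longrightarrow> neighbours H v \<subseteq> {1..n}"
  by (auto simp: neighbours_def)

lemma card_neighbours:
  assumes "H \<subseteq> pairs n"
  shows "card (neighbours H v) = degree_in H v"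
  unfolding degree_in_def
proof (rule bij_betw_same_card[of "\<lambda>u. {v, u}"], rule bij_betwI')
  fix e assume e: "e \<in> {e \<in> H. v \<in> e}"
  then obtain x y where "e = {x, y}" using assms by (blast elim: nsets2_E)
  then show "\<exists>u\<in>neighbours H v. e = {v, u}"
    using e by (auto simp: neighbours_def insert_commute)
qed (auto simp: neighbours_def doubleton_eq_iff)

lemma degree_sum_eq:
  assumes "H \<subseteq> pairs n"
  shows "degree_in H v = (\<Sum>e\<in>H. of_bool (v \<in> e))"
  using finite_subset_pairs[OF assms] by (simp add: degree_in_def of_bool_def sum.If_cases Int_def)

text \<open>Double counting of incidences. Constant weights give the handshake lemma; general
  weights show that a tilt of the form \<open>x u + x v\<close> depends on a graph only through its
  degrees.\<close>

lemma sum_degree_weighted: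
  fixes x :: "nat \<Rightarrow> real"
  assumes "H \<subseteq> pairs n"
  shows "(\<Sum>v\<in>{1..n}. degree_in H v * x v) = (\<Sum>e\<in>H. \<Sum>v\<in>e. x v)"
proof -
  have "(\<Sum>v\<in>{1..n}. degree_in H v * x v) = (\<Sum>v\<in>{1..n}. \<Sum>e\<in>H. of_bool (v \<in> e) * x v)"
    by (simp add: degree_sum_eq[OF assms] sum_distrib_right)
  also have "\<dots> = (\<Sum>e\<in>H. \<Sum>v\<in>{1..n}. of_bool (v \<in> e) * x v)" by (rule sum.swap)
  also have "\<dots> = (\<Sum>e\<in>H. \<Sum>v\<in>e. x v)"
  proof (rule sum.cong[OF refl])
    fix e assume "e \<in> H"
    then have "e \<subseteq> {1..n}" using assms by (auto simp: nsets_def)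
    then have "{1..n} \<inter> e = e" by auto
    then show "(\<Sum>v\<in>{1..n}. of_bool (v \<in> e) * x v) = (\<Sum>v\<in>e. x v)"
      using sum.inter_restrict[of "{1..n}" x e]
      by (auto simp: of_bool_def if_distrib[of "\<lambda>c. c * _"] cong: if_cong)
  qed
  finally show ?thesis .
qed

lemma handshake:
  assumes "H \<subseteq> pairs n"
  shows "(\<Sum>v\<in>{1..n}. degree_in H v) = 2 * card H"
proof -
  have "(\<Sum>v\<in>{1..n}. degree_in H v * 1) = (\<Sum>e\<in>H. \<Sum>v\<in>e. (1::real))"
    using sum_degree_weighted[OF assms, of "\<lambda>_. 1"] by simp
  also have "\<dots> = (\<Sum>e\<in>H. 2)"
    using assms by (intro sum.cong) (auto simp: nsets_def)
  finally have "real (\<Sum>v\<in>{1..n}. degree_in H v) = real (2 * card H)" by simp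
  then show ?thesis by (simp only: of_nat_eq_iff)
qed

lemma degree_pairs:
  assumes "v \<in> {1..n}"
  shows "degree_in (pairs n) v = n - 1"
proof -
  have "neighbours (pairs n) v = {1..n} - {v}" using assms by (auto simp: neighbours_def)
  then show ?thesis using card_neighbours[of "pairs n" n v] assms by simp
qed

lemma degree_compl:
  assumes "H \<subseteq> pairs n" "v \<in> {1..n}"
  shows "degree_in (pairs n - H) v + degree_in H v = n - 1"
proof -
  have "card ({e \<in> pairs n - H. v \<in> e} \<union> {e \<in> H. v \<in> e}) = degree_in (pairs n - H) v + degree_in H v"
    unfolding degree_in_def using finite_subset_pairs[OF assms(1)] by (intro card_Un_disjoint) auto
  moreover have "{e \<in> pairs n - H. v \<in> e} \<union> {e \<in> H. v \<in> e} = {e \<in> pairs n. v \<in> e}"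
    using assms by auto
  ultimately have "degree_in (pairs n) v = degree_in (pairs n - H) v + degree_in H v"
    by (simp add: degree_in_def)
  then show ?thesis using degree_pairs[OF assms(2)] by simp
qed

lemma ecount_eq_sum:
  assumes "H \<subseteq> pairs n" "finite S" "finite T"
  shows "ecount H S T = (\<Sum>e\<in>H. pair_weight S T e)"
proof -
  have "{(a, b) \<in> S \<times> T. {a, b} \<in> H} = (\<Union>e\<in>H. {(a, b) \<in> S \<times> T. {a, b} = e})" by auto
  moreover have "card (\<Union>e\<in>H. {(a, b) \<in> S \<times> T. {a, b} = e}) = (\<Sum>e\<in>H. card {(a, b) \<in> S \<times> T. {a, b} = e})"
  proof (rule card_UN_disjoint)
    show "finite H" using assms(1) by (rule finite_subset_pairs)
    show "\<forall>e\<in>H. finite {(a, b) \<in> S \<times> T. {a, b} = e}"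
      using assms(2,3) by (auto intro: rev_finite_subset[of "S \<times> T"])
  qed auto
  ultimately show ?thesis by (simp add: ecount_def pair_weight_def)
qed

lemma ecount_pairs:
  assumes "S \<subseteq> {1..n}" "T \<subseteq> {1..n}"
  shows "real (ecount (pairs n) S T) = real (card S) * real (card T) - real (card (S \<inter> T))"
proof -
  have fin: "finite S" "finite T" using assms finite_subset by auto
  have "S \<times> T = {(a, b) \<in> S \<times> T. {a, b} \<in> pairs n} \<union> (\<lambda>a. (a, a)) ` (S \<inter> T)"
    using assms by auto
  moreover have "card \<dots> = card {(a, b) \<in> S \<times> T. {a, b} \<in> pairs n} + card ((\<lambda>a. (a, a)) ` (S \<inter> T))"
    using fin by (intro card_Un_disjoint) (auto intro: rev_finite_subset[of "S \<times> T"])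
  moreover have "card ((\<lambda>a. (a, a)) ` (S \<inter> T)) = card (S \<inter> T)"
    by (rule card_image) (auto simp: inj_on_def)
  ultimately have "card S * card T = ecount (pairs n) S T + card (S \<inter> T)"
    by (metis card_cartesian_product ecount_def)
  then have "real (card S * card T) = real (ecount (pairs n) S T + card (S \<inter> T))" by simp
  then show ?thesis by simp
qed

lemma ecount_Un_disjoint:
  assumes "G \<subseteq> pairs n" "H \<subseteq> pairs n" "G \<inter> H = {}" "finite S" "finite T"
  shows "ecount (G \<union> H) S T = ecount G S T + ecount H S T"
proof -
  have "G \<union> H \<subseteq> pairs n" using assms by auto
  from ecount_eq_sum[OF this assms(4,5)] ecount_eq_sum[OF assms(1,4,5)] ecount_eq_sum[OF assms(2,4,5)]
  show ?thesis
    using sum.union_disjoint[OF finite_subset_pairs[OF assms(1)] finite_subset_pairs[OF assms(2)] assms(3)]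
    by simp
qed

lemma ecount_compl:
  assumes "H \<subseteq> pairs n" "S \<subseteq> {1..n}" "T \<subseteq> {1..n}"
  shows "real (ecount (pairs n - H) S T) =
    real (card S) * real (card T) - real (card (S \<inter> T)) - real (ecount H S T)"
proof -
  have "ecount ((pairs n - H) \<union> H) S T = ecount (pairs n - H) S T + ecount H S T"
    using assms finite_subset[of S] finite_subset[of T]
    by (intro ecount_Un_disjoint[where n = n]) auto
  moreover have "(pairs n - H) \<union> H = pairs n" using assms by auto
  ultimately show ?thesis using ecount_pairs[OF assms(2,3)] by simp
qed

lemma ecount_le:
  assumes "finite S" "finite T"
  shows "ecount H S T \<le> card S * card T"
  unfolding ecount_def card_cartesian_product [symmetric]
  by (rule card_mono) (use assms in auto)

lemma pair_weight_le_2: "pair_weight S T e \<le> 2"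
proof (cases "\<exists>a b. e = {a, b}")
  case True
  then obtain a b where e: "e = {a, b}" by auto
  have "{(x, y) \<in> S \<times> T. {x, y} = e} \<subseteq> {(a, b), (b, a)}"
    by (auto simp: e doubleton_eq_iff)
  then have "card {(x, y) \<in> S \<times> T. {x, y} = e} \<le> card {(a, b), (b, a)}"
    by (intro card_mono) auto
  also have "\<dots> \<le> 2" by (cases "a = b") auto
  finally show ?thesis by (simp add: pair_weight_def)
next
  case False
  then have "{(x, y) \<in> S \<times> T. {x, y} = e} = {}" by auto
  then show ?thesis unfolding pair_weight_def by (simp only: card.empty)
qed

lemma sum_pair_weight_le:
  assumes "H \<subseteq> pairs n" "finite S" "finite T"
  shows "(\<Sum>e\<in>H. real (pair_weight S T e)) \<le> real (card S) * real (card T)"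
proof -
  have "(\<Sum>e\<in>H. real (pair_weight S T e)) = real (ecount H S T)"
    by (simp add: ecount_eq_sum[OF assms])
  also have "\<dots> \<le> real (card S * card T)" using ecount_le[OF assms(2,3)] by (simp only: of_nat_le_iff)
  finally show ?thesis by simp
qed

text \<open>Weights are at most 2, so their squares add up to at most twice their sum, hence to at
  most \<open>2 * V\<close>; this 2 cancels the one in Hoeffding's exponent. The fixed set
  \<open>H\<close> is all pairs when a random graph is studied, and a graph or its complement when
  the random set is \<open>R\<close>.\<close>

lemma ecount_Hoeffding:
  assumes H: "H \<subseteq> pairs n" and f: "\<And>e. e \<in> pairs n \<Longrightarrow> 0 \<le> f e \<and> f e \<le> 1"
    and ST: "finite S" "finite T" "real (card S) * real (card T) \<le> V" and t: "0 < t"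
  shows "measure_pmf.prob (random_subset (pairs n) f)
      {R. \<bar>real (ecount (R \<inter> H) S T) - (\<Sum>e\<in>H. f e * pair_weight S T e)\<bar> \<ge> t} \<le> 2 * exp (- t\<^sup>2 / V)"
proof -
  define w where "w e = (if e \<in> H then real (pair_weight S T e) else 0)" for e
  have "(\<Sum>e\<in>pairs n. (w e)\<^sup>2) = (\<Sum>e\<in>H. (w e)\<^sup>2)"
    using H by (intro sum.mono_neutral_right) (auto simp: w_def)
  also have "\<dots> \<le> (\<Sum>e\<in>H. 2 * real (pair_weight S T e))"
  proof (intro sum_mono)
    fix e assume "e \<in> H"
    then have "w e = real (pair_weight S T e)" by (simp add: w_def)
    moreover have "real (pair_weight S T e) \<le> 2"
      using pair_weight_le_2[of S T e] by linarith
    ultimately show "(w e)\<^sup>2 \<le> 2 * real (pair_weight S T e)"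
      unfolding power2_eq_square by (auto intro: mult_right_mono)
  qed
  also have "\<dots> \<le> 2 * V"
    unfolding sum_distrib_left [symmetric] using sum_pair_weight_le[OF H ST(1,2)] ST(3) by auto
  finally have *: "(\<Sum>e\<in>pairs n. (w e)\<^sup>2) \<le> 2 * V" .
  have eq1: "(\<Sum>e\<in>pairs n \<inter> R. w e) = real (ecount (R \<inter> H) S T)" for R
  proof -
    have "(\<Sum>e\<in>pairs n \<inter> R. w e) = (\<Sum>e\<in>R \<inter> H. real (pair_weight S T e))"
      using H by (intro sum.mono_neutral_cong_right) (auto simp: w_def)
    also have "\<dots> = real (ecount (R \<inter> H) S T)"
      using H ST by (subst ecount_eq_sum[of _ n]) auto
    finally show ?thesis .
  qed
  have eq2: "(\<Sum>e\<in>pairs n. f e * w e) = (\<Sum>e\<in>H. f e * pair_weight S T e)"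
    using H by (intro sum.mono_neutral_cong_right) (auto simp: w_def)
  show ?thesis
    using Hoeffding_random_subset[of "pairs n" f w "2 * V" t] f * t
    unfolding eq1 eq2 by (auto simp: w_def)
qed

lemma degree_Hoeffding:
  assumes H: "H \<subseteq> pairs n" and f: "\<And>e. e \<in> pairs n \<Longrightarrow> 0 \<le> f e \<and> f e \<le> 1"
    and v: "v \<in> {1..n}" and t: "0 < t"
  shows "measure_pmf.prob (random_subset (pairs n) f)
      {R. \<bar>real (degree_in (R \<inter> H) v) - (\<Sum>e\<in>H. f e * of_bool (v \<in> e))\<bar> \<ge> t} \<le> 2 * exp (- 2 * t\<^sup>2 / n)"
proof -
  define w :: "nat set \<Rightarrow> real" where "w e = (if e \<in> H then of_bool (v \<in> e) else 0)" for e
  have "(\<Sum>e\<in>pairs n. (w e)\<^sup>2) = (\<Sum>e\<in>H. of_bool (v \<in> e))"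
    using H by (intro sum.mono_neutral_cong_right) (auto simp: w_def)
  also have "\<dots> = real (degree_in H v)" by (simp add: degree_sum_eq[OF H])
  also have "\<dots> \<le> n" using degree_compl[OF H v] by simp
  finally have *: "(\<Sum>e\<in>pairs n. (w e)\<^sup>2) \<le> n" .
  have eq1: "(\<Sum>e\<in>pairs n \<inter> R. w e) = real (degree_in (R \<inter> H) v)" for R
  proof -
    have "(\<Sum>e\<in>pairs n \<inter> R. w e) = (\<Sum>e\<in>R \<inter> H. of_bool (v \<in> e))"
      using H by (intro sum.mono_neutral_cong_right) (auto simp: w_def)
    also have "\<dots> = real (degree_in (R \<inter> H) v)"
      using H by (subst degree_sum_eq[of _ n]) auto
    finally show ?thesis .
  qed
  have eq2: "(\<Sum>e\<in>pairs n. f e * w e) = (\<Sum>e\<in>H. f e * of_bool (v \<in> e))"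
    using H by (intro sum.mono_neutral_cong_right) (auto simp: w_def)
  show ?thesis
    using Hoeffding_random_subset[of "pairs n" f w n t] f * t
    unfolding eq1 eq2 by (auto simp: w_def)
qed

lemma prob_UN_le:
  assumes "finite I" "\<And>i. i \<in> I \<Longrightarrow> measure_pmf.prob M (X i) \<le> c"
  shows "measure_pmf.prob M (\<Union>i\<in>I. X i) \<le> real (card I) * c"
proof -
  have "measure_pmf.prob M (\<Union>i\<in>I. X i) \<le> (\<Sum>i\<in>I. measure_pmf.prob M (X i))"
    by (rule measure_UNION_le) (use assms in auto)
  also have "\<dots> \<le> real (card I) * c"
    using sum_bounded_above[of I "\<lambda>i. measure_pmf.prob M (X i)" c] assms(2) by simp
  finally show ?thesis .
qed

lemma prob_subset_le:
  assumes "X \<subseteq> Y" "measure_pmf.prob M Y \<le> c" shows "measure_pmf.prob M X \<le> c"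
  using measure_pmf.finite_measure_mono[of X Y M] assms by simp

text \<open>A union bound over all \<open>4 ^ n\<close> choices of \<open>S\<close> and
  \<open>T\<close>. The threshold may depend on the sets, provided its square is at least
  \<open>c\<close> times the product of their sizes; the predicate \<open>good\<close> selects the
  sets that matter.\<close>

lemma ecount_Hoeffding_uniform:
  assumes H: "H \<subseteq> pairs n" and f: "\<And>e. e \<in> pairs n \<Longrightarrow> 0 \<le> f e \<and> f e \<le> 1"
    and t: "\<And>S T. good S T \<Longrightarrow> S \<subseteq> {1..n} \<Longrightarrow> T \<subseteq> {1..n} \<Longrightarrow>
        0 < t S T \<and> c * real (card S) * real (card T) \<le> (t S T)\<^sup>2 \<and> S \<noteq> {} \<and> T \<noteq> {}"
  shows "measure_pmf.prob (random_subset (pairs n) f)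
      {R. \<exists>S\<subseteq>{1..n}. \<exists>T\<subseteq>{1..n}. good S T \<and>
         \<bar>real (ecount (R \<inter> H) S T) - (\<Sum>e\<in>H. f e * pair_weight S T e)\<bar> \<ge> t S T} \<le> 4 ^ n * (2 * exp (- c))"
proof -
  let ?I = "Pow {1..n} \<times> Pow {1..n}"
  let ?X = "\<lambda>(S, T). {R. good S T \<and>
         \<bar>real (ecount (R \<inter> H) S T) - (\<Sum>e\<in>H. f e * pair_weight S T e)\<bar> \<ge> t S T}"
  have "measure_pmf.prob (random_subset (pairs n) f) (\<Union>i\<in>?I. ?X i) \<le> card ?I * (2 * exp (- c))"
  proof (rule prob_UN_le)
    fix i assume "i \<in> ?I"
    then obtain S T where i: "i = (S, T)" "S \<subseteq> {1..n}" "T \<subseteq> {1..n}" by auto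
    have fin: "finite S" "finite T" using i finite_subset by auto
    show "measure_pmf.prob (random_subset (pairs n) f) (?X i) \<le> 2 * exp (- c)"
    proof (cases "good S T")
      case True
      note t' = t[OF True i(2,3)]
      define m where "m = real (card S) * real (card T)"
      have m: "m > 0" using t' fin by (auto simp: m_def card_gt_0_iff)
      have "measure_pmf.prob (random_subset (pairs n) f)
          {R. \<bar>real (ecount (R \<inter> H) S T) - (\<Sum>e\<in>H. f e * pair_weight S T e)\<bar> \<ge> t S T}
          \<le> 2 * exp (- (t S T)\<^sup>2 / m)"
        by (rule ecount_Hoeffding[OF H f fin]) (use t' in \<open>auto simp: m_def\<close>)
      also have "\<dots> \<le> 2 * exp (- c)"
        using t' m by (auto simp: field_simps m_def)
      finally show ?thesis using True by (simp add: i)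
    next
      case False
      then show ?thesis by (simp add: i)
    qed
  qed auto
  moreover have "card ?I = 4 ^ n"
  proof -
    have "card ?I = 2 ^ n * 2 ^ n" by (simp add: card_cartesian_product card_Pow)
    also have "\<dots> = (2 * 2) ^ n" by (rule power_mult_distrib [symmetric])
    finally show ?thesis by simp
  qed
  ultimately have le: "measure_pmf.prob (random_subset (pairs n) f) (\<Union>i\<in>?I. ?X i) \<le> 4 ^ n * (2 * exp (- c))"
    by (simp only: of_nat_power of_nat_numeral)
  show ?thesis
    by (rule prob_subset_le[OF _ le]) blast
qed


section \<open>Rewiring and switching\<close>

lemma graphs_with_degreesD:
  assumes "G \<in> graphs_with_degrees n d"
  shows "G \<subseteq> pairs n" "\<And>v. v \<in> {1..n} \<Longrightarrow> degree_in G v = d v"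
  using assms by (auto simp: graphs_with_degrees_def)

lemma finite_graphs_with_degrees [simp, intro]: "finite (graphs_with_degrees n d)"
  by (rule finite_subset[of _ "Pow (pairs n)"]) (auto simp: graphs_with_degrees_def)

lemma pairs_neq: "H \<subseteq> pairs n \<Longrightarrow> {x, y} \<in> H \<Longrightarrow> x \<noteq> y"
  by (metis doubleton_in_nsets_2 subsetD)

lemma degree_insert:
  assumes "finite H" "e \<notin> H"
  shows "degree_in (insert e H) v = degree_in H v + of_bool (v \<in> e)"
proof -
  have "{x \<in> insert e H. v \<in> x} = (if v \<in> e then insert e {x \<in> H. v \<in> x} else {x \<in> H. v \<in> x})"
    by auto
  then show ?thesis using assms by (simp add: degree_in_def)
qed

lemma degree_remove:
  assumes "finite H" "e \<in> H"
  shows "degree_in (H - {e}) v + of_bool (v \<in> e) = degree_in H v"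
  using degree_insert[of "H - {e}" e v] assms by (simp add: insert_absorb)

text \<open>The ends of the deleted edge get their degrees back, while \<open>i\<close> and
  \<open>k\<close> gain one each (two if they coincide). The move serves twice: to repair missing
  degrees and, after deletion of \<open>{j, k}\<close>, as the switching itself.\<close>

definition rewire :: "nat set set \<Rightarrow> nat \<Rightarrow> nat \<Rightarrow> nat \<Rightarrow> nat \<Rightarrow> nat set set" where
  "rewire H i a b k = insert {i, a} (insert {k, b} (H - {{a, b}}))"

lemma degree_rewire:
  assumes H: "H \<subseteq> pairs n" "{a, b} \<in> H" and ne: "i \<noteq> a" "k \<noteq> b" and new: "{i, a} \<notin> H" "{k, b} \<notin> H"
  shows "degree_in (rewire H i a b k) v = degree_in H v + of_bool (v = i) + of_bool (v = k)"
proof -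
  have "a \<noteq> b" using pairs_neq[OF H] .
  \<comment> \<open>As \<open>a \<noteq> b\<close>, equality would force \<open>i = b\<close> and
    \<open>k = a\<close>, and then \<open>{i, a}\<close> would be the edge
    \<open>{a, b}\<close>.\<close>
  have "{i, a} \<noteq> {k, b}"
    using H(2) new ne \<open>a \<noteq> b\<close> by (auto simp: doubleton_eq_iff insert_commute)
  then have "degree_in (rewire H i a b k) v =
      degree_in (H - {{a, b}}) v + of_bool (v \<in> {k, b}) + of_bool (v \<in> {i, a})"
    using new finite_subset_pairs[OF H(1)] by (simp add: rewire_def degree_insert)
  moreover have "degree_in (H - {{a, b}}) v + of_bool (v \<in> {a, b}) = degree_in H v"
    by (rule degree_remove[OF finite_subset_pairs[OF H(1)] H(2)])
  ultimately show ?thesis using ne \<open>a \<noteq> b\<close> by (auto split: if_splits)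
qed

lemma ecount_mono:
  assumes "finite S" "finite T" "G \<subseteq> H" shows "ecount G S T \<le> ecount H S T"
  unfolding ecount_def
  by (rule card_mono) (use assms in \<open>auto intro: rev_finite_subset[of "S \<times> T"]\<close>)

lemma ecount_remove:
  assumes H: "H \<subseteq> pairs n" and fin: "finite S" "finite T"
  shows "ecount H S T \<le> ecount (H - {e}) S T + 2"
proof (cases "e \<in> H")
  case True
  then have "ecount H S T = pair_weight S T e + ecount (H - {e}) S T"
    using finite_subset_pairs[OF H] ecount_eq_sum[OF H fin] ecount_eq_sum[OF _ fin, of "H - {e}" n] H
    by (simp add: sum.remove subset_iff)
  then show ?thesis using pair_weight_le_2[of S T e] by linarith
qed simp

lemma card_non_neighbours:
  assumes "H \<subseteq> pairs n" "i \<in> {1..n}"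
  shows "card ({1..n} - {i} - neighbours H i) = n - 1 - degree_in H i"
proof -
  have "neighbours H i \<subseteq> {1..n} - {i}"
    using neighbours_subset[OF assms(1), of i] pairs_neq[OF assms(1), of i i] by (auto simp: neighbours_def)
  then have "card ({1..n} - {i} - neighbours H i) = card ({1..n} - {i}) - card (neighbours H i)"
    by (intro card_Diff_subset) (auto intro: finite_subset)
  then show ?thesis using assms by (simp add: card_neighbours)
qed

text \<open>The missing degrees may all sit at one vertex, so \<open>i = k\<close> is allowed; the
  sum of the two indicators then demands a deficiency of 2.\<close>

lemma two_deficient:
  fixes f :: "'a \<Rightarrow> nat"
  assumes "finite V" "(\<Sum>v\<in>V. f v) \<ge> 2"
  obtains i k where "i \<in> V" "k \<in> V" "\<And>v. of_bool (v = i) + of_bool (v = k) \<le> f v"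
proof -
  have "\<not> (\<forall>v\<in>V. f v = 0)" using assms(2) by (metis not_numeral_le_zero sum.neutral)
  then obtain i where i: "i \<in> V" "f i > 0" by auto
  show ?thesis
  proof (cases "f i \<ge> 2")
    case True
    then show ?thesis using i by (intro that[of i i]) auto
  next
    case False
    have "(\<Sum>v\<in>V. f v) = f i + (\<Sum>v\<in>V - {i}. f v)" using assms i by (simp add: sum.remove)
    then have "(\<Sum>v\<in>V - {i}. f v) \<noteq> 0" using assms(2) False by linarith
    then have "\<not> (\<forall>v\<in>V - {i}. f v = 0)" by (metis sum.neutral)
    then obtain k where "k \<in> V - {i}" "f k > 0" by (metis neq0_conv)
    then show ?thesis using i by (intro that[of i k]) auto
  qed
qed

text \<open>Each round takes two deficient vertices \<open>i\<close>, \<open>j\<close> and rewires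
  an edge \<open>{a, b}\<close> joining a non-neighbour of \<open>i\<close> to a non-neighbour of
  \<open>j\<close>. This alters three pairs and lowers the total deficiency by 2. Such an edge
  exists because both non-neighbourhoods have at least \<sigma> vertices. A round deletes only one
  edge, which costs \<open>ecount\<close> at most 2, so a count above \<open>2 * k\<close> lasts for
  all \<open>k\<close> rounds.\<close>

lemma edit_to_degrees:
  assumes "H \<subseteq> pairs n" "\<And>v. v \<in> {1..n} \<Longrightarrow> degree_in H v \<le> d v"
    and "(\<Sum>v\<in>{1..n}. d v - degree_in H v) = 2 * k"
    and "\<And>S T. S \<subseteq> {1..n} \<Longrightarrow> T \<subseteq> {1..n} \<Longrightarrow> \<sigma> \<le> card S \<Longrightarrow> \<sigma> \<le> card T \<Longrightarrow> 2 * k < ecount H S T"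
    and \<sigma>: "\<And>v. v \<in> {1..n} \<Longrightarrow> \<sigma> \<le> n - 1 - d v"
  shows "\<exists>G\<in>graphs_with_degrees n d. card (sym_diff G H) \<le> 3 * k"
  using assms(1-4)
proof (induction k arbitrary: H)
  case 0
  then have "degree_in H v = d v" if "v \<in> {1..n}" for v
    using that by (force intro: antisym)
  then show ?case using 0 by (intro bexI[of _ H]) (auto simp: graphs_with_degrees_def)
next
  case (Suc k)
  obtain i j where ij: "i \<in> {1..n}" "j \<in> {1..n}"
    and def: "\<And>v. of_bool (v = i) + of_bool (v = j) \<le> d v - degree_in H v"
    using two_deficient[of "{1..n}" "\<lambda>v. d v - degree_in H v"] Suc.prems(3) by auto
  let ?S = "\<lambda>i. {1..n} - {i} - neighbours H i"
  have "\<sigma> \<le> card (?S v)" if "v \<in> {1..n}" for v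
    using card_non_neighbours[OF Suc.prems(1) that] \<sigma>[OF that] Suc.prems(2)[OF that] by linarith
  then have "2 * Suc k < ecount H (?S i) (?S j)"
    using ij by (intro Suc.prems(4)) auto
  then have "0 < ecount H (?S i) (?S j)" by (rule le_less_trans[OF le0])
  then have "{(a, b) \<in> ?S i \<times> ?S j. {a, b} \<in> H} \<noteq> {}" unfolding ecount_def by (metis card.empty less_irrefl)
  then obtain a b where ab: "a \<in> ?S i" "b \<in> ?S j" "{a, b} \<in> H" by auto
  define H' where "H' = rewire H i a b j"
  have new: "{i, a} \<notin> H" "{j, b} \<notin> H" "i \<noteq> a" "j \<noteq> b" using ab by (auto simp: neighbours_def)
  have deg: "degree_in H' v = degree_in H v + (of_bool (v = i) + of_bool (v = j))" for v
    unfolding H'_def using degree_rewire[OF Suc.prems(1) ab(3) new(3,4,1,2)] by simp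
  have H': "H' \<subseteq> pairs n" using Suc.prems(1) ab ij by (auto simp: H'_def rewire_def)
  have "\<exists>G\<in>graphs_with_degrees n d. card (sym_diff G H') \<le> 3 * k"
  proof (rule Suc.IH)
    show "H' \<subseteq> pairs n" by fact
    show "degree_in H' v \<le> d v" if "v \<in> {1..n}" for v
      using def[of v] Suc.prems(2)[OF that] by (simp add: deg)
    have "(\<Sum>v\<in>{1..n}. d v - degree_in H v) =
        (\<Sum>v\<in>{1..n}. (d v - degree_in H' v) + of_bool (v = i) + of_bool (v = j))"
    proof (rule sum.cong[OF refl])
      fix v
      show "d v - degree_in H v = (d v - degree_in H' v) + of_bool (v = i) + of_bool (v = j)"
        unfolding deg using def[of v] by linarith
    qed
    also have "\<dots> = (\<Sum>v\<in>{1..n}. d v - degree_in H' v) + 2"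
      using ij by (simp add: sum.distrib)
    finally show "(\<Sum>v\<in>{1..n}. d v - degree_in H' v) = 2 * k" using Suc.prems(3) by simp
    fix S T assume ST: "S \<subseteq> {1..n}" "T \<subseteq> {1..n}" "\<sigma> \<le> card S" "\<sigma> \<le> card T"
    have fin: "finite S" "finite T" using ST finite_subset by auto
    have "2 * Suc k < ecount H S T" by (rule Suc.prems(4)[OF ST])
    also have "\<dots> \<le> ecount (H - {{a, b}}) S T + 2" by (rule ecount_remove[OF Suc.prems(1) fin])
    also have "\<dots> \<le> ecount H' S T + 2"
      unfolding add_le_cancel_right by (rule ecount_mono[OF fin]) (auto simp: H'_def rewire_def)
    finally show "2 * k < ecount H' S T" by simp
  qed
  then obtain G where G: "G \<in> graphs_with_degrees n d" "card (sym_diff G H') \<le> 3 * k" by auto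
  have fin: "finite G" "finite H" "finite H'"
    by (intro finite_subset_pairs[OF graphs_with_degreesD(1)[OF G(1)]]
      finite_subset_pairs[OF Suc.prems(1)] finite_subset_pairs[OF H'])+
  have "sym_diff G H \<subseteq> sym_diff G H' \<union> {{a, b}, {i, a}, {j, b}}"
    unfolding H'_def rewire_def by blast
  then have "card (sym_diff G H) \<le> card (sym_diff G H' \<union> {{a, b}, {i, a}, {j, b}})"
    by (rule card_mono [rotated]) (use fin in simp)
  also have "\<dots> \<le> card (sym_diff G H') + card {{a, b}, {i, a}, {j, b}}" by (rule card_Un_le)
  also have "card {{a, b}, {i, a}, {j, b}} \<le> 3"
    using card_length[of "[{a, b}, {i, a}, {j, b}]"] by simp
  finally show ?case using G by (intro bexI[of _ G]) auto
qed

section \<open>Switchings\<close>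

lemma sym_diff_4:
  assumes "x \<in> G" "y \<in> G" "z \<notin> G" "w \<notin> G"
  shows "sym_diff G {x, y, z, w} = insert z (insert w (G - {x} - {y}))"
  using assms by blast

lemma degree_switch:
  assumes G: "G \<subseteq> pairs n" and e: "{j, k} \<in> G" "{a, b} \<in> G" "{j, a} \<notin> G" "{k, b} \<notin> G"
    and ne: "j \<noteq> a" "k \<noteq> b" "{j, k} \<noteq> {a, b}"
  shows "degree_in (sym_diff G {{j, k}, {a, b}, {j, a}, {k, b}}) v = degree_in G v"
proof -
  have "sym_diff G {{j, k}, {a, b}, {j, a}, {k, b}} = rewire (G - {{j, k}}) j a b k"
    unfolding rewire_def by (rule sym_diff_4) fact+
  moreover have "degree_in (rewire (G - {{j, k}}) j a b k) v =
      degree_in (G - {{j, k}}) v + of_bool (v = j) + of_bool (v = k)"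
    by (rule degree_rewire[of _ n]) (use G e ne in auto)
  moreover have "degree_in (G - {{j, k}}) v + of_bool (v \<in> {j, k}) = degree_in G v"
    by (rule degree_remove[OF finite_subset_pairs[OF G] e(1)])
  moreover have "of_bool (v \<in> {j, k}) = (of_bool (v = j) + of_bool (v = k) :: nat)"
    using pairs_neq[OF G e(1)] by auto
  ultimately show ?thesis by simp
qed

text \<open>
  The switchings \<open>{j, k}, {a, b} \<leftrightarrow> {j, a}, {k, b}\<close> with \<open>{a, b}, {j, a}, {k, b} \<in> R\<close> do not touch
  the exposed part \<open>G \<inter> A\<close>; a switching is a symmetric difference, hence its own inverse.
\<close>

lemma switching_double_count:
  assumes R: "R \<subseteq> pairs n" and A: "A \<inter> R = {}" and e: "{j, k} \<in> pairs n" "{j, k} \<notin> R" "{j, k} \<notin> A"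
    and C: "C = {G \<in> graphs_with_degrees n d. G \<inter> A = h}"
  shows "(\<Sum>G\<in>{G \<in> C. {j, k} \<in> G}. ecount (R \<inter> G) (neighbours (R - G) j) (neighbours (R - G) k)) =
    (\<Sum>G\<in>{G \<in> C. {j, k} \<notin> G}. ecount (R - G) (neighbours (R \<inter> G) j) (neighbours (R \<inter> G) k))"
proof -
  let ?Q = "\<lambda>a b. {{j, k}, {a, b}, {j, a}, {k, b}}"
  let ?f = "\<lambda>(G, a, b). (sym_diff G (?Q a b), a, b)"
  let ?X = "SIGMA G:{G \<in> C. {j, k} \<in> G}.
    {(a, b) \<in> neighbours (R - G) j \<times> neighbours (R - G) k. {a, b} \<in> R \<inter> G}"
  let ?Y = "SIGMA G:{G \<in> C. {j, k} \<notin> G}.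
    {(a, b) \<in> neighbours (R \<inter> G) j \<times> neighbours (R \<inter> G) k. {a, b} \<in> R - G}"
  have finC: "finite C" unfolding C by auto
  have fin: "finite (neighbours (R \<inter> G) v)" "finite (neighbours (R - G) v)" for G v
    using neighbours_subset[of "R \<inter> G" n v] neighbours_subset[of "R - G" n v] R
    by (auto intro: finite_subset)
  have fin2: "finite {(a, b) \<in> neighbours G j \<times> neighbours G k. P a b}"
    if "\<And>v. finite (neighbours G v)" for G P
    using that by (auto intro: rev_finite_subset[of "neighbours G j \<times> neighbours G k"])
  \<comment> \<open>Both directions at once: the four pairs are alternately edges and non-edges, and
    it does not matter which alternation holds.\<close>
  have mem: "sym_diff G (?Q a b) \<in> C"
    if ab: "{a, b} \<in> R" "{j, a} \<in> R" "{k, b} \<in> R" and G: "G \<in> C"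
      and alt: "({j, k} \<in> G \<and> {a, b} \<in> G \<and> {j, a} \<notin> G \<and> {k, b} \<notin> G) \<or>
        ({j, k} \<notin> G \<and> {a, b} \<notin> G \<and> {j, a} \<in> G \<and> {k, b} \<in> G)" for G a b
  proof -
    let ?G = "sym_diff G (?Q a b)"
    have GP: "G \<subseteq> pairs n" using G graphs_with_degreesD by (auto simp: C)
    have G'P: "?G \<subseteq> pairs n" using GP ab e R by blast
    have ne: "j \<noteq> a" "k \<noteq> b" using ab R pairs_neq by auto
    have jk: "{j, k} \<noteq> {a, b}" "{j, k} \<noteq> {j, a}" "{j, k} \<noteq> {k, b}" using ab e by auto
    have "a \<noteq> b" "j \<noteq> k" using ab R e pairs_neq by auto
    then have "{a, b} \<noteq> {j, a}" "{a, b} \<noteq> {k, b}" using jk by (auto simp: doubleton_eq_iff)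
    then have distinct: "{a, b} \<notin> {{j, a}, {k, b}}" "{j, k} \<notin> {{j, a}, {k, b}}" using jk by auto
    have deg: "degree_in ?G v = degree_in G v" for v
    proof (cases "{j, k} \<in> G")
      case True
      then show ?thesis using alt ne jk(1) by (intro degree_switch[OF GP]) auto
    next
      case False
      \<comment> \<open>Read backwards: in the switched graph \<open>{j, k}\<close> and
        \<open>{a, b}\<close> are edges, so the forward computation applies to it and leads back to
        \<open>G\<close>.\<close>
      then have "degree_in (sym_diff ?G (?Q a b)) v = degree_in ?G v"
        using alt ne jk(1) distinct by (intro degree_switch[OF G'P]) auto
      moreover have "sym_diff ?G (?Q a b) = G" by blast
      ultimately show ?thesis by simp
    qed
    have "?G \<inter> A = G \<inter> A" using ab A e by blast
    then show ?thesis using G deg G'P unfolding C graphs_with_degrees_def by auto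
  qed
  have fX: "?f x \<in> ?Y" if "x \<in> ?X" for x
  proof -
    obtain G a b where x: "x = (G, a, b)" by (cases x)
    then have *: "G \<in> C" "{j, k} \<in> G" "{j, a} \<in> R" "{j, a} \<notin> G" "{k, b} \<in> R" "{k, b} \<notin> G"
      "{a, b} \<in> R" "{a, b} \<in> G"
      using that by (auto simp: neighbours_def)
    then have "sym_diff G (?Q a b) \<in> C" by (intro mem) auto
    then show ?thesis using * by (auto simp: x neighbours_def)
  qed
  have fY: "?f x \<in> ?X" if "x \<in> ?Y" for x
  proof -
    obtain G a b where x: "x = (G, a, b)" by (cases x)
    then have *: "G \<in> C" "{j, k} \<notin> G" "{j, a} \<in> R" "{j, a} \<in> G" "{k, b} \<in> R" "{k, b} \<in> G"
      "{a, b} \<in> R" "{a, b} \<notin> G"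
      using that by (auto simp: neighbours_def)
    then have "sym_diff G (?Q a b) \<in> C" by (intro mem) auto
    then show ?thesis using * by (auto simp: x neighbours_def)
  qed
  have ff: "?f (?f x) = x" for x by (cases x) auto
  have "bij_betw ?f ?X ?Y"
    by (rule bij_betw_byWitness[where f' = ?f]) (use fX fY ff in blast)+
  then have "card ?X = card ?Y" by (rule bij_betw_same_card)
  moreover have "card ?X = (\<Sum>G\<in>{G \<in> C. {j, k} \<in> G}.
      ecount (R \<inter> G) (neighbours (R - G) j) (neighbours (R - G) k))"
    unfolding ecount_def using finC fin fin2 by (subst card_SigmaI) auto
  moreover have "card ?Y = (\<Sum>G\<in>{G \<in> C. {j, k} \<notin> G}.
      ecount (R - G) (neighbours (R \<inter> G) j) (neighbours (R \<inter> G) k))"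
    unfolding ecount_def using finC fin fin2 by (subst card_SigmaI) auto
  ultimately show ?thesis by simp
qed


section \<open>Conditional edge probabilities\<close>

text \<open>Typical terms lie in the window; the at most \<open>b\<close> exceptional ones are
  bounded only by 0 and the crude maximum \<open>M\<close>.\<close>

lemma sum_window:
  fixes f :: "'a \<Rightarrow> real" and lo hi b M :: real
  assumes X: "finite X" and f: "\<And>x. 0 \<le> f x \<and> f x \<le> M"
    and win: "\<forall>x\<in>X - Bad. lo \<le> f x \<and> f x \<le> hi" and lohi: "0 \<le> lo" "0 \<le> hi"
    and b: "real (card (X \<inter> Bad)) \<le> b" and M: "0 \<le> M"
  shows "lo * (card X - b) \<le> (\<Sum>x\<in>X. f x)" "(\<Sum>x\<in>X. f x) \<le> hi * card X + M * b"
proof -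
  have split: "(\<Sum>x\<in>X. f x) = (\<Sum>x\<in>X \<inter> Bad. f x) + (\<Sum>x\<in>X - Bad. f x)"
    using X by (rule sum.Int_Diff)
  have "card X = card (X \<inter> Bad) + card (X - Bad)"
    using X by (metis card_Int_Diff)
  then have cX: "real (card X) = real (card (X \<inter> Bad)) + real (card (X - Bad))" by simp
  have "lo * (card X - b) \<le> lo * real (card (X - Bad))"
    using lohi b cX by (intro mult_left_mono) auto
  also have "\<dots> \<le> (\<Sum>x\<in>X - Bad. f x)"
    using sum_bounded_below[of "X - Bad" lo f] win by (simp add: mult.commute)
  also have "\<dots> \<le> (\<Sum>x\<in>X. f x)"
    unfolding split using f by (auto intro: sum_nonneg)
  finally show "lo * (card X - b) \<le> (\<Sum>x\<in>X. f x)" .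
  have "(\<Sum>x\<in>X \<inter> Bad. f x) \<le> M * real (card (X \<inter> Bad))"
    using sum_bounded_above[of "X \<inter> Bad" f M] f by (simp add: mult.commute)
  also have "\<dots> \<le> M * b" using b M by (rule mult_left_mono)
  finally have 1: "(\<Sum>x\<in>X \<inter> Bad. f x) \<le> M * b" .
  have "(\<Sum>x\<in>X - Bad. f x) \<le> hi * real (card (X - Bad))"
    using sum_bounded_above[of "X - Bad" f hi] win by (simp add: mult.commute)
  also have "\<dots> \<le> hi * card X" using lohi cX by (intro mult_left_mono) auto
  finally show "(\<Sum>x\<in>X. f x) \<le> hi * card X + M * b" using 1 split by linarith
qed

text \<open>Here \<open>I\<close> and \<open>J\<close> count the graphs with and without the pair,
  and \<open>s\<close> counts switchings from either side. Without errors
  \<open>(1 - \<alpha>) * f * I = \<alpha> * f * J\<close>, which says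
  \<open>I = \<alpha> * (I + J)\<close>. The value of \<open>q\<close> gives
  \<open>M * q = \<alpha> * \<kappa> * f / 2\<close>, so the bad graphs disturb the balance no more
  than the window does. The factors 3 and 4 come from
  \<open>(1 + \<kappa>) * (1 - 3 * \<kappa>) \<le> 1 - 2 * \<kappa>\<close> and
  \<open>1 + 2 * \<kappa> \<le> (1 - \<kappa>) * (1 + 4 * \<kappa>)\<close>; the latter is where
  \<open>\<kappa> \<le> 1 / 4\<close> enters.\<close>

lemma proportion_bounds:
  fixes I J \<alpha> \<kappa> f q M s :: real
  assumes \<alpha>: "0 < \<alpha>" "\<alpha> < 1" and f: "0 < f" "f \<le> M" and \<kappa>: "0 < \<kappa>" "\<kappa> \<le> 1 / 4"
    and IJ: "0 \<le> I" "0 \<le> J" and q: "q = \<alpha> * \<kappa> * f / (2 * M)"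
    and F: "(1 - \<kappa>) * ((1 - \<alpha>) * f) * (I - q * (I + J)) \<le> s"
      "s \<le> (1 + \<kappa>) * ((1 - \<alpha>) * f) * I + M * (q * (I + J))"
    and B: "(1 - \<kappa>) * (\<alpha> * f) * (J - q * (I + J)) \<le> s"
      "s \<le> (1 + \<kappa>) * (\<alpha> * f) * J + M * (q * (I + J))"
  shows "\<alpha> * (1 - 3 * \<kappa>) * (I + J) \<le> I" "I \<le> \<alpha> * (1 + 4 * \<kappa>) * (I + J)"
proof -
  define c where "c = I + J"
  have c: "0 \<le> c" using IJ by (simp add: c_def)
  have M: "0 < M" using f by simp
  have qM: "M * q = \<alpha> * \<kappa> * f / 2" using M by (simp add: q)
  have q0: "0 \<le> q" using \<alpha> \<kappa> f M by (simp add: q)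
  have fq: "f * q \<le> \<alpha> * \<kappa> * f / 2"
    unfolding qM [symmetric] using f q0 by (intro mult_right_mono) auto
  have fqx: "x * (f * q) \<le> \<alpha> * \<kappa> * f / 2" if "0 \<le> x" "x \<le> 1" for x
    using mult_mono[OF that(2) fq] f q0 \<alpha> \<kappa> that by simp
  have "0 \<le> (1 - \<kappa>) * (1 - \<alpha>)" "(1 - \<kappa>) * (1 - \<alpha>) \<le> 1" 
    "0 \<le> (1 - \<kappa>) * \<alpha>" "(1 - \<kappa>) * \<alpha> \<le> 1" using \<alpha> \<kappa> by (auto intro!: mult_le_one)
  note e1 = fqx[OF this(1,2)] and e2 = fqx[OF this(3,4)]
  have "(1 - \<kappa>) * (1 - \<alpha>) * f * I \<le>
      (1 + \<kappa>) * \<alpha> * f * J + (M * q) * c + ((1 - \<kappa>) * (1 - \<alpha>) * (f * q)) * c"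
    using order_trans[OF F(1) B(2)] by (simp add: c_def algebra_simps)
  also have "\<dots> \<le> (1 + \<kappa>) * \<alpha> * f * J + (\<alpha> * \<kappa> * f / 2) * c + (\<alpha> * \<kappa> * f / 2) * c"
    unfolding qM using e1 c by (intro add_mono mult_right_mono order_refl) auto
  finally have "f * ((1 - \<kappa>) * (1 - \<alpha>) * I) \<le> f * ((1 + \<kappa>) * \<alpha> * J + \<alpha> * \<kappa> * c)"
    by (simp add: algebra_simps)
  then have "(1 - \<kappa>) * (1 - \<alpha>) * I \<le> (1 + \<kappa>) * \<alpha> * J + \<alpha> * \<kappa> * c"
    using f by simp
  then have "(1 - \<kappa>) * I + 2 * \<kappa> * \<alpha> * I \<le> \<alpha> * (1 + 2 * \<kappa>) * c"
    by (simp add: c_def algebra_simps)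
  moreover have "0 \<le> 2 * \<kappa> * \<alpha> * I" using \<alpha> \<kappa> IJ by simp
  ultimately have "(1 - \<kappa>) * I \<le> \<alpha> * (1 + 2 * \<kappa>) * c" by linarith
  also have "\<dots> \<le> \<alpha> * ((1 - \<kappa>) * (1 + 4 * \<kappa>)) * c"
  proof (intro mult_right_mono mult_left_mono)
    have "\<kappa> * (4 * \<kappa>) \<le> \<kappa> * 1" using \<kappa> by (intro mult_left_mono) auto
    then show "1 + 2 * \<kappa> \<le> (1 - \<kappa>) * (1 + 4 * \<kappa>)" by (simp add: algebra_simps)
  qed (use \<alpha> c in auto)
  finally have "(1 - \<kappa>) * I \<le> (1 - \<kappa>) * (\<alpha> * (1 + 4 * \<kappa>) * c)" by (simp add: algebra_simps)
  then show "I \<le> \<alpha> * (1 + 4 * \<kappa>) * (I + J)" using \<kappa> by (simp add: c_def)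
  have "(1 - \<kappa>) * \<alpha> * f * J \<le>
      (1 + \<kappa>) * (1 - \<alpha>) * f * I + (M * q) * c + ((1 - \<kappa>) * \<alpha> * (f * q)) * c"
    using order_trans[OF B(1) F(2)] by (simp add: c_def algebra_simps)
  also have "\<dots> \<le> (1 + \<kappa>) * (1 - \<alpha>) * f * I + (\<alpha> * \<kappa> * f / 2) * c + (\<alpha> * \<kappa> * f / 2) * c"
    unfolding qM using e2 c by (intro add_mono mult_right_mono order_refl) auto
  finally have "f * ((1 - \<kappa>) * \<alpha> * J) \<le> f * ((1 + \<kappa>) * (1 - \<alpha>) * I + \<alpha> * \<kappa> * c)"
    by (simp add: algebra_simps)
  then have "(1 - \<kappa>) * \<alpha> * J \<le> (1 + \<kappa>) * (1 - \<alpha>) * I + \<alpha> * \<kappa> * c" using f by simp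
  then have "\<alpha> * (1 - 2 * \<kappa>) * c + 2 * \<kappa> * \<alpha> * I \<le> (1 + \<kappa>) * I"
    by (simp add: c_def algebra_simps)
  moreover have "0 \<le> 2 * \<kappa> * \<alpha> * I" using \<alpha> \<kappa> IJ by simp
  ultimately have *: "\<alpha> * (1 - 2 * \<kappa>) * c \<le> (1 + \<kappa>) * I" by linarith
  have "\<alpha> * ((1 + \<kappa>) * (1 - 3 * \<kappa>)) * c \<le> \<alpha> * (1 - 2 * \<kappa>) * c"
    by (intro mult_right_mono mult_left_mono) (use \<alpha> c \<kappa> in \<open>auto simp: algebra_simps\<close>)
  with * have "(1 + \<kappa>) * (\<alpha> * (1 - 3 * \<kappa>) * c) \<le> (1 + \<kappa>) * I" by (simp add: algebra_simps)
  then show "\<alpha> * (1 - 3 * \<kappa>) * (I + J) \<le> I" using \<kappa> by (simp add: c_def)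
qed

text \<open>
  Both switching counts depend only on the unexposed part \<open>R\<close>; \<open>f\<close> stands for
  \<open>\<delta>\<^sup>3 \<alpha> (1 - \<alpha>) n\<^sup>2\<close> when \<open>R\<close> is a random set of pairs of density \<open>\<delta>\<close> and \<open>G\<close> has density \<open>\<alpha>\<close>.
\<close>

definition switch_good :: "nat \<Rightarrow> nat set set \<Rightarrow> real \<Rightarrow> real \<Rightarrow> real \<Rightarrow> nat set set \<Rightarrow> bool" where
  "switch_good n R \<alpha> \<kappa> f G \<longleftrightarrow> (\<forall>j\<in>{1..n}. \<forall>k\<in>{1..n}.
     real (ecount (R \<inter> G) (neighbours (R - G) j) (neighbours (R - G) k))
       \<in> {(1 - \<kappa>) * ((1 - \<alpha>) * f) .. (1 + \<kappa>) * ((1 - \<alpha>) * f)} \<and>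
     real (ecount (R - G) (neighbours (R \<inter> G) j) (neighbours (R \<inter> G) k))
       \<in> {(1 - \<kappa>) * (\<alpha> * f) .. (1 + \<kappa>) * (\<alpha> * f)})"

lemma ecount_le_n2:
  assumes "S \<subseteq> {1..n}" "T \<subseteq> {1..n}" shows "real (ecount H S T) \<le> (real n)\<^sup>2"
proof -
  have "card S \<le> n" "card T \<le> n" using card_mono[of "{1..n}"] assms by auto
  then have "card S * card T \<le> n * n" by (rule mult_le_mono)
  then have "ecount H S T \<le> n * n"
    using ecount_le[of S T H] assms finite_subset[of S "{1..n}"] finite_subset[of T "{1..n}"] by auto
  then show ?thesis by (metis of_nat_le_iff of_nat_mult power2_eq_square)
qed

text \<open>Conditioning on the history leaves the double count of switchings exact, and all but a
  few graphs in the class have the typical number of switchings in each direction. A bad graph has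
  at most \<open>n ^ 2\<close> switchings, which fixes the tolerated proportion of bad
  graphs.\<close>

lemma conditional_edge_probability:
  fixes \<alpha> \<kappa> f :: real
  assumes R: "R \<subseteq> pairs n" and e: "e \<in> pairs n - R" and A: "A \<subseteq> pairs n - R - {e}"
    and C: "C = {G \<in> graphs_with_degrees n d. G \<inter> A = h}"
    and \<alpha>: "0 < \<alpha>" "\<alpha> < 1" and f: "0 < f" "f \<le> (real n)\<^sup>2" and \<kappa>: "0 < \<kappa>" "\<kappa> \<le> 1 / 4"
    and bad: "real (card (C \<inter> {G. \<not> switch_good n R \<alpha> \<kappa> f G})) \<le> \<alpha> * \<kappa> * f / (2 * (real n)\<^sup>2) * card C"
  shows "\<alpha> * (1 - 3 * \<kappa>) * card C \<le> card {G \<in> C. e \<in> G}"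
    "card {G \<in> C. e \<in> G} \<le> \<alpha> * (1 + 4 * \<kappa>) * card C"
proof -
  obtain j k where jk: "e = {j, k}" "j \<in> {1..n}" "k \<in> {1..n}"
    using e by (auto elim!: nsets2_E)
  let ?B = "{G. \<not> switch_good n R \<alpha> \<kappa> f G}"
  let ?q = "\<alpha> * \<kappa> * f / (2 * (real n)\<^sup>2)"
  define X Y where "X = {G \<in> C. e \<in> G}" and "Y = {G \<in> C. e \<notin> G}"
  have finC: "finite C" by (simp add: C)
  then have fin: "finite X" "finite Y" by (auto simp: X_def Y_def)
  have "card C = card (X \<union> Y)" by (rule arg_cong[where f = card]) (auto simp: X_def Y_def)
  also have "\<dots> = card X + card Y" using fin by (intro card_Un_disjoint) (auto simp: X_def Y_def)
  finally have cC: "real (card C) = real (card X) + real (card Y)" by simp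
  have b: "real (card (Z \<inter> ?B)) \<le> ?q * (real (card X) + real (card Y))" if "Z \<subseteq> C" for Z
  proof -
    have "card (Z \<inter> ?B) \<le> card (C \<inter> ?B)" using finC that by (intro card_mono) auto
    then show ?thesis using bad unfolding cC by linarith
  qed
  define F where "F G = real (ecount (R \<inter> G) (neighbours (R - G) j) (neighbours (R - G) k))" for G
  define B where "B G = real (ecount (R - G) (neighbours (R \<inter> G) j) (neighbours (R \<inter> G) k))" for G
  have nb: "neighbours (R - G) v \<subseteq> {1..n}" "neighbours (R \<inter> G) v \<subseteq> {1..n}" for G v
    by (rule neighbours_subset; use R in auto)+
  have FM: "0 \<le> F G \<and> F G \<le> (real n)\<^sup>2" "0 \<le> B G \<and> B G \<le> (real n)\<^sup>2" for G
    unfolding F_def B_def by (intro conjI of_nat_0_le_iff ecount_le_n2 nb)+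
  have winF: "\<forall>G\<in>X - ?B. (1 - \<kappa>) * ((1 - \<alpha>) * f) \<le> F G \<and> F G \<le> (1 + \<kappa>) * ((1 - \<alpha>) * f)"
    using jk unfolding switch_good_def F_def by auto
  have winB: "\<forall>G\<in>Y - ?B. (1 - \<kappa>) * (\<alpha> * f) \<le> B G \<and> B G \<le> (1 + \<kappa>) * (\<alpha> * f)"
    using jk unfolding switch_good_def B_def by auto
  have lo: "0 \<le> (1 - \<kappa>) * ((1 - \<alpha>) * f)" "0 \<le> (1 + \<kappa>) * ((1 - \<alpha>) * f)"
    "0 \<le> (1 - \<kappa>) * (\<alpha> * f)" "0 \<le> (1 + \<kappa>) * (\<alpha> * f)"
    using \<alpha> \<kappa> f by auto
  have "(\<Sum>G\<in>X. ecount (R \<inter> G) (neighbours (R - G) j) (neighbours (R - G) k)) =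
      (\<Sum>G\<in>Y. ecount (R - G) (neighbours (R \<inter> G) j) (neighbours (R \<inter> G) k))"
    unfolding X_def Y_def jk(1)
    by (rule switching_double_count[OF R _ _ _ _ C]) (use e A jk in auto)
  then have eq: "(\<Sum>G\<in>X. F G) = (\<Sum>G\<in>Y. B G)"
    unfolding F_def B_def by (simp flip: of_nat_sum)
  have sub: "X \<subseteq> C" "Y \<subseteq> C" by (auto simp: X_def Y_def)
  note swX = sum_window[OF fin(1) FM(1) winF lo(1,2) b[OF sub(1)] zero_le_power2]
  note swY = sum_window[OF fin(2) FM(2) winB lo(3,4) b[OF sub(2)] zero_le_power2, folded eq]
  have "\<alpha> * (1 - 3 * \<kappa>) * (real (card X) + real (card Y)) \<le> real (card X) \<and>
      real (card X) \<le> \<alpha> * (1 + 4 * \<kappa>) * (real (card X) + real (card Y))"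
    by (intro conjI proportion_bounds[OF \<alpha> f \<kappa> of_nat_0_le_iff of_nat_0_le_iff refl swX swY])
  then show "\<alpha> * (1 - 3 * \<kappa>) * card C \<le> card {G \<in> C. e \<in> G}"
    "card {G \<in> C. e \<in> G} \<le> \<alpha> * (1 + 4 * \<kappa>) * card C"
    unfolding cC X_def [symmetric] by auto
qed

text \<open>The numbers \<open>x\<close>, \<open>y\<close> are the sizes of two neighbourhoods
  inside \<open>R\<close>, both near \<open>m\<close>, and \<open>z\<close> is the size of their
  overlap; \<open>E\<close> counts the edges of the whole graph between them and \<open>F\<close>
  those lying in \<open>R\<close>. The relative errors are 3\<eta> for each size and \<eta> each for
  discrepancy, overlap and sampling, 9\<eta> in all; the tenth \<eta> absorbs the products.\<close>

lemma switch_window: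
  fixes x y z m E F \<gamma> \<delta> \<eta> :: real
  assumes \<eta>: "0 < \<eta>" "\<eta> \<le> 1 / 100" and m: "2 \<le> \<eta> * m" and \<gamma>: "0 < \<gamma>" and \<delta>: "0 < \<delta>"
    and x: "\<bar>x - m\<bar> \<le> 3 * \<eta> * m" and y: "\<bar>y - m\<bar> \<le> 3 * \<eta> * m" and z: "0 \<le> z" "z \<le> x"
    and E: "\<bar>E - \<gamma> * (x * y - z)\<bar> \<le> \<eta> * \<gamma> * x * y" and F: "\<bar>F - \<delta> * E\<bar> \<le> \<eta> * \<delta> * \<gamma> * m\<^sup>2"
  shows "F \<in> {(1 - 10 * \<eta>) * (\<delta> * \<gamma> * m\<^sup>2) .. (1 + 10 * \<eta>) * (\<delta> * \<gamma> * m\<^sup>2)}"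
proof -
  have "0 < \<eta> * m" using m by linarith
  then have m0: "0 < m" using \<eta> by (simp add: zero_less_mult_iff)
  have xm: "(1 - 3 * \<eta>) * m \<le> x" "x \<le> (1 + 3 * \<eta>) * m" "(1 - 3 * \<eta>) * m \<le> y" "y \<le> (1 + 3 * \<eta>) * m"
    using x y by (auto simp: abs_le_iff algebra_simps)
  have p: "0 \<le> (1 - 3 * \<eta>) * m" using \<eta> m0 by simp
  have xy: "((1 - 3 * \<eta>) * m) * ((1 - 3 * \<eta>) * m) \<le> x * y" "x * y \<le> ((1 + 3 * \<eta>) * m) * ((1 + 3 * \<eta>) * m)"
    by (intro mult_mono xm p; use xm p in linarith)+
  have x0: "0 \<le> x" using xm p by linarith
  have "1 / 2 * m \<le> (1 - 3 * \<eta>) * m" using \<eta> m0 by (intro mult_right_mono) auto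
  then have "m \<le> 2 * y" using xm by linarith
  then have "\<eta> * m \<le> \<eta> * (2 * y)" using \<eta> by (intro mult_left_mono) auto
  \<comment> \<open>This makes the overlap harmless: it is at most \<open>x\<close>, hence at most
    \<open>\<eta> * x * y\<close>.\<close>
  then have "1 \<le> \<eta> * y" using m by linarith
  then have "x * 1 \<le> x * (\<eta> * y)" using x0 by (rule mult_left_mono)
  then have z': "z \<le> \<eta> * (x * y)" using z by (simp add: algebra_simps)
  have xy0: "0 \<le> x * y" using xy(1) p by (meson mult_nonneg_nonneg order_trans)
  have "E \<le> \<gamma> * (x * y - z) + \<eta> * \<gamma> * x * y" "\<gamma> * (x * y - z) - \<eta> * \<gamma> * x * y \<le> E"
    using E by (auto simp: abs_le_iff)
  moreover have "\<gamma> * (x * y - z) \<le> \<gamma> * (x * y)" using z \<gamma> by simp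
  moreover have "\<gamma> * (x * y - \<eta> * (x * y)) \<le> \<gamma> * (x * y - z)" using z' \<gamma> by simp
  ultimately have E': "E \<le> \<gamma> * ((1 + \<eta>) * (x * y))" "\<gamma> * ((1 - 2 * \<eta>) * (x * y)) \<le> E"
    by (auto simp: algebra_simps)
  have m2: "0 < \<delta> * \<gamma> * m\<^sup>2" using \<delta> \<gamma> m0 by simp
  have "\<eta> * \<eta> \<le> \<eta> * (1 / 100)" using \<eta> by (intro mult_left_mono) auto
  then have ee: "\<eta> * \<eta> \<le> \<eta> / 100" by simp
  then have "\<eta> * (\<eta> * \<eta>) \<le> \<eta> * (\<eta> / 100)" using \<eta> by (intro mult_left_mono) auto
  then have eee: "\<eta> * (\<eta> * \<eta>) \<le> \<eta> / 100" using ee \<eta> by linarith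
  have "F \<le> \<delta> * E + \<eta> * \<delta> * \<gamma> * m\<^sup>2" using F by (auto simp: abs_le_iff)
  also have "\<dots> \<le> \<delta> * (\<gamma> * ((1 + \<eta>) * (((1 + 3 * \<eta>) * m) * ((1 + 3 * \<eta>) * m)))) + \<eta> * \<delta> * \<gamma> * m\<^sup>2"
    by (intro add_right_mono mult_left_mono order_trans[OF E'(1)] xy) (use \<delta> \<gamma> \<eta> in auto)
  also have "\<dots> = ((1 + \<eta>) * ((1 + 3 * \<eta>) * (1 + 3 * \<eta>)) + \<eta>) * (\<delta> * \<gamma> * m\<^sup>2)"
    by (simp add: algebra_simps power2_eq_square)
  also have "\<dots> \<le> (1 + 10 * \<eta>) * (\<delta> * \<gamma> * m\<^sup>2)"
  proof (rule mult_right_mono)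
    have "(1 + \<eta>) * ((1 + 3 * \<eta>) * (1 + 3 * \<eta>)) + \<eta> =
        1 + 8 * \<eta> + 15 * (\<eta> * \<eta>) + 9 * (\<eta> * (\<eta> * \<eta>))" by (simp add: algebra_simps)
    then show "(1 + \<eta>) * ((1 + 3 * \<eta>) * (1 + 3 * \<eta>)) + \<eta> \<le> 1 + 10 * \<eta>"
      using ee eee \<eta>(1) by linarith
  qed (use m2 in simp)
  finally have up: "F \<le> (1 + 10 * \<eta>) * (\<delta> * \<gamma> * m\<^sup>2)" .
  have "(1 - 10 * \<eta>) * (\<delta> * \<gamma> * m\<^sup>2) \<le> ((1 - 2 * \<eta>) * ((1 - 3 * \<eta>) * (1 - 3 * \<eta>)) - \<eta>) * (\<delta> * \<gamma> * m\<^sup>2)"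
  proof (rule mult_right_mono)
    have "(1 - 2 * \<eta>) * ((1 - 3 * \<eta>) * (1 - 3 * \<eta>)) - \<eta> =
        1 - 9 * \<eta> + 21 * (\<eta> * \<eta>) - 18 * (\<eta> * (\<eta> * \<eta>))" by (simp add: algebra_simps)
    moreover have "0 \<le> \<eta> * \<eta>" by simp
    ultimately show "1 - 10 * \<eta> \<le> (1 - 2 * \<eta>) * ((1 - 3 * \<eta>) * (1 - 3 * \<eta>)) - \<eta>"
      using eee \<eta>(1) by linarith
  qed (use m2 in simp)
  also have "\<dots> = \<delta> * (\<gamma> * ((1 - 2 * \<eta>) * (((1 - 3 * \<eta>) * m) * ((1 - 3 * \<eta>) * m)))) - \<eta> * \<delta> * \<gamma> * m\<^sup>2"
    by (simp add: algebra_simps power2_eq_square)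
  also have "\<dots> \<le> \<delta> * E - \<eta> * \<delta> * \<gamma> * m\<^sup>2"
    by (intro diff_right_mono mult_left_mono order_trans[OF _ E'(2)] xy) (use \<delta> \<gamma> \<eta> in auto)
  also have "\<dots> \<le> F" using F by (auto simp: abs_le_iff)
  finally show ?thesis using up by auto
qed

text \<open>A form of jumbledness. Subtracting the diagonal makes the centre the exact mean in the
  binomial graph. The error is relative, which is why only sets of size at least \<sigma> are asked
  for.\<close>

definition discrepancy :: "nat \<Rightarrow> real \<Rightarrow> real \<Rightarrow> real \<Rightarrow> nat set set \<Rightarrow> bool" where
  "discrepancy n \<alpha> \<sigma> \<kappa> G \<longleftrightarrow> (\<forall>S\<subseteq>{1..n}. \<forall>T\<subseteq>{1..n}. \<sigma> \<le> card S \<longrightarrow> \<sigma> \<le> card T \<longrightarrow>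
     \<bar>real (ecount G S T) - \<alpha> * (real (card S) * real (card T) - real (card (S \<inter> T)))\<bar>
       \<le> \<kappa> * real (card S) * real (card T))"

text \<open>\<open>R\<close> acts on \<open>H\<close> like a \<delta>-sample. The bound is uniform
  over all \<open>S\<close> and \<open>T\<close> because it is applied to neighbourhoods inside
  \<open>R\<close>, which depend on \<open>R\<close>.\<close>

definition inherits :: "nat \<Rightarrow> real \<Rightarrow> real \<Rightarrow> nat set set \<Rightarrow> nat set set \<Rightarrow> bool" where
  "inherits n \<delta> \<tau> H R \<longleftrightarrow>
     (\<forall>S\<subseteq>{1..n}. \<forall>T\<subseteq>{1..n}. \<bar>real (ecount (R \<inter> H) S T) - \<delta> * real (ecount H S T)\<bar> \<le> \<tau> * (real n)\<^sup>2) \<and>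
     (\<forall>v\<in>{1..n}. \<bar>real (degree_in (R \<inter> H) v) - \<delta> * real (degree_in H v)\<bar> \<le> \<tau> * real n)"

lemma discrepancy_compl:
  assumes "G \<subseteq> pairs n" "discrepancy n \<alpha> \<sigma> \<kappa> G"
  shows "discrepancy n (1 - \<alpha>) \<sigma> \<kappa> (pairs n - G)"
  unfolding discrepancy_def
proof (intro allI impI)
  fix S T assume *: "S \<subseteq> {1..n}" "T \<subseteq> {1..n}" "\<sigma> \<le> card S" "\<sigma> \<le> card T"
  have "real (ecount (pairs n - G) S T) - (1 - \<alpha>) * (real (card S) * real (card T) - real (card (S \<inter> T))) =
    - (real (ecount G S T) - \<alpha> * (real (card S) * real (card T) - real (card (S \<inter> T))))"
    unfolding ecount_compl[OF assms(1) *(1,2)] by (simp add: algebra_simps)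
  then show "\<bar>real (ecount (pairs n - G) S T) - (1 - \<alpha>) * (real (card S) * real (card T) - real (card (S \<inter> T)))\<bar>
     \<le> \<kappa> * real (card S) * real (card T)"
    using assms(2) * unfolding discrepancy_def by (simp only: abs_minus_cancel)
qed

text \<open>Serves both directions of the switching. With \<open>H = G\<close> and \<open>H'\<close>
  its complement, so \<open>\<gamma> = \<alpha>\<close> and \<open>\<beta> = 1 - \<alpha>\<close>,
  it gives the forward count; exchanging the two gives the backward count. The typical neighbourhood
  size is \<open>m\<close>, so actual sizes exceed the discrepancy threshold
  \<open>m / 2\<close>.\<close>

lemma ecount_inherited:
  assumes H: "H \<subseteq> pairs n" and H': "H' \<subseteq> pairs n" and \<eta>: "0 < \<eta>" "\<eta> \<le> 1 / 100"
    and \<gamma>: "0 < \<gamma>" and \<beta>: "0 < \<beta>" and \<delta>: "0 < \<delta>"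
    and m: "m = \<delta> * \<beta> * n" "2 \<le> \<eta> * m" and \<tau>: "\<tau> * (real n)\<^sup>2 \<le> \<eta> * \<delta> * \<gamma> * m\<^sup>2" "\<tau> \<le> \<eta> * \<delta> * \<beta>"
    and disc: "discrepancy n \<gamma> (m / 2) (\<eta> * \<gamma>) H" and inh: "inherits n \<delta> \<tau> H R" "inherits n \<delta> \<tau> H' R"
    and deg: "\<And>v. v \<in> {1..n} \<Longrightarrow> \<bar>real (degree_in H' v) - \<beta> * n\<bar> \<le> 2 * \<eta> * \<beta> * n"
    and jk: "j \<in> {1..n}" "k \<in> {1..n}"
  shows "real (ecount (R \<inter> H) (neighbours (R \<inter> H') j) (neighbours (R \<inter> H') k))
    \<in> {(1 - 10 * \<eta>) * (\<delta> * \<gamma> * m\<^sup>2) .. (1 + 10 * \<eta>) * (\<delta> * \<gamma> * m\<^sup>2)}"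
proof -
  let ?S = "neighbours (R \<inter> H') j" and ?T = "neighbours (R \<inter> H') k"
  have "0 < \<eta> * m" using m(2) by linarith
  then have m0: "0 < m" using \<eta> by (simp add: zero_less_mult_iff)
  have RH': "R \<inter> H' \<subseteq> pairs n" using H' by auto
  have sub: "?S \<subseteq> {1..n}" "?T \<subseteq> {1..n}" by (rule neighbours_subset[OF RH'])+
  have c: "\<bar>real (card (neighbours (R \<inter> H') v)) - m\<bar> \<le> 3 * \<eta> * m" if v: "v \<in> {1..n}" for v
  proof -
    have 1: "\<bar>real (card (neighbours (R \<inter> H') v)) - \<delta> * real (degree_in H' v)\<bar> \<le> \<tau> * n"
      using inh(2) v unfolding card_neighbours[OF RH'] inherits_def by blast
    have 2: "\<tau> * n \<le> (\<eta> * \<delta> * \<beta>) * n" using \<tau>(2) by (rule mult_right_mono) simp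
    have "\<delta> * \<bar>real (degree_in H' v) - \<beta> * n\<bar> \<le> \<delta> * (2 * \<eta> * \<beta> * n)"
      using deg[OF v] \<delta> by (intro mult_left_mono) auto
    moreover have "\<delta> * \<bar>real (degree_in H' v) - \<beta> * n\<bar> = \<bar>\<delta> * real (degree_in H' v) - m\<bar>"
      using \<delta> by (simp add: m(1) abs_mult_pos' algebra_simps)
    ultimately have 3: "\<bar>\<delta> * real (degree_in H' v) - m\<bar> \<le> 2 * \<eta> * m" by (simp add: m(1) algebra_simps)
    show ?thesis using 1 2 3 by (simp add: m(1) algebra_simps abs_le_iff)
  qed
  have half: "m / 2 \<le> card (neighbours (R \<inter> H') v)" if "v \<in> {1..n}" for v
  proof -
    have "3 * \<eta> * m \<le> 1 / 2 * m" using \<eta> m0 by (intro mult_right_mono) auto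
    then show ?thesis using c[OF that] by (auto simp: abs_le_iff)
  qed
  show ?thesis
  proof (rule switch_window[OF \<eta> m(2) \<gamma> \<delta> c[OF jk(1)] c[OF jk(2)],
        where E = "ecount H ?S ?T" and z = "card (?S \<inter> ?T)"])
    show "real (card (?S \<inter> ?T)) \<le> real (card ?S)"
      using sub finite_subset[OF sub(1)] by (simp add: card_mono)
    show "\<bar>real (ecount H ?S ?T) - \<gamma> * (real (card ?S) * real (card ?T) - real (card (?S \<inter> ?T)))\<bar>
      \<le> \<eta> * \<gamma> * real (card ?S) * real (card ?T)"
      using disc sub half jk unfolding discrepancy_def by blast
    have "\<bar>real (ecount (R \<inter> H) ?S ?T) - \<delta> * real (ecount H ?S ?T)\<bar> \<le> \<tau> * (real n)\<^sup>2"
      using inh(1) sub unfolding inherits_def by blast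
    then show "\<bar>real (ecount (R \<inter> H) ?S ?T) - \<delta> * real (ecount H ?S ?T)\<bar> \<le> \<eta> * \<delta> * \<gamma> * m\<^sup>2"
      using \<tau>(1) by linarith
  qed simp
qed

text \<open>The sampling error has to be small against both switching counts, which are of orders
  \<alpha>(1 - \<alpha>)^2 and \<alpha>^2(1 - \<alpha>) times \<open>\<delta> ^ 3 * n ^ 2\<close>,
  and against the neighbourhood sizes. The symmetric choice of \<tau> lies below \<eta> times each
  of these at once.\<close>

lemma switch_goodI:
  assumes R: "R \<subseteq> pairs n" and G: "G \<subseteq> pairs n" and \<eta>: "0 < \<eta>" "\<eta> \<le> 1 / 100"
    and \<alpha>: "0 < \<alpha>" "\<alpha> < 1" and \<delta>: "0 < \<delta>" "\<delta> \<le> 1"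
    and big: "2 \<le> \<eta> * (\<delta> * \<alpha> * n)" "2 \<le> \<eta> * (\<delta> * (1 - \<alpha>) * n)"
    and \<tau>: "\<tau> = \<eta> * \<delta> ^ 3 * \<alpha>\<^sup>2 * (1 - \<alpha>)\<^sup>2"
    and disc: "discrepancy n \<alpha> (\<delta> * (1 - \<alpha>) * n / 2) (\<eta> * \<alpha>) G"
      "discrepancy n \<alpha> (\<delta> * \<alpha> * n / 2) (\<eta> * (1 - \<alpha>)) G"
    and inh: "inherits n \<delta> \<tau> G R" "inherits n \<delta> \<tau> (pairs n - G) R"
    and deg: "\<And>v. v \<in> {1..n} \<Longrightarrow> \<bar>real (degree_in G v) - \<alpha> * n\<bar> \<le> \<eta> * \<alpha> * n"
      "\<And>v. v \<in> {1..n} \<Longrightarrow> \<bar>real (degree_in G v) - \<alpha> * n\<bar> \<le> \<eta> * (1 - \<alpha>) * n"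
  shows "switch_good n R \<alpha> (10 * \<eta>) (\<delta> ^ 3 * \<alpha> * (1 - \<alpha>) * (real n)\<^sup>2) G"
proof -
  let ?Gc = "pairs n - G"
  have RG: "R - G = R \<inter> ?Gc" using R by auto
  have Gc: "?Gc \<subseteq> pairs n" by auto
  have 1: "\<delta> * \<alpha> * (\<delta> * (1 - \<alpha>) * n)\<^sup>2 = (1 - \<alpha>) * (\<delta> ^ 3 * \<alpha> * (1 - \<alpha>) * (real n)\<^sup>2)"
    by (simp add: power2_eq_square power3_eq_cube)
  have 2: "\<delta> * (1 - \<alpha>) * (\<delta> * \<alpha> * n)\<^sup>2 = \<alpha> * (\<delta> ^ 3 * \<alpha> * (1 - \<alpha>) * (real n)\<^sup>2)"
    by (simp add: power2_eq_square power3_eq_cube)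
  have le1: "a * (b * c) \<le> a" if "0 \<le> a" "0 \<le> b" "b \<le> 1" "0 \<le> c" "c \<le> 1" for a b c :: real
    using mult_left_mono[of "b * c" 1 a] that by (auto simp: mult_le_one)
  have \<tau>1: "\<tau> * (real n)\<^sup>2 \<le> \<eta> * \<delta> * \<alpha> * (\<delta> * (1 - \<alpha>) * n)\<^sup>2"
  proof -
    have "\<tau> * (real n)\<^sup>2 = (\<eta> * \<delta> * \<alpha> * (\<delta> * (1 - \<alpha>) * n)\<^sup>2) * (\<alpha> * 1)"
      by (simp add: \<tau> power2_eq_square power3_eq_cube)
    also have "\<dots> \<le> \<eta> * \<delta> * \<alpha> * (\<delta> * (1 - \<alpha>) * n)\<^sup>2"
      by (rule le1) (use \<eta> \<delta> \<alpha> in auto)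
    finally show ?thesis .
  qed
  have \<tau>2: "\<tau> * (real n)\<^sup>2 \<le> \<eta> * \<delta> * (1 - \<alpha>) * (\<delta> * \<alpha> * n)\<^sup>2"
  proof -
    have "\<tau> * (real n)\<^sup>2 = (\<eta> * \<delta> * (1 - \<alpha>) * (\<delta> * \<alpha> * n)\<^sup>2) * ((1 - \<alpha>) * 1)"
      by (simp add: \<tau> power2_eq_square power3_eq_cube)
    also have "\<dots> \<le> \<eta> * \<delta> * (1 - \<alpha>) * (\<delta> * \<alpha> * n)\<^sup>2"
      by (rule le1) (use \<eta> \<delta> \<alpha> in auto)
    finally show ?thesis .
  qed
  have \<tau>3: "\<tau> \<le> \<eta> * \<delta> * (1 - \<alpha>)"
  proof -
    have "\<tau> = (\<eta> * \<delta> * (1 - \<alpha>)) * (\<delta>\<^sup>2 * (\<alpha>\<^sup>2 * (1 - \<alpha>)))"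
      by (simp add: \<tau> power2_eq_square power3_eq_cube)
    also have "\<dots> \<le> \<eta> * \<delta> * (1 - \<alpha>)"
      by (rule le1) (use \<eta> \<delta> \<alpha> in \<open>auto intro!: power_le_one mult_le_one\<close>)
    finally show ?thesis .
  qed
  have \<tau>4: "\<tau> \<le> \<eta> * \<delta> * \<alpha>"
  proof -
    have "\<tau> = (\<eta> * \<delta> * \<alpha>) * (\<delta>\<^sup>2 * (\<alpha> * (1 - \<alpha>)\<^sup>2))"
      by (simp add: \<tau> power2_eq_square power3_eq_cube)
    also have "\<dots> \<le> \<eta> * \<delta> * \<alpha>"
      by (rule le1) (use \<eta> \<delta> \<alpha> in \<open>auto intro!: power_le_one mult_le_one\<close>)
    finally show ?thesis .
  qed
  have discc: "discrepancy n (1 - \<alpha>) (\<delta> * \<alpha> * n / 2) (\<eta> * (1 - \<alpha>)) ?Gc"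
    by (rule discrepancy_compl[OF G disc(2)])
  have degc: "\<bar>real (degree_in ?Gc v) - (1 - \<alpha>) * n\<bar> \<le> 2 * \<eta> * (1 - \<alpha>) * n" if v: "v \<in> {1..n}" for v
  proof -
    have "n \<ge> 1" using v by simp
    then have "real (degree_in ?Gc v) = real n - 1 - real (degree_in G v)"
      using degree_compl[OF G v] by linarith
    \<comment> \<open>The degrees in the complement are centred at
      \<open>(1 - \<alpha>) * n - 1\<close>; the lost 1 is absorbed by the second half of the
      tolerance \<open>2 * \<eta>\<close>.\<close>
    then have eq: "real (degree_in ?Gc v) - (1 - \<alpha>) * n = - (real (degree_in G v) - \<alpha> * n) - 1"
      by (simp add: algebra_simps)
    have "\<eta> * (\<delta> * (1 - \<alpha>) * n) = (\<eta> * (1 - \<alpha>) * n) * (\<delta> * 1)" by simp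
    also have "\<dots> \<le> \<eta> * (1 - \<alpha>) * n" by (rule le1) (use \<eta> \<delta> \<alpha> in auto)
    finally have "1 \<le> \<eta> * (1 - \<alpha>) * n" using big(2) by linarith
    then show ?thesis unfolding eq using deg(2)[OF v] by (simp add: abs_le_iff)
  qed
  have degG: "\<bar>real (degree_in G v) - \<alpha> * n\<bar> \<le> 2 * \<eta> * \<alpha> * n" if v: "v \<in> {1..n}" for v
  proof -
    have "0 \<le> \<eta> * \<alpha> * n" using \<eta> \<alpha> by simp
    then show ?thesis using deg(1)[OF v] by linarith
  qed
  have "1 - \<alpha> > 0" using \<alpha> by simp
  show ?thesis
    unfolding switch_good_def RG 1 [symmetric] 2 [symmetric]
    using ecount_inherited[OF G Gc \<eta> \<alpha>(1) \<open>1 - \<alpha> > 0\<close> \<delta>(1) refl big(2) \<tau>1 \<tau>3 disc(1) inh degc]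
      ecount_inherited[OF Gc G \<eta> \<open>1 - \<alpha> > 0\<close> \<alpha>(1) \<delta>(1) refl big(1) \<tau>2 \<tau>4 discc inh(2,1) degG]
    by auto
qed

text \<open>Since the sets have at most \<open>n\<close> elements each, the threshold
  \<open>\<tau> * n ^ 2\<close> gives the exponent \<open>\<tau> ^ 2 * n ^ 2\<close>, enough against
  \<open>4 ^ n\<close> pairs of sets. A degree is a sum of fewer than \<open>n\<close> coins and
  yields only \<open>\<tau> ^ 2 * n\<close>, but there the union runs over just \<open>n\<close>
  vertices.\<close>

lemma prob_inherits:
  assumes H: "H \<subseteq> pairs n" and \<delta>: "0 \<le> \<delta>" "\<delta> \<le> 1" and \<tau>: "0 < \<tau>" and n: "0 < n"
  shows "measure_pmf.prob (random_subset (pairs n) (\<lambda>_. \<delta>)) {R. \<not> inherits n \<delta> \<tau> H R}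
    \<le> 4 ^ n * (2 * exp (- (\<tau>\<^sup>2 * (real n)\<^sup>2))) + n * (2 * exp (- 2 * (\<tau>\<^sup>2 * n)))"
proof -
  let ?M = "random_subset (pairs n) (\<lambda>_. \<delta>)"
  let ?X = "{R. \<exists>S\<subseteq>{1..n}. \<exists>T\<subseteq>{1..n}. (S \<noteq> {} \<and> T \<noteq> {}) \<and>
     \<bar>real (ecount (R \<inter> H) S T) - (\<Sum>e\<in>H. \<delta> * pair_weight S T e)\<bar> \<ge> \<tau> * (real n)\<^sup>2}"
  let ?Y = "\<lambda>v. {R. \<bar>real (degree_in (R \<inter> H) v) - (\<Sum>e\<in>H. \<delta> * of_bool (v \<in> e))\<bar> \<ge> \<tau> * n}"
  have X: "measure_pmf.prob ?M ?X \<le> 4 ^ n * (2 * exp (- (\<tau>\<^sup>2 * (real n)\<^sup>2)))"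
  proof (rule ecount_Hoeffding_uniform[OF H, where t = "\<lambda>_ _. \<tau> * (real n)\<^sup>2"])
    fix S T assume ST: "S \<noteq> {} \<and> T \<noteq> {}" "S \<subseteq> {1..n}" "T \<subseteq> {1..n}"
    have "card S \<le> n" "card T \<le> n" using card_mono[of "{1..n}"] ST by auto
    then have "real (card S) * real (card T) \<le> real n * real n" by (intro mult_mono) auto
    then have "(\<tau>\<^sup>2 * (real n)\<^sup>2) * (real (card S) * real (card T)) \<le> (\<tau>\<^sup>2 * (real n)\<^sup>2) * (real n * real n)"
      by (rule mult_left_mono) simp
    then show "0 < \<tau> * (real n)\<^sup>2 \<and> \<tau>\<^sup>2 * (real n)\<^sup>2 * real (card S) * real (card T) \<le> (\<tau> * (real n)\<^sup>2)\<^sup>2 \<and>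
        S \<noteq> {} \<and> T \<noteq> {}"
      using \<tau> n ST by (simp add: power2_eq_square mult_ac)
  qed (use \<delta> in auto)
  have Y: "measure_pmf.prob ?M (\<Union>v\<in>{1..n}. ?Y v) \<le> real (card {1..n}) * (2 * exp (- 2 * (\<tau>\<^sup>2 * n)))"
  proof (rule prob_UN_le)
    fix v assume v: "v \<in> {1..n}"
    have "measure_pmf.prob ?M (?Y v) \<le> 2 * exp (- 2 * (\<tau> * n)\<^sup>2 / n)"
      by (rule degree_Hoeffding[OF H _ v]) (use \<delta> \<tau> n in auto)
    also have "- 2 * (\<tau> * n)\<^sup>2 / n = - 2 * (\<tau>\<^sup>2 * n)" using n by (simp add: power2_eq_square)
    finally show "measure_pmf.prob ?M (?Y v) \<le> 2 * exp (- 2 * (\<tau>\<^sup>2 * n))" .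
  qed simp
  have "{R. \<not> inherits n \<delta> \<tau> H R} \<subseteq> ?X \<union> (\<Union>v\<in>{1..n}. ?Y v)"
  proof
    fix R assume R: "R \<in> {R. \<not> inherits n \<delta> \<tau> H R}"
    show "R \<in> ?X \<union> (\<Union>v\<in>{1..n}. ?Y v)"
    proof (rule ccontr)
      assume no: "R \<notin> ?X \<union> (\<Union>v\<in>{1..n}. ?Y v)"
      have "inherits n \<delta> \<tau> H R"
        unfolding inherits_def
      proof (intro conjI allI impI ballI)
        fix S T assume ST: "S \<subseteq> {1..n}" "T \<subseteq> {1..n}"
        have fin: "finite S" "finite T" using ST finite_subset by auto
        have eq: "(\<Sum>e\<in>H. \<delta> * pair_weight S T e) = \<delta> * real (ecount H S T)"
          by (simp add: ecount_eq_sum[OF H fin] sum_distrib_left)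
        show "\<bar>real (ecount (R \<inter> H) S T) - \<delta> * real (ecount H S T)\<bar> \<le> \<tau> * (real n)\<^sup>2"
        proof (cases "S = {} \<or> T = {}")
          case True
          then have "ecount H' S T = 0" for H' by (auto simp: ecount_def)
          then show ?thesis using \<tau> by simp
        next
          case False
          then have "\<not> \<tau> * (real n)\<^sup>2 \<le> \<bar>real (ecount (R \<inter> H) S T) - (\<Sum>e\<in>H. \<delta> * pair_weight S T e)\<bar>"
            using no ST by blast
          then show ?thesis unfolding eq by simp
        qed
      next
        fix v assume v: "v \<in> {1..n}"
        have eq: "(\<Sum>e\<in>H. \<delta> * of_bool (v \<in> e)) = \<delta> * real (degree_in H v)"
          by (simp add: degree_sum_eq[OF H] sum_distrib_left)
        show "\<bar>real (degree_in (R \<inter> H) v) - \<delta> * real (degree_in H v)\<bar> \<le> \<tau> * real n"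
        proof -
          have "\<not> \<tau> * n \<le> \<bar>real (degree_in (R \<inter> H) v) - (\<Sum>e\<in>H. \<delta> * of_bool (v \<in> e))\<bar>"
            using no v by blast
          then show ?thesis unfolding eq by simp
        qed
      qed
      then show False using R by simp
    qed
  qed
  then have "measure_pmf.prob ?M {R. \<not> inherits n \<delta> \<tau> H R} \<le> measure_pmf.prob ?M (?X \<union> (\<Union>v\<in>{1..n}. ?Y v))"
    by (rule measure_pmf.finite_measure_mono) simp
  also have "\<dots> \<le> measure_pmf.prob ?M ?X + measure_pmf.prob ?M (\<Union>v\<in>{1..n}. ?Y v)"
    by (rule measure_Un_le) auto
  finally show ?thesis using X Y by simp
qed


section \<open>The probability of a degree sequence\<close>

text \<open>Likelihood ratio, pair by pair, using 1 + y \<le> exp y: a present pair contributes (f e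
  - \<alpha>) / \<alpha> to the exponent, an absent one - (f e - \<alpha>) / (1 - \<alpha>).\<close>

lemma pmf_random_subset_le_tilt:
  assumes P: "finite P" "A \<subseteq> P" and f: "\<And>e. e \<in> P \<Longrightarrow> 0 \<le> f e \<and> f e \<le> 1" and \<alpha>: "0 < \<alpha>" "\<alpha> < 1"
  shows "pmf (random_subset P f) A \<le>
    exp (((\<Sum>e\<in>A. f e - \<alpha>) - \<alpha> * (\<Sum>e\<in>P. f e - \<alpha>)) / (\<alpha> * (1 - \<alpha>))) * pmf (random_subset P (\<lambda>_. \<alpha>)) A"
proof -
  let ?c = "\<lambda>e. if e \<in> A then (f e - \<alpha>) / \<alpha> else - (f e - \<alpha>) / (1 - \<alpha>)"
  have factor: "(if e \<in> A then f e else 1 - f e) \<le> exp (?c e) * (if e \<in> A then \<alpha> else 1 - \<alpha>)" for e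
  proof -
    have "f e = \<alpha> * (1 + (f e - \<alpha>) / \<alpha>)" using \<alpha> by (simp add: field_simps)
    also have "\<dots> \<le> \<alpha> * exp ((f e - \<alpha>) / \<alpha>)"
      using \<alpha> by (intro mult_left_mono exp_ge_add_one_self) auto
    finally have 1: "f e \<le> \<alpha> * exp ((f e - \<alpha>) / \<alpha>)" .
    have "1 - f e = (1 - \<alpha>) * (1 + - (f e - \<alpha>) / (1 - \<alpha>))" using \<alpha> by (simp add: field_simps)
    also have "\<dots> \<le> (1 - \<alpha>) * exp (- (f e - \<alpha>) / (1 - \<alpha>))"
      using \<alpha> by (intro mult_left_mono exp_ge_add_one_self) auto
    finally show ?thesis using 1 by (simp add: mult.commute)
  qed
  have "pmf (random_subset P f) A = (\<Prod>e\<in>P. if e \<in> A then f e else 1 - f e)"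
    by (rule pmf_random_subset[OF P f])
  also have "\<dots> \<le> (\<Prod>e\<in>P. exp (?c e) * (if e \<in> A then \<alpha> else 1 - \<alpha>))"
    using f by (intro prod_mono conjI factor) auto
  also have "\<dots> = exp (\<Sum>e\<in>P. ?c e) * pmf (random_subset P (\<lambda>_. \<alpha>)) A"
    using P \<alpha> by (simp add: prod.distrib exp_sum pmf_random_subset)
  also have "(\<Sum>e\<in>P. ?c e) = (\<Sum>e\<in>A. f e - \<alpha>) / \<alpha> - (\<Sum>e\<in>P - A. f e - \<alpha>) / (1 - \<alpha>)"
  proof -
    have "(\<Sum>e\<in>P. ?c e) = (\<Sum>e\<in>A. ?c e) + (\<Sum>e\<in>P - A. ?c e)"
      using P by (subst sum.subset_diff[of A]) auto
    also have "(\<Sum>e\<in>A. ?c e) = (\<Sum>e\<in>A. f e - \<alpha>) / \<alpha>"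
      by (simp add: sum_divide_distrib)
    also have "(\<Sum>e\<in>P - A. ?c e) = (\<Sum>e\<in>P - A. - ((f e - \<alpha>) / (1 - \<alpha>)))"
      by (intro sum.cong) (auto simp: minus_divide_left)
    also have "\<dots> = - ((\<Sum>e\<in>P - A. f e - \<alpha>) / (1 - \<alpha>))"
      by (simp add: sum_negf sum_divide_distrib)
    finally show ?thesis by simp
  qed
  also have "(\<Sum>e\<in>P - A. f e - \<alpha>) = (\<Sum>e\<in>P. f e - \<alpha>) - (\<Sum>e\<in>A. f e - \<alpha>)"
    by (rule sum_diff) (use P in auto)
  also have "s / \<alpha> - (t - s) / (1 - \<alpha>) = (s - \<alpha> * t) / (\<alpha> * (1 - \<alpha>))" for s t
    using \<alpha> by (simp add: field_simps)
  finally show ?thesis .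
qed

text \<open>Toggling a pair multiplies the probability by \<alpha> / (1 - \<alpha>) or its inverse,
  and both are at least \<alpha> (1 - \<alpha>).\<close>

lemma pmf_random_subset_edit:
  assumes P: "finite P" "A \<subseteq> P" "G \<subseteq> P" and \<alpha>: "0 < \<alpha>" "\<alpha> < 1" and k: "card (sym_diff G A) \<le> k"
  shows "pmf (random_subset P (\<lambda>_. \<alpha>)) A * (\<alpha> * (1 - \<alpha>)) ^ k \<le> pmf (random_subset P (\<lambda>_. \<alpha>)) G"
proof -
  let ?D = "sym_diff G A"
  let ?h = "\<lambda>A e. if e \<in> A then \<alpha> else 1 - \<alpha>"
  have c: "0 \<le> \<alpha> * (1 - \<alpha>)" "\<alpha> * (1 - \<alpha>) \<le> 1" using \<alpha> by (auto intro: mult_le_one)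
  have D: "?D \<subseteq> P" using P by auto
  have "(\<alpha> * (1 - \<alpha>)) ^ k \<le> (\<alpha> * (1 - \<alpha>)) ^ card ?D" using k c by (intro power_decreasing) auto
  also have "\<dots> = (\<Prod>e\<in>P. if e \<in> ?D then \<alpha> * (1 - \<alpha>) else 1)"
    using P D by (simp add: prod.If_cases Int_absorb1 del: Un_iff Diff_iff)
  finally have "pmf (random_subset P (\<lambda>_. \<alpha>)) A * (\<alpha> * (1 - \<alpha>)) ^ k \<le>
      (\<Prod>e\<in>P. ?h A e) * (\<Prod>e\<in>P. if e \<in> ?D then \<alpha> * (1 - \<alpha>) else 1)"
    using P \<alpha> by (simp add: pmf_random_subset mult_left_mono prod_nonneg)
  also have "\<dots> = (\<Prod>e\<in>P. ?h A e * (if e \<in> ?D then \<alpha> * (1 - \<alpha>) else 1))"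
    by (simp only: prod.distrib)
  also have "\<dots> \<le> (\<Prod>e\<in>P. ?h G e)"
  proof (rule prod_mono)
    fix e
    have "\<alpha> * (\<alpha> * (1 - \<alpha>)) \<le> 1 - \<alpha>" "(1 - \<alpha>) * (\<alpha> * (1 - \<alpha>)) \<le> \<alpha>"
      using \<alpha> mult_right_mono[of "\<alpha> * \<alpha>" 1 "1 - \<alpha>"] mult_right_mono[of "(1 - \<alpha>) * (1 - \<alpha>)" 1 \<alpha>]
      by (auto simp: mult_le_one mult_ac)
    then show "0 \<le> ?h A e * (if e \<in> ?D then \<alpha> * (1 - \<alpha>) else 1) \<and>
        ?h A e * (if e \<in> ?D then \<alpha> * (1 - \<alpha>) else 1) \<le> ?h G e"
      using \<alpha> by auto
  qed
  also have "\<dots> = pmf (random_subset P (\<lambda>_. \<alpha>)) G" using P \<alpha> by (simp add: pmf_random_subset)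
  finally show ?thesis .
qed

text \<open>A set of at most \<open>k\<close> elements arises from \<open>k\<close> successive
  choices of an element of \<open>P\<close> or of nothing; \<open>None\<close> stands for
  nothing.\<close>

lemma card_small_subsets:
  assumes "finite P" shows "card {X. X \<subseteq> P \<and> card X \<le> k} \<le> (card P + 1) ^ k"
proof (induction k)
  case 0
  have "{X. X \<subseteq> P \<and> card X \<le> 0} = {{}}" using assms finite_subset by fastforce
  then show ?case by simp
next
  case (Suc k)
  let ?S = "\<lambda>k. {X. X \<subseteq> P \<and> card X \<le> k}"
  let ?g = "\<lambda>(X, z). case z of None \<Rightarrow> X | Some x \<Rightarrow> insert x X"
  let ?O = "insert None (Some ` P)"
  have fin: "finite (?S k)" for k using assms by (auto intro: finite_subset[of _ "Pow P"])
  have "?S (Suc k) \<subseteq> ?g ` (?S k \<times> ?O)"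
  proof
    fix X assume X: "X \<in> ?S (Suc k)"
    show "X \<in> ?g ` (?S k \<times> ?O)"
    proof (cases "X = {}")
      case True
      then show ?thesis by (intro image_eqI[of _ _ "({}, None)"]) auto
    next
      case False
      then obtain x where x: "x \<in> X" by auto
      have "finite X" using X assms finite_subset by auto
      moreover have "card X \<le> Suc k" using X by blast
      ultimately have "card (X - {x}) \<le> k" using card_Diff_singleton[OF x] by linarith
      then show ?thesis using X x
        by (intro image_eqI[of _ _ "(X - {x}, Some x)"]) (auto simp: insert_absorb)
    qed
  qed
  then have "card (?S (Suc k)) \<le> card (?g ` (?S k \<times> ?O))"
    using fin assms by (intro card_mono) auto
  also have "\<dots> \<le> card (?S k \<times> ?O)" using fin assms by (intro card_image_le) auto
  also have "\<dots> = card (?S k) * (card P + 1)"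
    using assms by (simp add: card_cartesian_product card_image)
  also have "\<dots> \<le> (card P + 1) ^ k * (card P + 1)" using Suc by (rule mult_right_mono) simp
  finally show ?case by (simp add: mult.commute)
qed

text \<open>Probability is transported from the typical set \<open>T\<close> of the tilted model to
  \<open>GG\<close> by an edit map. Three losses occur: \<open>exp X\<close> for undoing the tilt,
  \<open>\<alpha> * (1 - \<alpha>)\<close> per edited pair, and the multiplicity of the map. The
  last is at most \<open>(card P + 1) ^ k\<close>, because \<open>Y\<close> is recovered from its
  image and the set of edited pairs.\<close>

lemma prob_edit_lower_bound:
  assumes P: "finite P" and f: "\<And>e. e \<in> P \<Longrightarrow> 0 \<le> f e \<and> f e \<le> 1" and \<alpha>: "0 < \<alpha>" "\<alpha> < 1"
    and GG: "GG \<subseteq> Pow P"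
    and typical: "\<And>Y. Y \<in> T \<Longrightarrow> Y \<subseteq> P \<Longrightarrow> \<exists>G\<in>GG. card (sym_diff G Y) \<le> k"
    and tilt: "\<And>Y. Y \<in> T \<Longrightarrow> Y \<subseteq> P \<Longrightarrow>
      ((\<Sum>e\<in>Y. f e - \<alpha>) - \<alpha> * (\<Sum>e\<in>P. f e - \<alpha>)) / (\<alpha> * (1 - \<alpha>)) \<le> X"
  shows "measure_pmf.prob (random_subset P f) T * (\<alpha> * (1 - \<alpha>) / (real (card P) + 1)) ^ k * exp (- X)
    \<le> measure_pmf.prob (random_subset P (\<lambda>_. \<alpha>)) GG"
proof -
  let ?h = "\<lambda>A. pmf (random_subset P (\<lambda>_. \<alpha>)) A"
  let ?c = "(\<alpha> * (1 - \<alpha>)) ^ k" and ?N = "(real (card P) + 1) ^ k"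
  have c: "0 < ?c" "0 < ?N" using \<alpha> by auto
  have finT: "finite (T \<inter> Pow P)" and finG: "finite GG" using P GG by (auto intro: finite_subset)
  from typical have "\<forall>Y\<in>T \<inter> Pow P. \<exists>G. G \<in> GG \<and> card (sym_diff G Y) \<le> k" by blast
  then obtain \<phi> where \<phi>: "\<And>Y. Y \<in> T \<inter> Pow P \<Longrightarrow> \<phi> Y \<in> GG \<and> card (sym_diff (\<phi> Y) Y) \<le> k"
    by metis
  have fiber: "real (card {Y \<in> T \<inter> Pow P. \<phi> Y = G}) \<le> ?N" if "G \<in> GG" for G
  proof -
    have "card {Y \<in> T \<inter> Pow P. \<phi> Y = G} \<le> card {X. X \<subseteq> P \<and> card X \<le> k}"
    proof (rule card_inj_on_le[where f = "sym_diff G"])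
      show "inj_on (sym_diff G) {Y \<in> T \<inter> Pow P. \<phi> Y = G}" by (rule inj_onI) blast
      show "sym_diff G ` {Y \<in> T \<inter> Pow P. \<phi> Y = G} \<subseteq> {X. X \<subseteq> P \<and> card X \<le> k}"
      proof
        fix Z assume "Z \<in> sym_diff G ` {Y \<in> T \<inter> Pow P. \<phi> Y = G}"
        then obtain Y where Y: "Y \<in> T \<inter> Pow P" "\<phi> Y = G" "Z = sym_diff G Y" by blast
        moreover have "Z \<subseteq> P" using Y GG that by blast
        ultimately show "Z \<in> {X. X \<subseteq> P \<and> card X \<le> k}" using \<phi>[OF Y(1)] by auto
      qed
    qed (use P in auto)
    also have "\<dots> \<le> (card P + 1) ^ k" by (rule card_small_subsets[OF P])
    finally have "real (card {Y \<in> T \<inter> Pow P. \<phi> Y = G}) \<le> real ((card P + 1) ^ k)" by (simp only: of_nat_le_iff)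
    then show ?thesis by (simp add: add.commute)
  qed
  have "measure_pmf.prob (random_subset P f) T = (\<Sum>Y\<in>T \<inter> Pow P. pmf (random_subset P f) Y)"
    by (rule prob_random_subset[OF P])
  also have "\<dots> \<le> (\<Sum>Y\<in>T \<inter> Pow P. exp X * (?h (\<phi> Y) / ?c))"
  proof (rule sum_mono)
    fix Y assume Y: "Y \<in> T \<inter> Pow P"
    have "pmf (random_subset P f) Y \<le>
        exp (((\<Sum>e\<in>Y. f e - \<alpha>) - \<alpha> * (\<Sum>e\<in>P. f e - \<alpha>)) / (\<alpha> * (1 - \<alpha>))) * ?h Y"
      using Y by (intro pmf_random_subset_le_tilt[OF P _ f \<alpha>]) auto
    also have "\<dots> \<le> exp X * ?h Y" using tilt[of Y] Y by (intro mult_right_mono) auto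
    also have "?h Y \<le> ?h (\<phi> Y) / ?c"
      using pmf_random_subset_edit[OF P _ _ \<alpha>, of Y "\<phi> Y" k] Y \<phi>[OF Y] GG c
      by (auto simp: pos_le_divide_eq)
    finally show "pmf (random_subset P f) Y \<le> exp X * (?h (\<phi> Y) / ?c)" by simp
  qed
  also have "\<dots> = (\<Sum>G\<in>GG. \<Sum>Y\<in>{Y \<in> T \<inter> Pow P. \<phi> Y = G}. exp X * (?h (\<phi> Y) / ?c))"
    by (rule sum.group [symmetric]) (use finT finG \<phi> in auto)
  also have "\<dots> = (\<Sum>G\<in>GG. real (card {Y \<in> T \<inter> Pow P. \<phi> Y = G}) * (exp X * (?h G / ?c)))"
    by (intro sum.cong refl) simp
  also have "\<dots> \<le> (\<Sum>G\<in>GG. ?N * (exp X * (?h G / ?c)))"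
    using fiber c by (intro sum_mono mult_right_mono) auto
  also have "\<dots> = exp X * ?N / ?c * (\<Sum>G\<in>GG. ?h G)"
    unfolding sum_distrib_left by (intro sum.cong refl) simp
  also have "(\<Sum>G\<in>GG. ?h G) = measure_pmf.prob (random_subset P (\<lambda>_. \<alpha>)) GG"
    using GG finG by (simp add: measure_measure_pmf_finite)
  finally have "measure_pmf.prob (random_subset P f) T * (?c / ?N * exp (- X)) \<le>
      exp X * ?N / ?c * measure_pmf.prob (random_subset P (\<lambda>_. \<alpha>)) GG * (?c / ?N * exp (- X))"
    using c by (intro mult_right_mono) auto
  also have "\<dots> = measure_pmf.prob (random_subset P (\<lambda>_. \<alpha>)) GG"
  proof -
    have "e * N / c * p * (c / N * inverse e) = p" if "c \<noteq> 0" "N \<noteq> 0" "e \<noteq> 0" for e N c p :: real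
      using that by (simp add: field_simps)
    then show ?thesis using c unfolding exp_minus by (metis exp_not_eq_zero less_irrefl)
  qed
  finally show ?thesis by (simp add: power_divide mult_ac)
qed

section \<open>From the binomial graph to the uniform graph with given degrees\<close>

lemma card_degree_graphs:
  assumes "G \<in> graphs_with_degrees n d" "G' \<in> graphs_with_degrees n d"
  shows "card G = card G'"
proof -
  have "2 * card G = (\<Sum>v\<in>{1..n}. d v)" if "G \<in> graphs_with_degrees n d" for G
    using handshake[OF graphs_with_degreesD(1)[OF that]] graphs_with_degreesD(2)[OF that] by simp
  from this[OF assms(1)] this[OF assms(2)] show ?thesis by simp
qed

text \<open>Graphs with equal degrees have equally many edges, hence equal binomial probability: the
  binomial graph conditioned on its degree sequence is uniform.\<close>

lemma prob_degree_graph_transfer: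
  assumes ne: "graphs_with_degrees n d \<noteq> {}" and \<alpha>: "0 < \<alpha>" "\<alpha> < 1"
  shows "measure_pmf.prob (pmf_of_set (graphs_with_degrees n d)) X *
      measure_pmf.prob (random_subset (pairs n) (\<lambda>_. \<alpha>)) (graphs_with_degrees n d)
    \<le> measure_pmf.prob (random_subset (pairs n) (\<lambda>_. \<alpha>)) (X \<inter> graphs_with_degrees n d)"
proof -
  let ?M = "random_subset (pairs n) (\<lambda>_. \<alpha>)" and ?GG = "graphs_with_degrees n d"
  obtain G0 where G0: "G0 \<in> ?GG" using ne by auto
  have const: "pmf ?M G = pmf ?M G0" if G: "G \<in> ?GG" for G
  proof -
    have *: "pmf ?M G = \<alpha> ^ card G * (1 - \<alpha>) ^ (card (pairs n) - card G)" if "G \<in> ?GG" for G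
    proof -
      have GP: "G \<subseteq> pairs n" by (rule graphs_with_degreesD(1)[OF that])
      then have "pmf ?M G = (\<Prod>e\<in>pairs n. if e \<in> G then \<alpha> else 1 - \<alpha>)"
        using \<alpha> by (intro pmf_random_subset) auto
      also have "\<dots> = \<alpha> ^ card G * (1 - \<alpha>) ^ card (pairs n - G)"
        using GP by (simp add: prod.If_cases Int_absorb1 Diff_eq)
      also have "card (pairs n - G) = card (pairs n) - card G"
        by (rule card_Diff_subset[OF finite_subset_pairs[OF GP] GP])
      finally show ?thesis .
    qed
    show ?thesis unfolding *[OF G] *[OF G0] card_degree_graphs[OF G G0] ..
  qed
  have 1: "measure_pmf.prob ?M ?GG = card ?GG * pmf ?M G0"
    using const by (simp add: measure_measure_pmf_finite)
  have 2: "measure_pmf.prob ?M (X \<inter> ?GG) = card (X \<inter> ?GG) * pmf ?M G0"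
    using const by (subst measure_measure_pmf_finite) auto
  have "card ?GG > 0" using ne by (auto simp: card_gt_0_iff)
  then show ?thesis unfolding 1 2 using ne by (simp add: measure_pmf_of_set Int_commute)
qed

text \<open>For the threshold \<kappa> |S| |T| the Hoeffding exponent is \<kappa>^2 |S| |T|, which
  is at least (\<kappa> \<sigma>)^2; it competes with the \<open>4 ^ n\<close> of the union
  bound.\<close>

lemma prob_not_discrepancy:
  assumes \<alpha>: "0 \<le> \<alpha>" "\<alpha> \<le> 1" and \<sigma>: "0 < \<sigma>" and \<kappa>: "0 < \<kappa>"
  shows "measure_pmf.prob (random_subset (pairs n) (\<lambda>_. \<alpha>)) {G. \<not> discrepancy n \<alpha> \<sigma> \<kappa> (G \<inter> pairs n)}
    \<le> 4 ^ n * (2 * exp (- (\<kappa> * \<sigma>)\<^sup>2))"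
proof (rule prob_subset_le[OF _ ecount_Hoeffding_uniform[where H = "pairs n" and
      good = "\<lambda>S T. \<sigma> \<le> card S \<and> \<sigma> \<le> card T" and t = "\<lambda>S T. \<kappa> * real (card S) * real (card T)"]])
  fix S T :: "nat set" assume *: "\<sigma> \<le> card S \<and> \<sigma> \<le> card T"
  have pos: "0 < real (card S)" "0 < real (card T)" using * \<sigma> by linarith+
  have "\<sigma> * \<sigma> \<le> real (card S) * real (card T)" using * \<sigma> by (intro mult_mono) auto
  then have "(\<kappa> * \<kappa>) * (real (card S) * real (card T)) * (\<sigma> * \<sigma>) \<le>
      (\<kappa> * \<kappa>) * (real (card S) * real (card T)) * (real (card S) * real (card T))"
    by (intro mult_left_mono) auto
  then show "0 < \<kappa> * real (card S) * real (card T) \<and>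
      (\<kappa> * \<sigma>)\<^sup>2 * real (card S) * real (card T) \<le> (\<kappa> * real (card S) * real (card T))\<^sup>2 \<and>
      S \<noteq> {} \<and> T \<noteq> {}"
    using pos \<kappa> by (auto simp: power2_eq_square mult_ac)
next
  show "{G. \<not> discrepancy n \<alpha> \<sigma> \<kappa> (G \<inter> pairs n)} \<subseteq>
    {R. \<exists>S\<subseteq>{1..n}. \<exists>T\<subseteq>{1..n}. (\<sigma> \<le> card S \<and> \<sigma> \<le> card T) \<and>
       \<kappa> * real (card S) * real (card T) \<le>
         \<bar>real (ecount (R \<inter> pairs n) S T) - (\<Sum>e\<in>pairs n. \<alpha> * pair_weight S T e)\<bar>}"
  proof
    fix G assume "G \<in> {G. \<not> discrepancy n \<alpha> \<sigma> \<kappa> (G \<inter> pairs n)}"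
    then obtain S T where ST: "S \<subseteq> {1..n}" "T \<subseteq> {1..n}" "\<sigma> \<le> card S" "\<sigma> \<le> card T"
      and dev0: "\<not> \<bar>real (ecount (G \<inter> pairs n) S T) - \<alpha> * (real (card S) * real (card T) - real (card (S \<inter> T)))\<bar>
        \<le> \<kappa> * real (card S) * real (card T)"
      unfolding discrepancy_def mem_Collect_eq by blast
    from dev0 have dev: "\<kappa> * real (card S) * real (card T) \<le>
        \<bar>real (ecount (G \<inter> pairs n) S T) - \<alpha> * (real (card S) * real (card T) - real (card (S \<inter> T)))\<bar>"
      by linarith
    have fin: "finite S" "finite T" using ST finite_subset by auto
    have "(\<Sum>e\<in>pairs n. \<alpha> * pair_weight S T e) = \<alpha> * real (ecount (pairs n) S T)"
      by (subst ecount_eq_sum[OF order_refl fin]) (simp add: sum_distrib_left)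
    then have "(\<Sum>e\<in>pairs n. \<alpha> * pair_weight S T e) =
        \<alpha> * (real (card S) * real (card T) - real (card (S \<inter> T)))"
      using ecount_pairs[OF ST(1,2)] by simp
    with dev have dev': "\<kappa> * real (card S) * real (card T) \<le>
        \<bar>real (ecount (G \<inter> pairs n) S T) - (\<Sum>e\<in>pairs n. \<alpha> * pair_weight S T e)\<bar>" by simp
    show "G \<in> {R. \<exists>S\<subseteq>{1..n}. \<exists>T\<subseteq>{1..n}. (\<sigma> \<le> card S \<and> \<sigma> \<le> card T) \<and>
       \<kappa> * real (card S) * real (card T) \<le>
         \<bar>real (ecount (R \<inter> pairs n) S T) - (\<Sum>e\<in>pairs n. \<alpha> * pair_weight S T e)\<bar>}"
      unfolding mem_Collect_eq using ST dev' by blast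
  qed
qed (use \<alpha> in auto)

lemma sum_pairs_at:
  fixes g :: "nat set \<Rightarrow> real"
  assumes v: "v \<in> {1..n}"
  shows "(\<Sum>e\<in>pairs n. g e * of_bool (v \<in> e)) = (\<Sum>u\<in>{1..n} - {v}. g {v, u})"
proof -
  have "(\<Sum>e\<in>pairs n. g e * of_bool (v \<in> e)) = (\<Sum>e\<in>{e \<in> pairs n. v \<in> e}. g e)"
    by (intro sum.mono_neutral_cong_right) auto
  also have "\<dots> = (\<Sum>u\<in>{1..n} - {v}. g {v, u})"
  proof (rule sum.reindex_cong[where l = "\<lambda>u. {v, u}"])
    show "inj_on (\<lambda>u. {v, u}) ({1..n} - {v})" by (auto simp: inj_on_def doubleton_eq_iff)
    show "{e \<in> pairs n. v \<in> e} = (\<lambda>u. {v, u}) ` ({1..n} - {v})"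
    proof
      show "{e \<in> pairs n. v \<in> e} \<subseteq> (\<lambda>u. {v, u}) ` ({1..n} - {v})"
      proof
        fix e assume e: "e \<in> {e \<in> pairs n. v \<in> e}"
        then obtain x y where xy: "e = {x, y}" "x \<in> {1..n}" "y \<in> {1..n}" "x \<noteq> y"
          by (auto elim!: nsets2_E)
        then have "e = {v, if v = x then y else x}" using e by auto
        then show "e \<in> (\<lambda>u. {v, u}) ` ({1..n} - {v})" using xy e by (auto split: if_splits)
      qed
    qed (use v in auto)
  qed simp
  finally show ?thesis .
qed

lemma card_pairs_le: "n \<ge> 1 \<Longrightarrow> real (card (pairs n)) + 1 \<le> (real n)\<^sup>2"
proof -
  assume n: "n \<ge> 1"
  have "(\<Sum>v\<in>{1..n}. degree_in (pairs n) v) = (\<Sum>v\<in>{1..n}. n - 1)"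
    by (intro sum.cong refl degree_pairs)
  then have "2 * card (pairs n) = n * (n - 1)" using handshake[of "pairs n" n] by simp
  then have "2 * real (card (pairs n)) = real n * (real n - 1)"
    using n by (metis of_nat_1 of_nat_diff of_nat_mult of_nat_numeral)
  moreover have "1 * 1 \<le> real n * real n" using n by (intro mult_mono) auto
  moreover have "0 \<le> (real n - 1)\<^sup>2" by simp
  ultimately show ?thesis using n by (simp add: power2_eq_square algebra_simps)
qed

text \<open>
  The number of graphs with degrees \<open>d\<close> is bounded from below by means of the inhomogeneous model
  with edge probabilities \<open>\<alpha> + x i + x j\<close>, whose expected degrees are exactly \<open>d v - s\<close>: a typical
  graph of that model lies slightly below \<open>d\<close> everywhere and can be edited into one with degrees \<open>d\<close>.
\<close>

lemma prob_degrees_lower_bound: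
  fixes r s \<alpha> \<mu> :: real and d :: "nat \<Rightarrow> nat" and \<sigma> K n :: nat
  defines "\<mu> \<equiv> (\<Sum>v\<in>{1..n}. real (d v) - s) / n"
  defines "\<alpha> \<equiv> \<mu> / (real n - 1)"
  assumes n: "4 \<le> n" and ne: "graphs_with_degrees n d \<noteq> {}"
    and r: "\<And>u v. u \<in> {1..n} \<Longrightarrow> v \<in> {1..n} \<Longrightarrow> real (d u) \<le> real (d v) + r" "0 \<le> r" and s: "0 < s"
    and \<alpha>: "0 < \<alpha>" "\<alpha> < 1" and r\<alpha>: "8 * r \<le> \<alpha> * n" "4 * r \<le> (1 - \<alpha>) * n"
    and \<sigma>: "2 \<le> \<sigma>" "\<And>v. v \<in> {1..n} \<Longrightarrow> \<sigma> \<le> n - 1 - d v" "16 * s * n < \<alpha> * (real \<sigma>)\<^sup>2"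
    and K: "3 * s * n \<le> K"
    and tail1: "n * (2 * exp (- 2 * s\<^sup>2 / n)) \<le> 1 / 4"
    and tail2: "4 ^ n * (2 * exp (- (\<alpha>\<^sup>2 * (real \<sigma>)\<^sup>2 / 64))) \<le> 1 / 4"
  shows "1 / 2 * (\<alpha> * (1 - \<alpha>) / (real n)\<^sup>2) ^ K * exp (- (2 * r * (r + s) / (\<alpha> * (1 - \<alpha>))))
    \<le> measure_pmf.prob (random_subset (pairs n) (\<lambda>_. \<alpha>)) (graphs_with_degrees n d)"
proof -
  let ?V = "{1..n}" and ?P = "pairs n" and ?GG = "graphs_with_degrees n d"
  define c where "c v = real (d v) - s" for v
  \<comment> \<open>If the \<open>x v\<close> sum to 0, the expected degree of \<open>v\<close> is
    \<open>(n - 1) * \<alpha> + (n - 2) * x v\<close>: the pairs at \<open>v\<close> contribute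
    \<open>n - 1\<close> copies of \<open>x v\<close>, and the other vertices together
    \<open>- x v\<close>. Equating this to \<open>c v\<close> gives the quotient.\<close>
  define x where "x v = (c v - \<mu>) / (real n - 2)" for v
  define f where "f e = \<alpha> + (\<Sum>v\<in>e. x v)" for e
  have n1: "real n - 2 > 0" "real n - 1 > 0" "real n > 0" using n by auto
  have n\<mu>: "n * \<mu> = (\<Sum>v\<in>?V. c v)" using n by (simp add: \<mu>_def c_def)
  then have sumx: "(\<Sum>v\<in>?V. x v) = 0"
    by (simp add: x_def sum_divide_distrib [symmetric] sum_subtractf)
  have c_eq: "c v = \<mu> + (real n - 2) * x v" for v using n1 by (simp add: x_def)
  have \<mu>_eq: "\<mu> = (real n - 1) * \<alpha>" using n1 by (simp add: \<alpha>_def)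
  have xb: "\<bar>x v\<bar> \<le> r / (real n - 2)" if v: "v \<in> ?V" for v
  proof -
    have up: "n * \<mu> \<le> (\<Sum>u\<in>?V. c v + r)" unfolding n\<mu>
      using r(1)[OF _ v] by (intro sum_mono) (auto simp: c_def)
    have "(\<Sum>u\<in>?V. c v - r) \<le> n * \<mu>" unfolding n\<mu>
    proof (rule sum_mono)
      fix u assume "u \<in> ?V"
      from r(1)[OF v this] show "c v - r \<le> c u" by (simp add: c_def)
    qed
    then have "n * (c v - r) \<le> n * \<mu>" "n * \<mu> \<le> n * (c v + r)" using up by simp_all
    then have "\<bar>c v - \<mu>\<bar> \<le> r" using n1(3) by (simp add: abs_le_iff)
    then show ?thesis using n1 by (simp add: x_def abs_mult divide_right_mono)
  qed
  have r2: "r / (real n - 2) \<le> 2 * r / n"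
  proof -
    have "r * n \<le> r * (2 * (real n - 2))" using n r(2) by (intro mult_left_mono) auto
    then show ?thesis using n1 by (simp add: divide_le_eq le_divide_eq mult_ac)
  qed
  have fb: "\<alpha> / 2 \<le> f e" "f e \<le> 1" "0 \<le> f e" if e: "e \<in> ?P" for e
  proof -
    obtain u v where uv: "e = {u, v}" "u \<in> ?V" "v \<in> ?V" "u \<noteq> v" using e by (auto elim!: nsets2_E)
    have "\<bar>f e - \<alpha>\<bar> \<le> \<bar>x u\<bar> + \<bar>x v\<bar>" using uv by (simp add: f_def)
    also have "\<dots> \<le> 4 * r / n" using xb[OF uv(2)] xb[OF uv(3)] r2 by linarith
    finally have *: "\<bar>f e - \<alpha>\<bar> \<le> 4 * r / n" .
    have "4 * r / n \<le> \<alpha> / 2" "4 * r / n \<le> 1 - \<alpha>" using r\<alpha> n1(3) by (auto simp: field_simps)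
    then show "\<alpha> / 2 \<le> f e" "f e \<le> 1" "0 \<le> f e" using * \<alpha> by linarith+
  qed
  have f01: "0 \<le> f e \<and> f e \<le> 1" if "e \<in> ?P" for e using fb[OF that] by simp
  have sumA: "(\<Sum>e\<in>Y. f e - \<alpha>) = (\<Sum>v\<in>?V. degree_in Y v * x v)" if "Y \<subseteq> ?P" for Y
    using sum_degree_weighted[OF that, of x] by (simp add: f_def)
  have "(\<Sum>e\<in>?P. f e - \<alpha>) = (\<Sum>v\<in>?V. (real n - 1) * x v)"
  proof -
    have "real (degree_in ?P v) = real n - 1" if "v \<in> ?V" for v
      using degree_pairs[OF that] n by (simp add: of_nat_diff)
    then show ?thesis unfolding sumA[OF order_refl] by (intro sum.cong) auto
  qed
  then have sumP: "(\<Sum>e\<in>?P. f e - \<alpha>) = 0" using sumx by (simp flip: sum_distrib_left)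
  have Edeg: "(\<Sum>e\<in>?P. f e * of_bool (v \<in> e)) = c v" if v: "v \<in> ?V" for v
  proof -
    have "(\<Sum>e\<in>?P. f e * of_bool (v \<in> e)) = (\<Sum>u\<in>?V - {v}. f {v, u})" by (rule sum_pairs_at[OF v])
    also have "\<dots> = (\<Sum>u\<in>?V - {v}. (\<alpha> + x v) + x u)" by (intro sum.cong refl) (auto simp: f_def)
    also have "\<dots> = (real n - 1) * (\<alpha> + x v) + (\<Sum>u\<in>?V - {v}. x u)"
      using v n by (simp add: sum.distrib of_nat_diff)
    also have "(\<Sum>u\<in>?V - {v}. x u) = - x v" using sumx v by (simp add: sum_diff1)
    finally show ?thesis by (simp add: c_eq \<mu>_eq algebra_simps)
  qed
  \<comment> \<open>The typical graphs: in \<open>T1\<close> every degree lies strictly between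
    \<open>d v - 2 * s\<close> and \<open>d v\<close>, so edits only have to add degrees;
    \<open>T2\<close> supplies the edges they rewire.\<close>
  define T1 where "T1 = {Y. \<forall>v\<in>?V. \<bar>real (degree_in (Y \<inter> ?P) v) - c v\<bar> < s}"
  define T2 where "T2 = {Y. \<forall>A\<subseteq>?V. \<forall>B\<subseteq>?V. \<sigma> \<le> card A \<and> \<sigma> \<le> card B \<longrightarrow>
    \<bar>real (ecount (Y \<inter> ?P) A B) - (\<Sum>e\<in>?P. f e * pair_weight A B e)\<bar> < \<alpha> / 8 * real (card A) * real (card B)}"
  let ?M = "random_subset ?P f"
  have "measure_pmf.prob ?M (- T1) \<le> 1 / 4"
  proof -
    have "measure_pmf.prob ?M (\<Union>v\<in>?V. {Y. s \<le> \<bar>real (degree_in (Y \<inter> ?P) v) - (\<Sum>e\<in>?P. f e * of_bool (v \<in> e))\<bar>})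
        \<le> real (card ?V) * (2 * exp (- 2 * s\<^sup>2 / n))"
      by (rule prob_UN_le[OF _ degree_Hoeffding[OF order_refl f01 _ s]]) auto
    also have "\<dots> \<le> 1 / 4" using tail1 by simp
    finally show ?thesis
    proof (rule prob_subset_le [rotated], intro subsetI)
      fix Y assume "Y \<in> - T1"
      then obtain v where v: "v \<in> ?V" "\<not> \<bar>real (degree_in (Y \<inter> ?P) v) - c v\<bar> < s"
        unfolding T1_def by blast
      then have "s \<le> \<bar>real (degree_in (Y \<inter> ?P) v) - (\<Sum>e\<in>?P. f e * of_bool (v \<in> e))\<bar>"
        unfolding Edeg[OF v(1)] by linarith
      then show "Y \<in> (\<Union>v\<in>?V. {Y. s \<le> \<bar>real (degree_in (Y \<inter> ?P) v) - (\<Sum>e\<in>?P. f e * of_bool (v \<in> e))\<bar>})"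
        using v(1) by blast
    qed
  qed
  moreover have "measure_pmf.prob ?M (- T2) \<le> 1 / 4"
  proof -
    have "measure_pmf.prob ?M {Y. \<exists>A\<subseteq>?V. \<exists>B\<subseteq>?V. (\<sigma> \<le> card A \<and> \<sigma> \<le> card B) \<and>
        \<alpha> / 8 * real (card A) * real (card B) \<le>
          \<bar>real (ecount (Y \<inter> ?P) A B) - (\<Sum>e\<in>?P. f e * pair_weight A B e)\<bar>}
        \<le> 4 ^ n * (2 * exp (- (\<alpha>\<^sup>2 * (real \<sigma>)\<^sup>2 / 64)))"
    proof (rule ecount_Hoeffding_uniform[OF order_refl f01])
      fix A B :: "nat set" assume AB: "\<sigma> \<le> card A \<and> \<sigma> \<le> card B"
      have pos: "0 < real (card A)" "0 < real (card B)" using AB \<sigma>(1) by auto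
      have "real \<sigma> * real \<sigma> \<le> real (card A) * real (card B)" using AB by (intro mult_mono) auto
      then have "(\<alpha>\<^sup>2 / 64 * (real (card A) * real (card B))) * (real \<sigma> * real \<sigma>) \<le>
          (\<alpha>\<^sup>2 / 64 * (real (card A) * real (card B))) * (real (card A) * real (card B))"
        by (intro mult_left_mono) auto
      then show "0 < \<alpha> / 8 * real (card A) * real (card B) \<and>
          \<alpha>\<^sup>2 * (real \<sigma>)\<^sup>2 / 64 * real (card A) * real (card B) \<le> (\<alpha> / 8 * real (card A) * real (card B))\<^sup>2 \<and>
          A \<noteq> {} \<and> B \<noteq> {}"
        using pos \<alpha> by (auto simp: power2_eq_square mult_ac)
    qed
    also have "\<dots> \<le> 1 / 4" by (rule tail2)
    finally show ?thesis
    proof (rule prob_subset_le [rotated], intro subsetI)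
      fix Y assume "Y \<in> - T2"
      then obtain A B where AB: "A \<subseteq> ?V" "B \<subseteq> ?V" "\<sigma> \<le> card A \<and> \<sigma> \<le> card B"
        "\<not> \<bar>real (ecount (Y \<inter> ?P) A B) - (\<Sum>e\<in>?P. f e * pair_weight A B e)\<bar> <
          \<alpha> / 8 * real (card A) * real (card B)"
        unfolding T2_def by blast
      then show "Y \<in> {Y. \<exists>A\<subseteq>?V. \<exists>B\<subseteq>?V. (\<sigma> \<le> card A \<and> \<sigma> \<le> card B) \<and>
        \<alpha> / 8 * real (card A) * real (card B) \<le>
          \<bar>real (ecount (Y \<inter> ?P) A B) - (\<Sum>e\<in>?P. f e * pair_weight A B e)\<bar>}"
        unfolding not_less by blast
    qed
  qed
  moreover have "measure_pmf.prob ?M (- (T1 \<inter> T2)) \<le> measure_pmf.prob ?M (- T1) + measure_pmf.prob ?M (- T2)"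
    unfolding Compl_Int by (rule measure_Un_le) auto
  moreover have "measure_pmf.prob ?M (- (T1 \<inter> T2)) = 1 - measure_pmf.prob ?M (T1 \<inter> T2)"
    using measure_pmf.prob_compl[of "T1 \<inter> T2" ?M] by (simp add: Compl_eq_Diff_UNIV)
  ultimately have T: "1 / 2 \<le> measure_pmf.prob ?M (T1 \<inter> T2)" by linarith
  have edit: "\<exists>G\<in>?GG. card (sym_diff G Y) \<le> K" if Y: "Y \<in> T1 \<inter> T2" "Y \<subseteq> ?P" for Y
  proof -
    have YP: "Y \<inter> ?P = Y" using Y by auto
    have dY: "real (degree_in Y v) < real (d v)" "real (d v) < real (degree_in Y v) + 2 * s" if "v \<in> ?V" for v
    proof -
      have "\<bar>real (degree_in (Y \<inter> ?P) v) - c v\<bar> < s" using Y(1) that unfolding T1_def by blast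
      then show "real (degree_in Y v) < real (d v)" "real (d v) < real (degree_in Y v) + 2 * s"
        unfolding YP c_def by linarith+
    qed
    obtain G0 where G0: "G0 \<in> ?GG" using ne by auto
    have "(\<Sum>v\<in>?V. d v) = 2 * card G0"
      using handshake[OF graphs_with_degreesD(1)[OF G0]] graphs_with_degreesD(2)[OF G0] by simp
    moreover have "(\<Sum>v\<in>?V. degree_in Y v) = 2 * card Y" by (rule handshake[OF Y(2)])
    moreover have "(\<Sum>v\<in>?V. d v - degree_in Y v) + (\<Sum>v\<in>?V. degree_in Y v) = (\<Sum>v\<in>?V. d v)"
      unfolding sum.distrib [symmetric] using dY(1) by (intro sum.cong) (force simp: less_imp_le)+
    \<comment> \<open>Repairs add degrees two at a time, so parity matters; it holds because the
      degree sum of an actual realisation of \<open>d\<close> is even, as is that of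
      \<open>Y\<close>.\<close>
    ultimately have "even (\<Sum>v\<in>?V. d v - degree_in Y v)" by presburger
    then obtain k where k: "(\<Sum>v\<in>?V. d v - degree_in Y v) = 2 * k" by (auto elim: evenE)
    have "real (2 * k) = (\<Sum>v\<in>?V. real (d v - degree_in Y v))" by (simp flip: k)
    also have "\<dots> \<le> (\<Sum>v\<in>?V. 2 * s)"
    proof (rule sum_mono)
      fix v assume v: "v \<in> ?V"
      then have "degree_in Y v \<le> d v" using dY(1)[OF v] by linarith
      then show "real (d v - degree_in Y v) \<le> 2 * s" using dY(2)[OF v] by (simp add: of_nat_diff)
    qed
    finally have ks: "real k \<le> s * n" by (simp add: mult.commute)
    have "\<exists>G\<in>?GG. card (sym_diff G Y) \<le> 3 * k"
    proof (rule edit_to_degrees[OF Y(2) _ k])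
      show "degree_in Y v \<le> d v" if "v \<in> ?V" for v using dY(1)[OF that] by linarith
      fix A B assume AB: "A \<subseteq> ?V" "B \<subseteq> ?V" "\<sigma> \<le> card A" "\<sigma> \<le> card B"
      have fin: "finite A" "finite B" using AB finite_subset by auto
      let ?a = "real (card A)" and ?b = "real (card B)"
      \<comment> \<open>As \<sigma> is at least 2, the diagonal takes up at most half of A \<times>
        B. Together with \<open>f e \<ge> \<alpha> / 2\<close> the mean is at least \<alpha> / 4 per
        ordered pair, and the fluctuation allowed by \<open>T2\<close> is only half of that.\<close>
      have "2 * real (card (A \<inter> B)) \<le> 2 * ?a" using fin by (simp add: card_mono)
      also have "\<dots> \<le> ?b * ?a" using AB \<sigma>(1) by (intro mult_right_mono) auto
      finally have half: "?a * ?b / 2 \<le> ?a * ?b - real (card (A \<inter> B))" by (simp add: mult.commute)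
      have "\<alpha> / 4 * (?a * ?b) = \<alpha> / 2 * (?a * ?b / 2)" by simp
      also have "\<dots> \<le> \<alpha> / 2 * (?a * ?b - real (card (A \<inter> B)))"
        using half \<alpha> by (intro mult_left_mono) auto
      also have "\<dots> = (\<Sum>e\<in>?P. \<alpha> / 2 * pair_weight A B e)"
        unfolding ecount_pairs[OF AB(1,2), symmetric] ecount_eq_sum[OF order_refl fin]
        by (simp add: sum_distrib_left)
      also have "\<dots> \<le> (\<Sum>e\<in>?P. f e * pair_weight A B e)"
        using fb by (intro sum_mono mult_right_mono) auto
      finally have mean: "\<alpha> / 4 * (?a * ?b) \<le> (\<Sum>e\<in>?P. f e * pair_weight A B e)" .
      have "\<bar>real (ecount Y A B) - (\<Sum>e\<in>?P. f e * pair_weight A B e)\<bar> < \<alpha> / 8 * ?a * ?b"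
      proof -
        have "\<bar>real (ecount (Y \<inter> ?P) A B) - (\<Sum>e\<in>?P. f e * pair_weight A B e)\<bar> < \<alpha> / 8 * ?a * ?b"
          using Y(1) AB unfolding T2_def by blast
        then show ?thesis unfolding YP .
      qed
      then have "(\<Sum>e\<in>?P. f e * pair_weight A B e) - real (ecount Y A B) < \<alpha> / 8 * (?a * ?b)"
        unfolding mult.assoc by linarith
      moreover have "\<alpha> / 4 * (?a * ?b) = \<alpha> / 8 * (?a * ?b) + \<alpha> / 8 * (?a * ?b)" by simp
      ultimately have "\<alpha> / 8 * (?a * ?b) < real (ecount Y A B)" using mean by linarith
      moreover have "\<alpha> / 8 * (real \<sigma> * real \<sigma>) \<le> \<alpha> / 8 * (?a * ?b)"
        using AB \<alpha> by (intro mult_left_mono mult_mono) auto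
      moreover have "2 * (s * n) < \<alpha> / 8 * (real \<sigma> * real \<sigma>)" using \<sigma>(3) by (simp add: power2_eq_square)
      ultimately have "real (2 * k) < real (ecount Y A B)" using ks by simp
      then show "2 * k < ecount Y A B" by (simp only: of_nat_less_iff)
    qed (use \<sigma>(2) in auto)
    moreover have "3 * k \<le> K"
    proof -
      have "real (3 * k) \<le> real K" using ks K by simp
      then show ?thesis by (simp only: of_nat_le_iff)
    qed
    ultimately show ?thesis by (meson le_trans)
  qed
  have tilt: "((\<Sum>e\<in>Y. f e - \<alpha>) - \<alpha> * (\<Sum>e\<in>?P. f e - \<alpha>)) / (\<alpha> * (1 - \<alpha>)) \<le> 2 * r * (r + s) / (\<alpha> * (1 - \<alpha>))"
    if Y: "Y \<in> T1 \<inter> T2" "Y \<subseteq> ?P" for Y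
  proof -
    have YP: "Y \<inter> ?P = Y" using Y by auto
    let ?\<rho> = "r / (real n - 2)"
    have \<rho>: "0 \<le> ?\<rho>" using r n1 by simp
    \<comment> \<open>The degree is written as \<open>\<mu>\<close>, plus the systematic excess
      \<open>(n - 2) * x v\<close>, plus a fluctuation below \<open>s\<close>. The first term
      cancels as the \<open>x v\<close> sum to 0; the other two give the summands \<open>r\<close>
      and \<open>s\<close> of the final factor.\<close>
    have "(\<Sum>v\<in>?V. degree_in Y v * x v) = (\<Sum>v\<in>?V. \<mu> * x v + ((real n - 2) * (x v * x v) + (real (degree_in Y v) - c v) * x v))"
      by (intro sum.cong refl) (simp add: c_eq algebra_simps)
    also have "\<dots> = (\<Sum>v\<in>?V. (real n - 2) * (x v * x v) + (real (degree_in Y v) - c v) * x v)"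
      using sumx by (simp add: sum.distrib flip: sum_distrib_left)
    also have "\<dots> \<le> (\<Sum>v\<in>?V. (real n - 2) * (?\<rho> * ?\<rho>) + s * ?\<rho>)"
    proof (intro sum_mono add_mono)
      fix v assume v: "v \<in> ?V"
      have "x v * x v \<le> ?\<rho> * ?\<rho>"
        using mult_mono[OF xb[OF v] xb[OF v]] \<rho> by (simp flip: abs_mult)
      then show "(real n - 2) * (x v * x v) \<le> (real n - 2) * (?\<rho> * ?\<rho>)" using n1 by (intro mult_left_mono) auto
      have "\<bar>real (degree_in (Y \<inter> ?P) v) - c v\<bar> < s" using Y(1) v unfolding T1_def by blast
      then have "\<bar>real (degree_in Y v) - c v\<bar> \<le> s" unfolding YP by simp
      then have "\<bar>real (degree_in Y v) - c v\<bar> * \<bar>x v\<bar> \<le> s * ?\<rho>"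
        using xb[OF v] s by (intro mult_mono) auto
      then show "(real (degree_in Y v) - c v) * x v \<le> s * ?\<rho>" by (simp flip: abs_mult)
    qed
    also have "\<dots> = n * ?\<rho> * (r + s)"
    proof -
      have "(real n - 2) * (?\<rho> * ?\<rho>) = r * ?\<rho>" using n1 by simp
      then show ?thesis by (simp only: sum_constant card_atLeastAtMost) (simp add: algebra_simps add_divide_distrib)
    qed
    also have "\<dots> \<le> 2 * r * (r + s)"
    proof (rule mult_right_mono)
      have "n * ?\<rho> \<le> n * (2 * r / n)" using r2 by (rule mult_left_mono) simp
      then show "n * ?\<rho> \<le> 2 * r" using n1 by simp
    qed (use r s in auto)
    finally show ?thesis unfolding sumP sumA[OF Y(2)] using \<alpha> by (simp add: divide_right_mono)
  qed
  let ?E = "exp (- (2 * r * (r + s) / (\<alpha> * (1 - \<alpha>))))"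
  have GP: "?GG \<subseteq> Pow ?P" using graphs_with_degreesD(1) by blast
  have base: "measure_pmf.prob ?M (T1 \<inter> T2) * (\<alpha> * (1 - \<alpha>) / (real (card ?P) + 1)) ^ K * ?E
      \<le> measure_pmf.prob (random_subset ?P (\<lambda>_. \<alpha>)) ?GG"
    by (rule prob_edit_lower_bound[OF _ f01 \<alpha> GP edit tilt]) auto
  have "\<alpha> * (1 - \<alpha>) / (real n)\<^sup>2 \<le> \<alpha> * (1 - \<alpha>) / (real (card ?P) + 1)"
    using card_pairs_le[of n] n \<alpha> by (intro divide_left_mono) auto
  then have "(\<alpha> * (1 - \<alpha>) / (real n)\<^sup>2) ^ K \<le> (\<alpha> * (1 - \<alpha>) / (real (card ?P) + 1)) ^ K"
    using \<alpha> by (intro power_mono) auto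
  then have "1 / 2 * (\<alpha> * (1 - \<alpha>) / (real n)\<^sup>2) ^ K \<le>
      measure_pmf.prob ?M (T1 \<inter> T2) * (\<alpha> * (1 - \<alpha>) / (real (card ?P) + 1)) ^ K"
    using T \<alpha> by (intro mult_mono) auto
  then have "1 / 2 * (\<alpha> * (1 - \<alpha>) / (real n)\<^sup>2) ^ K * ?E \<le>
      measure_pmf.prob ?M (T1 \<inter> T2) * (\<alpha> * (1 - \<alpha>) / (real (card ?P) + 1)) ^ K * ?E"
    by (rule mult_right_mono) simp
  then show ?thesis using base by (rule order_trans)
qed


section \<open>The sandwich for a fixed number of vertices\<close>

text \<open>Either \<open>G\<close> lacks discrepancy or \<open>R\<close> fails to sample
  \<open>G\<close> or its complement. The first event depends on \<open>G\<close> alone and is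
  imported from the binomial graph at the price \<open>1 / lb\<close>. The second is estimated for
  each fixed \<open>G\<close>, where independence of \<open>R\<close> makes conditioning
  unnecessary.\<close>

lemma prob_bad_exposure:
  fixes \<alpha> \<eta> \<delta> lb :: real
  assumes ne: "graphs_with_degrees n d \<noteq> {}" and n: "0 < n"
    and \<eta>: "0 < \<eta>" "\<eta> \<le> 1 / 100" and \<alpha>: "0 < \<alpha>" "\<alpha> < 1" and \<delta>: "0 < \<delta>" "\<delta> \<le> 1"
    and big: "2 \<le> \<eta> * (\<delta> * \<alpha> * n)" "2 \<le> \<eta> * (\<delta> * (1 - \<alpha>) * n)"
    and \<tau>: "\<tau> = \<eta> * \<delta> ^ 3 * \<alpha>\<^sup>2 * (1 - \<alpha>)\<^sup>2"
    and deg: "\<And>v. v \<in> {1..n} \<Longrightarrow> \<bar>real (d v) - \<alpha> * n\<bar> \<le> \<eta> * \<alpha> * n"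
      "\<And>v. v \<in> {1..n} \<Longrightarrow> \<bar>real (d v) - \<alpha> * n\<bar> \<le> \<eta> * (1 - \<alpha>) * n"
    and lb: "0 < lb" "lb \<le> measure_pmf.prob (random_subset (pairs n) (\<lambda>_. \<alpha>)) (graphs_with_degrees n d)"
  shows "measure_pmf.prob (pair_pmf (random_subset (pairs n) (\<lambda>_. \<delta>)) (pmf_of_set (graphs_with_degrees n d)))
      {(R, G). \<not> switch_good n R \<alpha> (10 * \<eta>) (\<delta> ^ 3 * \<alpha> * (1 - \<alpha>) * (real n)\<^sup>2) G}
    \<le> 4 * (4 :: real) ^ n * exp (- (\<eta> * \<alpha> * (\<delta> * (1 - \<alpha>) * n / 2))\<^sup>2) / lb
      + 4 * (4 :: real) ^ n * exp (- (\<tau>\<^sup>2 * (real n)\<^sup>2)) + 4 * real n * exp (- 2 * (\<tau>\<^sup>2 * n))"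
proof -
  let ?P = "pairs n" and ?GG = "graphs_with_degrees n d"
  let ?M = "random_subset ?P (\<lambda>_. \<delta>)" and ?U = "pmf_of_set ?GG" and ?hom = "random_subset ?P (\<lambda>_. \<alpha>)"
  let ?good = "\<lambda>R G. switch_good n R \<alpha> (10 * \<eta>) (\<delta> ^ 3 * \<alpha> * (1 - \<alpha>) * (real n)\<^sup>2) G"
  let ?l = "(\<eta> * \<alpha> * (\<delta> * (1 - \<alpha>) * n / 2))\<^sup>2"
  define D where "D = {G. \<not> discrepancy n \<alpha> (\<delta> * (1 - \<alpha>) * n / 2) (\<eta> * \<alpha>) (G \<inter> ?P)} \<union>
      {G. \<not> discrepancy n \<alpha> (\<delta> * \<alpha> * n / 2) (\<eta> * (1 - \<alpha>)) (G \<inter> ?P)}"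
  define E2 where "E2 = 4 * (4 :: real) ^ n * exp (- (\<tau>\<^sup>2 * (real n)\<^sup>2)) + 4 * real n * exp (- 2 * (\<tau>\<^sup>2 * n))"
  have E2: "0 \<le> E2" by (simp add: E2_def)
  have \<tau>0: "0 < \<tau>" using \<tau> \<eta> \<alpha> \<delta> by simp
  have "measure_pmf.prob ?hom D \<le>
      measure_pmf.prob ?hom {G. \<not> discrepancy n \<alpha> (\<delta> * (1 - \<alpha>) * n / 2) (\<eta> * \<alpha>) (G \<inter> ?P)} +
      measure_pmf.prob ?hom {G. \<not> discrepancy n \<alpha> (\<delta> * \<alpha> * n / 2) (\<eta> * (1 - \<alpha>)) (G \<inter> ?P)}"
    unfolding D_def by (rule measure_Un_le) auto
  also have "\<dots> \<le> 4 ^ n * (2 * exp (- ?l)) + 4 ^ n * (2 * exp (- ?l))"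
  proof (rule add_mono)
    show "measure_pmf.prob ?hom {G. \<not> discrepancy n \<alpha> (\<delta> * (1 - \<alpha>) * n / 2) (\<eta> * \<alpha>) (G \<inter> ?P)}
        \<le> 4 ^ n * (2 * exp (- ?l))"
      by (rule prob_not_discrepancy) (use \<eta> \<alpha> \<delta> n in auto)
    have "measure_pmf.prob ?hom {G. \<not> discrepancy n \<alpha> (\<delta> * \<alpha> * n / 2) (\<eta> * (1 - \<alpha>)) (G \<inter> ?P)}
        \<le> 4 ^ n * (2 * exp (- (\<eta> * (1 - \<alpha>) * (\<delta> * \<alpha> * n / 2))\<^sup>2))"
      by (rule prob_not_discrepancy) (use \<eta> \<alpha> \<delta> n in auto)
    \<comment> \<open>The size threshold and the error tolerance exchange \<alpha> and 1 - \<alpha>,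
      so both discrepancy conditions share one exponent.\<close>
    also have "\<eta> * (1 - \<alpha>) * (\<delta> * \<alpha> * n / 2) = \<eta> * \<alpha> * (\<delta> * (1 - \<alpha>) * n / 2)" by simp
    finally show "measure_pmf.prob ?hom {G. \<not> discrepancy n \<alpha> (\<delta> * \<alpha> * n / 2) (\<eta> * (1 - \<alpha>)) (G \<inter> ?P)}
        \<le> 4 ^ n * (2 * exp (- ?l))" .
  qed
  finally have homD: "measure_pmf.prob ?hom D \<le> 4 * (4 :: real) ^ n * exp (- ?l)" by simp
  have "measure_pmf.prob ?U D * lb \<le> measure_pmf.prob ?U D * measure_pmf.prob ?hom ?GG"
    using lb by (intro mult_left_mono) auto
  also have "\<dots> \<le> measure_pmf.prob ?hom (D \<inter> ?GG)" by (rule prob_degree_graph_transfer[OF ne \<alpha>])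
  also have "\<dots> \<le> 4 * (4 :: real) ^ n * exp (- ?l)" by (rule prob_subset_le[OF _ homD]) auto
  finally have UD: "measure_pmf.prob ?U D \<le> 4 * (4 :: real) ^ n * exp (- ?l) / lb"
    using lb by (simp add: pos_le_divide_eq)
  have inner: "measure_pmf.prob ?M {R. \<not> ?good R G} \<le> indicator D G + E2" if G: "G \<in> ?GG" for G
  proof (cases "G \<in> D")
    case True
    have "measure_pmf.prob ?M {R. \<not> ?good R G} \<le> 1" by simp
    moreover have "indicator D G = (1 :: real)" using True by simp
    ultimately show ?thesis using E2 by linarith
  next
    case False
    have GP: "G \<subseteq> ?P" by (rule graphs_with_degreesD(1)[OF G])
    then have GG: "G \<inter> ?P = G" by auto
    have disc: "discrepancy n \<alpha> (\<delta> * (1 - \<alpha>) * n / 2) (\<eta> * \<alpha>) G"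
      "discrepancy n \<alpha> (\<delta> * \<alpha> * n / 2) (\<eta> * (1 - \<alpha>)) G"
      using False unfolding D_def by (simp_all only: Un_iff mem_Collect_eq GG not_not de_Morgan_disj)
    let ?I = "\<lambda>H. {R. \<not> inherits n \<delta> \<tau> H R}"
    have "measure_pmf.prob ?M {R. \<not> ?good R G} \<le> measure_pmf.prob ?M (?I G \<union> ?I (?P - G))"
    proof (intro measure_pmf.finite_measure_mono_AE AE_pmfI impI)
      fix R assume R: "R \<in> set_pmf ?M" "R \<in> {R. \<not> ?good R G}"
      have RP: "R \<subseteq> ?P" by (rule set_random_subset[OF _ R(1)]) simp
      show "R \<in> ?I G \<union> ?I (?P - G)"
      proof (rule ccontr)
        assume "R \<notin> ?I G \<union> ?I (?P - G)"
        then have "inherits n \<delta> \<tau> G R" "inherits n \<delta> \<tau> (?P - G) R" by auto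
        then have "?good R G"
          using deg graphs_with_degreesD(2)[OF G]
          by (intro switch_goodI[OF RP GP \<eta> \<alpha> \<delta> big \<tau> disc]) auto
        then show False using R by simp
      qed
    qed simp
    also have "\<dots> \<le> measure_pmf.prob ?M (?I G) + measure_pmf.prob ?M (?I (?P - G))"
      by (rule measure_Un_le) auto
    also have "\<dots> \<le> (4 ^ n * (2 * exp (- (\<tau>\<^sup>2 * (real n)\<^sup>2))) + n * (2 * exp (- 2 * (\<tau>\<^sup>2 * n)))) +
        (4 ^ n * (2 * exp (- (\<tau>\<^sup>2 * (real n)\<^sup>2))) + n * (2 * exp (- 2 * (\<tau>\<^sup>2 * n))))"
      by (intro add_mono prob_inherits) (use GP \<delta> \<tau>0 n in auto)
    also have "\<dots> = E2" by (simp add: E2_def)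
    finally show ?thesis using False by simp
  qed
  have "measure_pmf.prob (pair_pmf ?M ?U) {(R, G). \<not> ?good R G} =
      measure_pmf.prob (pair_pmf ?U ?M) {(G, R). \<not> ?good R G}"
    by (subst pair_commute_pmf) (simp add: vimage_def case_prod_unfold)
  also have "\<dots> = measure_pmf.expectation ?U (\<lambda>G. measure_pmf.prob ?M {R. \<not> ?good R G})"
    by (simp add: prob_pair_pmf)
  also have "\<dots> \<le> measure_pmf.expectation ?U (\<lambda>G. indicator D G + E2)"
  proof (rule integral_mono_AE)
    show "integrable ?U (\<lambda>G. measure_pmf.prob ?M {R. \<not> ?good R G})"
      by (rule measure_pmf.integrable_const_bound[where B = 1]) auto
    show "AE G in ?U. measure_pmf.prob ?M {R. \<not> ?good R G} \<le> indicator D G + E2"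
      using inner ne by (intro AE_pmfI) (simp add: set_pmf_of_set)
  qed (auto intro!: integrable_measure_pmf_finite simp: set_pmf_of_set ne)
  also have "\<dots> = measure_pmf.prob ?U D + E2"
    by (subst Bochner_Integration.integral_add)
       (auto intro!: integrable_measure_pmf_finite simp: set_pmf_of_set ne)
  finally show ?thesis using UD by (simp add: E2_def)
qed

text \<open>With \<open>\<kappa> = 10 * \<eta>\<close> the edge probabilities stay within
  \<open>\<alpha> * (1 - 30 * \<eta>)\<close> and \<open>\<alpha> * (1 + 40 * \<eta>)\<close>; the
  minimum with 1 keeps the latter a probability. The divisor of the error is the tolerated
  proportion of bad graphs, \<open>\<alpha> * \<kappa> * f / (2 * n ^ 2)\<close>.\<close>

lemma sandwich_finite:
  fixes \<alpha> \<eta> \<delta> lb :: real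
  assumes ne: "graphs_with_degrees n d \<noteq> {}" and n: "0 < n"
    and \<eta>: "0 < \<eta>" "\<eta> \<le> 1 / 100" and \<alpha>: "0 < \<alpha>" "\<alpha> < 1" and \<delta>: "0 < \<delta>" "\<delta> \<le> 1"
    and big: "2 \<le> \<eta> * (\<delta> * \<alpha> * n)" "2 \<le> \<eta> * (\<delta> * (1 - \<alpha>) * n)"
    and \<tau>: "\<tau> = \<eta> * \<delta> ^ 3 * \<alpha>\<^sup>2 * (1 - \<alpha>)\<^sup>2"
    and deg: "\<And>v. v \<in> {1..n} \<Longrightarrow> \<bar>real (d v) - \<alpha> * n\<bar> \<le> \<eta> * \<alpha> * n"
      "\<And>v. v \<in> {1..n} \<Longrightarrow> \<bar>real (d v) - \<alpha> * n\<bar> \<le> \<eta> * (1 - \<alpha>) * n"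
    and lb: "0 < lb" "lb \<le> measure_pmf.prob (random_subset (pairs n) (\<lambda>_. \<alpha>)) (graphs_with_degrees n d)"
  shows "\<exists>J. is_coupling3 J (binomial_random_graph n ((1 - \<delta>) * (\<alpha> * (1 - 30 * \<eta>))))
      (degree_random_graph n d) (binomial_random_graph n (\<delta> + (1 - \<delta>) * min 1 (\<alpha> * (1 + 40 * \<eta>)))) \<and>
    1 - (4 * (4 :: real) ^ n * exp (- (\<eta> * \<alpha> * (\<delta> * (1 - \<alpha>) * n / 2))\<^sup>2) / lb
      + 4 * (4 :: real) ^ n * exp (- (\<tau>\<^sup>2 * (real n)\<^sup>2)) + 4 * real n * exp (- 2 * (\<tau>\<^sup>2 * n))) /
      (5 * \<eta> * \<delta> ^ 3 * \<alpha>\<^sup>2 * (1 - \<alpha>))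
    \<le> measure_pmf.prob J {(L, G, U). L \<subseteq> G \<and> G \<subseteq> U}"
proof -
  let ?P = "pairs n" and ?GG = "graphs_with_degrees n d"
  define f where "f = \<delta> ^ 3 * \<alpha> * (1 - \<alpha>) * (real n)\<^sup>2"
  define q where "q = 5 * \<eta> * \<delta> ^ 3 * \<alpha>\<^sup>2 * (1 - \<alpha>)"
  have q0: "0 < q" using \<eta> \<alpha> \<delta> by (simp add: q_def)
  have q_eq: "\<alpha> * (10 * \<eta>) * f / (2 * (real n)\<^sup>2) = q"
    using n by (simp add: q_def f_def power2_eq_square)
  have f0: "0 < f" using \<alpha> \<delta> n by (simp add: f_def)
  have "\<delta> ^ 3 * \<alpha> * (1 - \<alpha>) \<le> 1" using \<alpha> \<delta> by (intro mult_le_one power_le_one) auto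
  then have "f \<le> 1 * (real n)\<^sup>2" unfolding f_def by (rule mult_right_mono) simp
  then have fn: "f \<le> (real n)\<^sup>2" by simp
  have GP: "?GG \<subseteq> Pow ?P" using graphs_with_degreesD(1) by blast
  have "0 \<le> \<alpha> * (1 - 30 * \<eta>)" "\<alpha> * (1 - 30 * \<eta>) \<le> min 1 (\<alpha> * (1 + 40 * \<eta>))"
  proof -
    show "0 \<le> \<alpha> * (1 - 30 * \<eta>)" using \<alpha> \<eta> by simp
    have "\<alpha> * (1 - 30 * \<eta>) \<le> \<alpha> * (1 + 40 * \<eta>)" "\<alpha> * (1 - 30 * \<eta>) \<le> \<alpha> * 1"
      using \<alpha> \<eta> by (intro mult_left_mono; simp)+
    then show "\<alpha> * (1 - 30 * \<eta>) \<le> min 1 (\<alpha> * (1 + 40 * \<eta>))" using \<alpha> by linarith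
  qed
  note ab = this
  have "\<exists>J. is_coupling3 J (random_subset ?P (\<lambda>_. (1 - \<delta>) * (\<alpha> * (1 - 30 * \<eta>)))) (pmf_of_set ?GG)
       (random_subset ?P (\<lambda>_. \<delta> + (1 - \<delta>) * min 1 (\<alpha> * (1 + 40 * \<eta>)))) \<and>
     1 - measure_pmf.prob (pair_pmf (random_subset ?P (\<lambda>_. \<delta>)) (pmf_of_set ?GG))
         {(R, G). G \<in> {G. \<not> switch_good n R \<alpha> (10 * \<eta>) f G}} / q
       \<le> measure_pmf.prob J {(L, G, U). L \<subseteq> G \<and> G \<subseteq> U}"
  proof (rule sandwich_coupling[OF _ GP ne ab _ _ _ q0])
    fix R A h e C'
    assume *: "R \<subseteq> ?P" "e \<in> ?P - R" "A \<subseteq> ?P - R - {e}" "C' = {G \<in> ?GG. G \<inter> A = h}"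
      "real (card (C' \<inter> {G. \<not> switch_good n R \<alpha> (10 * \<eta>) f G})) \<le> q * real (card C')"
    have \<kappa>: "0 < 10 * \<eta>" "10 * \<eta> \<le> 1 / 4" using \<eta> by auto
    note cond = conditional_edge_probability[OF *(1-4) \<alpha> f0 fn \<kappa>, unfolded q_eq, OF *(5)]
    have "finite C'" unfolding *(4) by auto
    then have "real (card {G \<in> C'. e \<in> G}) \<le> 1 * real (card C')" by (simp add: card_mono)
    then show "\<alpha> * (1 - 30 * \<eta>) * real (card C') \<le> real (card {G \<in> C'. e \<in> G}) \<and>
        real (card {G \<in> C'. e \<in> G}) \<le> min 1 (\<alpha> * (1 + 40 * \<eta>)) * real (card C')"
      using cond by (simp add: min_def)
  qed (use \<delta> in auto)
  then obtain J where J: "is_coupling3 J (random_subset ?P (\<lambda>_. (1 - \<delta>) * (\<alpha> * (1 - 30 * \<eta>)))) (pmf_of_set ?GG)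
       (random_subset ?P (\<lambda>_. \<delta> + (1 - \<delta>) * min 1 (\<alpha> * (1 + 40 * \<eta>))))"
    and pr: "1 - measure_pmf.prob (pair_pmf (random_subset ?P (\<lambda>_. \<delta>)) (pmf_of_set ?GG))
         {(R, G). \<not> switch_good n R \<alpha> (10 * \<eta>) f G} / q
       \<le> measure_pmf.prob J {(L, G, U). L \<subseteq> G \<and> G \<subseteq> U}"
    by auto
  have "measure_pmf.prob (pair_pmf (random_subset ?P (\<lambda>_. \<delta>)) (pmf_of_set ?GG))
         {(R, G). \<not> switch_good n R \<alpha> (10 * \<eta>) f G} / q \<le>
     (4 * (4 :: real) ^ n * exp (- (\<eta> * \<alpha> * (\<delta> * (1 - \<alpha>) * n / 2))\<^sup>2) / lb
      + 4 * (4 :: real) ^ n * exp (- (\<tau>\<^sup>2 * (real n)\<^sup>2)) + 4 * real n * exp (- 2 * (\<tau>\<^sup>2 * n))) / q"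
    unfolding f_def
  proof (rule divide_right_mono)
    show "measure_pmf.prob (pair_pmf (random_subset ?P (\<lambda>_. \<delta>)) (pmf_of_set ?GG))
        {(R, G). \<not> switch_good n R \<alpha> (10 * \<eta>) (\<delta> ^ 3 * \<alpha> * (1 - \<alpha>) * (real n)\<^sup>2) G} \<le>
      4 * (4 :: real) ^ n * exp (- (\<eta> * \<alpha> * (\<delta> * (1 - \<alpha>) * n / 2))\<^sup>2) / lb
      + 4 * (4 :: real) ^ n * exp (- (\<tau>\<^sup>2 * (real n)\<^sup>2)) + 4 * real n * exp (- 2 * (\<tau>\<^sup>2 * n))"
      by (rule prob_bad_exposure[OF ne n \<eta> \<alpha> \<delta> big \<tau> _ _ lb]) (rule deg; assumption)+
  qed (use q0 in simp)
  then show ?thesis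
    using J pr unfolding binomial_random_graph_eq degree_random_graph_def q_def
    by (intro exI[of _ J]) auto
qed


section \<open>Asymptotics\<close>

text \<open>The parameter \<open>w\<close> stands for \<open>(ln n) powr (-1/16)\<close>, which keeps all bounds polynomial in \<open>w\<close> and \<open>n\<close>.\<close>

definition sandwich_error :: "real \<Rightarrow> real \<Rightarrow> real" where
  "sandwich_error n w = (8 * exp (n * ln 4 - w ^ 36 * n\<^sup>2 / 128 + (9 * n\<^sup>2 * w ^ 48 + 3 / w ^ 16))
     + 4 * exp (n * ln 4 - w ^ 88 * n\<^sup>2 / 1024) + 4 * n * exp (- (w ^ 88 * n / 512))) * (10 / w ^ 44)"

text \<open>The parameters become \<eta> = w and \<delta> = w \<alpha>, so that both densities
  differ from \<open>p\<close> by a factor 1 + O(w). Since \<open>ln n = 1 / w ^ 16\<close>, the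
  bounds \<open>4 * w ^ 8\<close> and \<open>C * max_deg * w ^ 16\<close> are those with 1 / sqrt
  (ln n) and 1 / ln n.\<close>

lemma sandwich_quantitative:
  fixes C w :: real and n :: nat and d :: "nat \<Rightarrow> nat"
  defines "p \<equiv> real (max_deg n d) / n"
  assumes ne: "graphs_with_degrees n d \<noteq> {}" and C: "1 \<le> C" and w: "0 < w" "1000 * C\<^sup>2 * w \<le> 1"
    and n: "1 \<le> n * w ^ 100" "ln n = 1 / w ^ 16"
    and dense: "4 * w ^ 8 \<le> p" "4 * w ^ 8 \<le> 1 - p"
    and range: "real (deg_range n d) \<le> C * real (max_deg n d) * w ^ 16"
    and tail1: "n * (2 * exp (- (2 * (n * w ^ 128)))) \<le> 1 / 4"
    and tail2: "2 * exp (n * ln 4 - w ^ 32 * (real n)\<^sup>2 / 64) \<le> 1 / 4"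
  shows "\<exists>p1 p2 J. p1 \<in> {0..1} \<and> p2 \<in> {0..1} \<and> \<bar>p1 - p\<bar> \<le> 43 * w * p \<and> \<bar>p2 - p\<bar> \<le> 43 * w * p \<and>
    is_coupling3 J (binomial_random_graph n p1) (degree_random_graph n d) (binomial_random_graph n p2) \<and>
    1 - sandwich_error n w \<le> measure_pmf.prob J {(GL, G, GU). GL \<subseteq> G \<and> G \<subseteq> GU}"
proof -
  have C2: "C \<le> C\<^sup>2" using C by (simp add: power2_eq_square)
  have Cw: "1000 * (C * w) \<le> 1"
  proof -
    have "C * w \<le> C\<^sup>2 * w" using C2 w by (intro mult_right_mono) auto
    then show ?thesis using w(2) by linarith
  qed
  have w1: "1000 * w \<le> 1"
  proof -
    have "1 * w \<le> C * w" using C w by (intro mult_right_mono) auto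
    then show ?thesis using Cw by linarith
  qed
  \<comment> \<open>Every additional power of \<open>w\<close> gains a factor 1000, which absorbs
    the numerical constants below.\<close>
  have pw: "w ^ j \<le> w ^ i / 1000" "0 < w ^ j" if "i < j" for i j
  proof -
    have "w ^ j \<le> w ^ (i + 1)" using that w w1 by (intro power_decreasing) auto
    also have "\<dots> = w ^ i * w" by simp
    also have "\<dots> \<le> w ^ i * (1 / 1000)" using w w1 by (intro mult_left_mono) auto
    finally show "w ^ j \<le> w ^ i / 1000" by simp
    show "0 < w ^ j" using w by simp
  qed
  have nw: "1000 \<le> n * w ^ k" if "k < 100" for k
  proof -
    have "1 \<le> n * w ^ 100" by (rule n)
    also have "\<dots> \<le> n * (w ^ k / 1000)" using pw(1)[OF that] by (intro mult_left_mono) auto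
    finally show ?thesis by simp
  qed
  have n1000: "1000 \<le> real n" using nw[of 0] by simp
  then have n0: "0 < real n" "4 \<le> n" "0 < n" by auto
  have exp4: "(4 :: real) ^ n = exp (n * ln 4)" by (simp add: exp_of_nat_mult)
  let ?\<Delta> = "real (max_deg n d)"
  let ?V = "{1..n}"
  have V: "finite (d ` ?V)" "d ` ?V \<noteq> {}" using n0 by auto
  have \<Delta>: "?\<Delta> = p * n" using n0 by (simp add: p_def)
  have dv: "d v \<le> max_deg n d" "max_deg n d \<le> d v + deg_range n d" if "v \<in> ?V" for v
  proof -
    have "d v \<le> Max (d ` ?V)" "Min (d ` ?V) \<le> d v" using that V by auto
    then show "d v \<le> max_deg n d" "max_deg n d \<le> d v + deg_range n d"
      by (auto simp: max_deg_def deg_range_def)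
  qed
  define r where "r = real (deg_range n d)"
  \<comment> \<open>Large enough that the degree tail exponent
    \<open>s ^ 2 / n = n * w ^ 128\<close> dominates ln n, small enough that the repair cost, of
    order \<open>s * n * ln n = n ^ 2 * w ^ 48\<close>, stays below the discrepancy exponent of
    order \<open>n ^ 2 * w ^ 36\<close>.\<close>
  define s where "s = n * w ^ 64"
  have s0: "0 < s" using n0 w by (simp add: s_def)
  have r0: "0 \<le> r" by (simp add: r_def)
  have p0: "0 < p" using dense(1) pw(2)[of 0 8] by linarith
  have p1: "p \<le> 1" using dense(2) pw(2)[of 0 8] by linarith
  have pn0: "0 < p * n" using p0 n0 by simp
  have r_le: "r \<le> C * (p * n * w ^ 16)" using range by (simp add: r_def \<Delta> mult_ac)
  have r_le': "r \<le> p * n * w ^ 15 / 1000"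
  proof -
    have "C * (p * n * w ^ 16) = (p * n * w ^ 15) * (C * w)"
      by (simp add: power_Suc [symmetric, of w 15, simplified] mult_ac)
    also have "\<dots> \<le> (p * n * w ^ 15) * (1 / 1000)"
      using Cw pn0 w by (intro mult_left_mono) auto
    finally show ?thesis using r_le by simp
  qed
  have s_le: "s \<le> p * n * w ^ 16 / 1000"
  proof -
    have "w ^ 64 \<le> w ^ 24 / 1000" by (rule pw) simp
    also have "w ^ 24 = w ^ 8 * w ^ 16" by (simp add: power_add [symmetric])
    also have "w ^ 8 * w ^ 16 / 1000 \<le> p * w ^ 16 / 1000"
    proof (intro divide_right_mono mult_right_mono)
      show "w ^ 8 \<le> p" using dense(1) pw(2)[of 0 8] by linarith
    qed (use w in auto)
    finally have "n * w ^ 64 \<le> n * (p * w ^ 16 / 1000)" by (intro mult_left_mono) auto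
    then show ?thesis by (simp add: s_def mult_ac)
  qed
  have w1516: "p * n * w ^ 16 \<le> p * n * (w ^ 15 / 1000)"
    using pw(1)[of 15 16] pn0 by (intro mult_left_mono) auto
  define \<mu> where "\<mu> = (\<Sum>v\<in>?V. real (d v) - s) / n"
  define \<alpha> where "\<alpha> = \<mu> / (real n - 1)"
  have sum_up: "n * \<mu> \<le> n * (p * n)"
  proof -
    have "n * \<mu> = (\<Sum>v\<in>?V. real (d v) - s)" using n0 by (simp add: \<mu>_def)
    also have "\<dots> \<le> (\<Sum>v\<in>?V. p * n)"
    proof (rule sum_mono)
      fix v assume "v \<in> ?V"
      then have "real (d v) \<le> ?\<Delta>" using dv(1) by simp
      then show "real (d v) - s \<le> p * n" using s0 by (simp add: \<Delta>)
    qed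
    finally show ?thesis by simp
  qed
  have sum_lo: "n * (p * n - r - s) \<le> n * \<mu>"
  proof -
    have "(\<Sum>v\<in>?V. p * n - r - s) \<le> (\<Sum>v\<in>?V. real (d v) - s)"
    proof (rule sum_mono)
      fix v assume "v \<in> ?V"
      then have "?\<Delta> \<le> real (d v) + r" unfolding r_def using dv(2) by (metis of_nat_add of_nat_le_iff)
      then show "p * n - r - s \<le> real (d v) - s" by (simp add: \<Delta>)
    qed
    also have "\<dots> = n * \<mu>" using n0 by (simp add: \<mu>_def)
    finally show ?thesis by simp
  qed
  have \<mu>: "\<mu> \<le> p * n" "p * n - r - s \<le> \<mu>" using sum_up sum_lo n0 by simp_all
  have \<mu>lo: "p * n * (1 - w ^ 15) \<le> \<mu>"
  proof -
    have "p * n * (1 - w ^ 15) = p * n - p * n * w ^ 15" by (simp add: algebra_simps)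
    moreover have "0 \<le> p * n * w ^ 15" using pn0 w by simp
    ultimately show ?thesis using \<mu>(2) r_le' s_le w1516 by linarith
  qed
  have w15: "0 < w ^ 15" "w ^ 15 \<le> w / 1000" "w ^ 15 \<le> w ^ 8 / 1000"
    using pw[of 1 15] pw(1)[of 8 15] by auto
  have \<alpha>lo: "p * (1 - w ^ 15) \<le> \<alpha>"
  proof -
    have "0 \<le> 1 - w ^ 15" using w15 w1 by linarith
    then have "0 \<le> p * n * (1 - w ^ 15)" using pn0 by (intro mult_nonneg_nonneg[OF less_imp_le])
    then have "0 \<le> \<mu>" using \<mu>lo by linarith
    then have "\<mu> / n \<le> \<alpha>" unfolding \<alpha>_def using n0 by (intro divide_left_mono) auto
    moreover have "p * (1 - w ^ 15) = p * n * (1 - w ^ 15) / n" using n0 by simp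
    moreover have "p * n * (1 - w ^ 15) / n \<le> \<mu> / n" using \<mu>lo n0 by (intro divide_right_mono) auto
    ultimately show ?thesis by linarith
  qed
  have \<alpha>up: "\<alpha> \<le> p * (1 + w ^ 15)"
  proof -
    have "2 \<le> n * w ^ 15" using nw[of 15] by simp
    then have "1 + w ^ 15 \<le> n * w ^ 15" using w15 w1 by linarith
    then have "n \<le> (1 + w ^ 15) * (real n - 1)" by (simp add: algebra_simps)
    then have "p * n \<le> p * ((1 + w ^ 15) * (real n - 1))" using p0 by (intro mult_left_mono) auto
    then have "\<mu> \<le> p * (1 + w ^ 15) * (real n - 1)" using \<mu>(1) by (simp add: mult_ac)
    then show ?thesis unfolding \<alpha>_def using n0 by (simp add: pos_divide_le_eq)
  qed
  have pw15: "p * w ^ 15 \<le> 1 * (w ^ 8 / 1000)" "p * w ^ 15 \<le> p * (w / 1000)"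
  proof -
    show "p * w ^ 15 \<le> 1 * (w ^ 8 / 1000)" using p1 w15 by (intro mult_mono) simp_all
    show "p * w ^ 15 \<le> p * (w / 1000)" using p0 w15 by (intro mult_left_mono) simp_all
  qed
  have a_p: "\<bar>\<alpha> - p\<bar> \<le> p * w ^ 15" using \<alpha>lo \<alpha>up by (auto simp: abs_le_iff algebra_simps)
  have w8: "0 < w ^ 8" using w by simp
  have \<alpha>_half: "p \<le> 2 * \<alpha>"
  proof -
    have "p * (w / 1000) \<le> p * (1 / 2)" using p0 w1 w by (intro mult_left_mono) auto
    then show ?thesis using a_p pw15(2) by (simp add: abs_le_iff)
  qed
  have \<alpha>1: "2 * w ^ 8 \<le> \<alpha>" "3 * w ^ 8 \<le> 1 - \<alpha>"
    using \<alpha>_half dense a_p pw15(1) w8 by (auto simp: abs_le_iff)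
  have \<alpha>0: "0 < \<alpha>" "\<alpha> < 1" using \<alpha>1 w8 by linarith+
  define A where "A = \<alpha> * (1 - \<alpha>)"
  have A: "w ^ 8 / 2 \<le> A"
  proof (cases "\<alpha> \<le> 1 / 2")
    case True
    then have "\<alpha> * (1 / 2) \<le> A" unfolding A_def using \<alpha>0 by (intro mult_left_mono) auto
    then show ?thesis using \<alpha>1 w8 by linarith
  next
    case False
    then have "(1 / 2) * (1 - \<alpha>) \<le> A" unfolding A_def using \<alpha>0 by (intro mult_right_mono) auto
    then have "1 - \<alpha> \<le> 2 * A" by simp
    then show ?thesis using \<alpha>1 w8 by linarith
  qed
  have A0: "0 < A" "A \<le> \<alpha>" "A \<le> 1 - \<alpha>" "A \<le> 1" using \<alpha>0 by (auto simp: A_def mult_le_one)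
  have Apow: "(w ^ 8 / 2) ^ k \<le> A ^ k" for k using A w8 by (intro power_mono) auto
  have degree_close: "\<bar>real (d v) - \<alpha> * n\<bar> \<le> 2 * (p * w ^ 15) * n" if v: "v \<in> ?V" for v
  proof -
    have "real (d v) \<le> p * n" unfolding \<Delta> [symmetric] using dv(1)[OF v] by simp
    moreover have "p * n \<le> real (d v) + r" unfolding \<Delta> [symmetric] r_def
      using dv(2)[OF v] by (metis of_nat_add of_nat_le_iff)
    moreover have "\<bar>\<alpha> * n - p * n\<bar> \<le> p * w ^ 15 * n"
      using mult_right_mono[OF a_p, of "real n"] by (simp add: left_diff_distrib [symmetric] abs_mult)
    moreover have "p * n * w ^ 15 / 1000 \<le> p * w ^ 15 * n" 
    proof -
      have "0 \<le> p * w ^ 15 * n" using p0 w by simp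
      moreover have "p * n * w ^ 15 = p * w ^ 15 * n" by simp
      ultimately show ?thesis by linarith
    qed
    moreover have "2 * (p * w ^ 15) * n = 2 * (p * w ^ 15 * n)" by simp
    ultimately show ?thesis using r_le' unfolding abs_le_iff by linarith
  qed
  have deg1: "\<bar>real (d v) - \<alpha> * n\<bar> \<le> w * \<alpha> * n" if v: "v \<in> ?V" for v
  proof -
    have "2 * (p * (w / 1000)) \<le> w * \<alpha>"
      using mult_right_mono[OF \<alpha>_half, of w] w \<alpha>0 by (simp add: mult_ac)
    then have "2 * (p * w ^ 15) * n \<le> w * \<alpha> * n" using pw15(2) by (intro mult_right_mono) auto
    then show ?thesis using degree_close[OF v] by linarith
  qed
  have deg2: "\<bar>real (d v) - \<alpha> * n\<bar> \<le> w * (1 - \<alpha>) * n" if v: "v \<in> ?V" for v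
  proof -
    have "p * w ^ 15 \<le> 1 * (w ^ 9 / 1000)" using p0 p1 pw(1)[of 9 15] w by (intro mult_mono) auto
    moreover have "w * (3 * w ^ 8) \<le> w * (1 - \<alpha>)" using \<alpha>1 w by (intro mult_left_mono) auto
    moreover have "w * (3 * w ^ 8) = 3 * w ^ 9" by (simp add: power_Suc [symmetric, of w 8, simplified])
    moreover have "0 < w ^ 9" using w by simp
    ultimately have "2 * (p * w ^ 15) \<le> w * (1 - \<alpha>)" by linarith
    then have "2 * (p * w ^ 15) * n \<le> w * (1 - \<alpha>) * n" by (intro mult_right_mono) auto
    then show ?thesis using degree_close[OF v] by linarith
  qed
  \<comment> \<open>A graph whose degrees do not exceed \<open>d\<close> leaves every vertex at
    least this many non-neighbours.\<close>
  define \<sigma> where "\<sigma> = n - 1 - max_deg n d"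
  have \<sigma>: "n * w ^ 8 \<le> real \<sigma>"
  proof -
    have "4 * w ^ 8 * n \<le> (1 - p) * n" using dense(2) by (intro mult_right_mono) auto
    then have "4 * (n * w ^ 8) \<le> n - ?\<Delta>" by (simp add: \<Delta> algebra_simps)
    moreover have "1000 \<le> n * w ^ 8" by (rule nw) simp
    ultimately have "n * w ^ 8 \<le> real n - 1 - ?\<Delta>" "0 \<le> real n - 1 - ?\<Delta>" by linarith+
    then show ?thesis using n0 by (simp add: \<sigma>_def of_nat_diff)
  qed
  have \<sigma>2: "2 \<le> \<sigma>" using \<sigma> nw[of 8] by linarith
  define K where "K = nat \<lceil>3 * s * n\<rceil>"
  have K: "3 * s * n \<le> K" "K \<le> 3 * s * n + 1"
    using s0 n0 by (auto simp: K_def real_nat_ceiling_ge of_nat_ceiling)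
  let ?X = "2 * r * (r + s) / (\<alpha> * (1 - \<alpha>))"
  define lb where "lb = 1 / 2 * (\<alpha> * (1 - \<alpha>) / (real n)\<^sup>2) ^ K * exp (- ?X)"
  have lb0: "0 < lb" unfolding lb_def using \<alpha>0 n0 by simp
  have lower: "lb \<le> measure_pmf.prob (random_subset (pairs n) (\<lambda>_. \<alpha>)) (graphs_with_degrees n d)"
    unfolding lb_def \<alpha>_def \<mu>_def
  proof (rule prob_degrees_lower_bound[where \<sigma> = \<sigma>], fold \<mu>_def, fold \<alpha>_def)
    show "real (d u) \<le> real (d v) + r" if "u \<in> ?V" "v \<in> ?V" for u v
      using dv(1)[OF that(1)] dv(2)[OF that(2)] unfolding r_def by linarith
    have small: "p * n * w ^ 15 \<le> p * n * 1" "p * n * w ^ 15 \<le> n * w ^ 8 * 1"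
    proof -
      show "p * n * w ^ 15 \<le> p * n * 1" using pn0 w15 w1 by (intro mult_left_mono) auto
      have "p * w ^ 15 * n \<le> 1 * (w ^ 8 / 1000) * n" using pw15(1) by (intro mult_right_mono) auto
      moreover have "0 < w ^ 8 * n" using n0 w8 by simp
      ultimately show "p * n * w ^ 15 \<le> n * w ^ 8 * 1" by (simp add: mult_ac)
    qed
    have "p * n \<le> 2 * \<alpha> * n" using \<alpha>_half by (intro mult_right_mono) auto
    then show "8 * r \<le> \<alpha> * n" using r_le' small pn0 by linarith
    have "3 * w ^ 8 * n \<le> (1 - \<alpha>) * n" using \<alpha>1 by (intro mult_right_mono) auto
    moreover have "0 < w ^ 8 * n" using n0 w8 by simp
    ultimately show "4 * r \<le> (1 - \<alpha>) * n" using r_le' small(2) by (simp add: mult_ac)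
    show "\<sigma> \<le> n - 1 - d v" if "v \<in> ?V" for v using dv(1)[OF that] by (simp add: \<sigma>_def)
    have sq: "(n * w ^ 8) * (n * w ^ 8) \<le> real \<sigma> * real \<sigma>" using \<sigma> w8 by (intro mult_mono) auto
    have n2: "0 < real n * real n" using n0 by simp
    have "16 * s * n = (real n * real n) * (16 * w ^ 64)" by (simp add: s_def)
    also have "\<dots> < (real n * real n) * (2 * w ^ 24)"
    proof (rule mult_strict_left_mono[OF _ n2])
      have "w ^ 64 \<le> w ^ 24 / 1000" "0 < w ^ 24" using pw(1)[of 24 64] w by simp_all
      then show "16 * w ^ 64 < 2 * w ^ 24" by linarith
    qed
    also have "\<dots> = 2 * w ^ 8 * ((n * w ^ 8) * (n * w ^ 8))" by (simp add: power_add [symmetric] mult_ac)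
    also have "\<dots> \<le> \<alpha> * (real \<sigma> * real \<sigma>)" 
      by (rule mult_mono[OF \<alpha>1(1) sq]) (use \<alpha>0 in simp_all)
    finally show "16 * s * n < \<alpha> * (real \<sigma>)\<^sup>2" by (simp add: power2_eq_square)
    have "- 2 * s\<^sup>2 / n = - (2 * (n * w ^ 128))"
      using n0 by (simp add: s_def power2_eq_square power_add [symmetric])
    then show "n * (2 * exp (- 2 * s\<^sup>2 / n)) \<le> 1 / 4" using tail1 by simp
    have aa: "(2 * w ^ 8) * (2 * w ^ 8) \<le> \<alpha> * \<alpha>" using \<alpha>1 w8 \<alpha>0 by (intro mult_mono) auto
    have "w ^ 32 * (real n)\<^sup>2 / 64 \<le> ((2 * w ^ 8) * (2 * w ^ 8)) * ((n * w ^ 8) * (n * w ^ 8)) / 64"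
      using n2 w by (simp add: power2_eq_square power_add [symmetric] mult_ac)
    also have "\<dots> \<le> \<alpha>\<^sup>2 * (real \<sigma>)\<^sup>2 / 64"
      unfolding power2_eq_square by (intro divide_right_mono mult_mono[OF aa sq]) simp_all
    finally have "4 ^ n * (2 * exp (- (\<alpha>\<^sup>2 * (real \<sigma>)\<^sup>2 / 64))) \<le>
        4 ^ n * (2 * exp (- (w ^ 32 * (real n)\<^sup>2 / 64)))"
      by simp
    also have "\<dots> = 2 * exp (n * ln 4 - w ^ 32 * (real n)\<^sup>2 / 64)"
    proof -
      have "exp a * (2 * exp (- b)) = 2 * exp (a - b)" for a b :: real
        by (simp add: exp_diff exp_minus divide_inverse)
      then show ?thesis unfolding exp4 .
    qed
    finally show "4 ^ n * (2 * exp (- (\<alpha>\<^sup>2 * (real \<sigma>)\<^sup>2 / 64))) \<le> 1 / 4" using tail2 by linarith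
  qed (use n0 ne r0 s0 \<alpha>0 \<sigma>2 K in auto)
  \<comment> \<open>Proportional to \<alpha>, since \<delta> is added to the upper density and must
    remain a relative error of order \<open>w\<close>.\<close>
  define \<delta> where "\<delta> = w * \<alpha>"
  have \<delta>: "0 < \<delta>" "\<delta> \<le> 1" "\<delta> \<le> w"
    using w w1 \<alpha>0 by (auto simp: \<delta>_def mult_le_one intro: mult_left_le)
  define \<tau> where "\<tau> = w * \<delta> ^ 3 * \<alpha>\<^sup>2 * (1 - \<alpha>)\<^sup>2"
  have big1: "2 \<le> w * (\<delta> * \<alpha> * n)"
  proof -
    have "(2 * w ^ 8) * (2 * w ^ 8) \<le> \<alpha> * \<alpha>" using \<alpha>1 w8 \<alpha>0 by (intro mult_mono) auto
    then have "w * w * n * ((2 * w ^ 8) * (2 * w ^ 8)) \<le> w * w * n * (\<alpha> * \<alpha>)"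
      using w by (intro mult_left_mono) auto
    moreover have "w * w * n * ((2 * w ^ 8) * (2 * w ^ 8)) = 4 * (n * w ^ 18)"
      by (simp add: eval_nat_numeral)
    moreover have "1000 \<le> n * w ^ 18" by (rule nw) simp
    moreover have "w * (\<delta> * \<alpha> * n) = w * w * n * (\<alpha> * \<alpha>)" by (simp add: \<delta>_def)
    ultimately show ?thesis by linarith
  qed
  have big2: "2 \<le> w * (\<delta> * (1 - \<alpha>) * n)"
  proof -
    have "w * w * n * (w ^ 8 / 2) \<le> w * w * n * A" using A w by (intro mult_left_mono) auto
    moreover have "w * w * n * (w ^ 8 / 2) = n * w ^ 10 / 2" by (simp add: eval_nat_numeral)
    moreover have "1000 \<le> n * w ^ 10" by (rule nw) simp
    moreover have "w * (\<delta> * (1 - \<alpha>) * n) = w * w * n * A" by (simp add: \<delta>_def A_def)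
    ultimately show ?thesis by linarith
  qed
  define p1 where "p1 = (1 - \<delta>) * (\<alpha> * (1 - 30 * w))"
  define p2 where "p2 = \<delta> + (1 - \<delta>) * min 1 (\<alpha> * (1 + 40 * w))"
  define err where "err = (4 * (4 :: real) ^ n * exp (- (w * \<alpha> * (\<delta> * (1 - \<alpha>) * n / 2))\<^sup>2) / lb
      + 4 * (4 :: real) ^ n * exp (- (\<tau>\<^sup>2 * (real n)\<^sup>2)) + 4 * real n * exp (- 2 * (\<tau>\<^sup>2 * n))) /
      (5 * w * \<delta> ^ 3 * \<alpha>\<^sup>2 * (1 - \<alpha>))"
  have "\<exists>J. is_coupling3 J (binomial_random_graph n p1) (degree_random_graph n d) (binomial_random_graph n p2) \<and>
      1 - err \<le> measure_pmf.prob J {(L, G, U). L \<subseteq> G \<and> G \<subseteq> U}"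
    unfolding p1_def p2_def err_def
    by (rule sandwich_finite[OF ne n0(3) w(1) _ \<alpha>0 \<delta>(1,2) big1 big2 \<tau>_def deg1 deg2 lb0 lower])
       (use w1 in auto)
  then obtain J where J: "is_coupling3 J (binomial_random_graph n p1) (degree_random_graph n d) (binomial_random_graph n p2)"
    "1 - err \<le> measure_pmf.prob J {(L, G, U). L \<subseteq> G \<and> G \<subseteq> U}" by auto
  have err_le: "err \<le> sandwich_error n w"
  proof -
    define l where "l = (w * \<alpha> * (\<delta> * (1 - \<alpha>) * n / 2))\<^sup>2"
    have l_eq: "l = w ^ 4 * \<alpha>\<^sup>2 * A\<^sup>2 * (real n)\<^sup>2 / 4"
      by (simp add: l_def \<delta>_def A_def power2_eq_square eval_nat_numeral)
    have rs: "r \<le> 2 * C * (\<alpha> * n * w ^ 16)" "r + s \<le> 3 * C * (\<alpha> * n * w ^ 16)"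
    proof -
      have "p * (n * w ^ 16) \<le> 2 * \<alpha> * (n * w ^ 16)" using \<alpha>_half w by (intro mult_right_mono) auto
      then have pa: "p * n * w ^ 16 \<le> 2 * (\<alpha> * n * w ^ 16)" by (simp add: mult_ac)
      then have "C * (p * n * w ^ 16) \<le> C * (2 * (\<alpha> * n * w ^ 16))" using C by (intro mult_left_mono) auto
      then show r2: "r \<le> 2 * C * (\<alpha> * n * w ^ 16)" using r_le by simp
      have "1 * (\<alpha> * n * w ^ 16) \<le> C * (\<alpha> * n * w ^ 16)" using C \<alpha>0 w by (intro mult_right_mono) auto
      moreover have "0 \<le> \<alpha> * n * w ^ 16" using \<alpha>0 w by simp
      ultimately show "r + s \<le> 3 * C * (\<alpha> * n * w ^ 16)" using r2 s_le pa by linarith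
    qed
    \<comment> \<open>The decisive comparison: the tilt uses up at most half of the discrepancy
      exponent \<open>l\<close>. After multiplication by \<open>A\<close> the left side is at most
      \<open>12 * C ^ 2 * w ^ 32\<close> and the right side at least \<open>w ^ 28 / 64\<close>,
      each times \<alpha>^2 n^2; the spare \<open>w ^ 4\<close> absorbs
      \<open>768 * C ^ 2\<close>.\<close>
    have X_le: "?X \<le> l / 2"
    proof -
      have "r * (r + s) \<le> (2 * C * (\<alpha> * n * w ^ 16)) * (3 * C * (\<alpha> * n * w ^ 16))"
        using rs r0 s0 C \<alpha>0 w by (intro mult_mono) auto
      moreover have "12 * C\<^sup>2 * w ^ 32 * (\<alpha>\<^sup>2 * (real n)\<^sup>2) =
          2 * ((2 * C * (\<alpha> * n * w ^ 16)) * (3 * C * (\<alpha> * n * w ^ 16)))"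
        by (simp add: power2_eq_square power_add [symmetric] mult_ac)
      moreover have "2 * r * (r + s) = 2 * (r * (r + s))" by simp
      ultimately have "2 * r * (r + s) \<le> 12 * C\<^sup>2 * w ^ 32 * (\<alpha>\<^sup>2 * (real n)\<^sup>2)" by linarith
      also have "\<dots> \<le> (w ^ 4 * A ^ 3 / 8) * (\<alpha>\<^sup>2 * (real n)\<^sup>2)"
      proof (rule mult_right_mono)
        have "w * w * w \<le> 1" using w w1 by (intro mult_le_one) auto
        then have "(768 * C\<^sup>2 * w) * (w * w * w) \<le> 1 * 1" using w w1 by (intro mult_mono) auto
        then have "768 * C\<^sup>2 * w ^ 4 \<le> 1" by (simp add: eval_nat_numeral)
        then have "(768 * C\<^sup>2 * w ^ 4) * (w ^ 28 / 64) \<le> 1 * (w ^ 28 / 64)" by (intro mult_right_mono) auto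
        then have "12 * C\<^sup>2 * w ^ 32 \<le> w ^ 28 / 64" by (simp add: power_add [symmetric] mult_ac)
        also have "\<dots> = w ^ 4 * (w ^ 8 / 2) ^ 3 / 8"
          by (simp add: power_divide power_mult [symmetric] power_add [symmetric])
        also have "\<dots> \<le> w ^ 4 * A ^ 3 / 8" using Apow w by (intro divide_right_mono mult_left_mono) auto
        finally show "12 * C\<^sup>2 * w ^ 32 \<le> w ^ 4 * A ^ 3 / 8" .
      qed simp
      also have "\<dots> = (l / 2) * A" by (simp add: l_eq power2_eq_square power3_eq_cube)
      finally show ?thesis using A0 by (simp add: A_def [symmetric] pos_divide_le_eq)
    qed
    have l_ge: "w ^ 36 * (real n)\<^sup>2 / 128 \<le> l / 2"
    proof -
      have "w ^ 36 * (real n)\<^sup>2 / 128 = w ^ 4 * ((w ^ 8 / 2) ^ 2 * (w ^ 8 / 2) ^ 2) * (real n)\<^sup>2 / 8"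
        by (simp add: power_divide power_mult [symmetric] power_add [symmetric])
      also have "\<dots> \<le> w ^ 4 * (\<alpha>\<^sup>2 * A\<^sup>2) * (real n)\<^sup>2 / 8"
      proof (intro divide_right_mono mult_right_mono mult_left_mono mult_mono Apow)
        show "(w ^ 8 / 2)\<^sup>2 \<le> \<alpha>\<^sup>2" using A A0 w8 by (intro power_mono) auto
      qed (use w in auto)
      also have "\<dots> = l / 2" by (simp add: l_eq)
      finally show ?thesis .
    qed
    \<comment> \<open>As \<open>A \<ge> 1 / n\<close>, one edit costs at most a factor
      \<open>n ^ 3\<close>, which is \<open>exp (3 / w ^ 16)\<close>.\<close>
    have lb_ge: "exp (- ?X - 3 * K / w ^ 16) / 2 \<le> lb"
    proof -
      have "1 / real n \<le> A"
      proof -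
        have "2 \<le> n * w ^ 8" using nw[of 8] by simp
        then have "1 \<le> n * (w ^ 8 / 2)" by simp
        also have "\<dots> \<le> n * A" using A by (intro mult_left_mono) auto
        finally show ?thesis using n0 by (simp add: pos_divide_le_eq mult.commute)
      qed
      then have "1 / real n / (real n)\<^sup>2 \<le> A / (real n)\<^sup>2" by (intro divide_right_mono) auto
      moreover have "exp (- (3 / w ^ 16)) = 1 / real n / (real n)\<^sup>2"
      proof -
        have "exp (- (3 / w ^ 16)) = exp (- (real 3 * ln n))" by (simp add: n(2))
        also have "\<dots> = 1 / real n ^ 3" unfolding exp_minus exp_of_nat_mult using n0 by (simp add: inverse_eq_divide)
        finally show ?thesis by (simp add: power2_eq_square power3_eq_cube)
      qed
      ultimately have "exp (- (3 / w ^ 16)) ^ K \<le> (A / (real n)\<^sup>2) ^ K" by (intro power_mono) auto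
      moreover have "exp (- (3 / w ^ 16)) ^ K = exp (- (3 * K / w ^ 16))"
        by (simp add: exp_of_nat_mult [symmetric] mult_ac)
      ultimately have "exp (- (3 * K / w ^ 16)) * exp (- ?X) / 2 \<le> (A / (real n)\<^sup>2) ^ K * exp (- ?X) / 2"
        by (intro divide_right_mono mult_right_mono) auto
      then show ?thesis by (simp add: lb_def A_def exp_diff exp_minus field_simps)
    qed
    have K_le: "3 * K / w ^ 16 \<le> 9 * (real n)\<^sup>2 * w ^ 48 + 3 / w ^ 16"
    proof -
      have "3 * K / w ^ 16 \<le> 3 * (3 * s * n + 1) / w ^ 16" using K w by (intro divide_right_mono) auto
      also have "\<dots> = 9 * (real n)\<^sup>2 * (w ^ 64 / w ^ 16) + 3 / w ^ 16"
        by (simp add: s_def power2_eq_square add_divide_distrib)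
      also have "w ^ 64 / w ^ 16 = w ^ 48" using w power_diff[of w 16 64] by simp
      finally show ?thesis .
    qed
    have e1: "4 * (4 :: real) ^ n * exp (- l) / lb \<le>
        8 * exp (n * ln 4 - w ^ 36 * (real n)\<^sup>2 / 128 + (9 * (real n)\<^sup>2 * w ^ 48 + 3 / w ^ 16))"
    proof -
      have "4 * (4 :: real) ^ n * exp (- l) / lb \<le> 4 * (4 :: real) ^ n * exp (- l) / (exp (- ?X - 3 * K / w ^ 16) / 2)"
        using lb_ge lb0 by (intro divide_left_mono) auto
      also have "\<dots> = 8 * exp (n * ln 4 - l + ?X + 3 * K / w ^ 16)"
        by (simp add: exp4 exp_diff exp_add exp_minus field_simps)
      also have "\<dots> \<le> 8 * exp (n * ln 4 - w ^ 36 * (real n)\<^sup>2 / 128 + (9 * (real n)\<^sup>2 * w ^ 48 + 3 / w ^ 16))"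
      proof -
        have "n * ln 4 - l + ?X + 3 * K / w ^ 16 \<le>
            n * ln 4 - w ^ 36 * (real n)\<^sup>2 / 128 + (9 * (real n)\<^sup>2 * w ^ 48 + 3 / w ^ 16)"
          using X_le l_ge K_le by linarith
        then show ?thesis by simp
      qed
      finally show ?thesis .
    qed
    \<comment> \<open>Here \<tau> equals \<open>w ^ 4 * \<alpha> ^ 5 * (1 - \<alpha>) ^ 2\<close>;
      completing the power of 1 - \<alpha> to 5 only decreases it and leaves a power of
      \<open>A\<close>.\<close>
    have \<tau>_ge: "w ^ 44 / 32 \<le> \<tau>"
    proof -
      have "w ^ 44 / 32 = w ^ 4 * (w ^ 8 / 2) ^ 5"
        by (simp add: power_divide power_mult [symmetric] power_add [symmetric])
      also have "\<dots> \<le> w ^ 4 * A ^ 5" using Apow w by (intro mult_left_mono) auto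
      also have "A ^ 5 = \<alpha> ^ 5 * (1 - \<alpha>) ^ 5" by (simp add: A_def power_mult_distrib)
      also have "w ^ 4 * (\<alpha> ^ 5 * (1 - \<alpha>) ^ 5) \<le> w ^ 4 * (\<alpha> ^ 5 * (1 - \<alpha>) ^ 2)"
        using \<alpha>0 w by (intro mult_left_mono power_decreasing) auto
      also have "\<dots> = \<tau>" by (simp add: \<tau>_def \<delta>_def eval_nat_numeral)
      finally show ?thesis .
    qed
    have \<tau>2: "w ^ 88 / 1024 \<le> \<tau>\<^sup>2"
    proof -
      have "w ^ 88 / 1024 = (w ^ 44 / 32)\<^sup>2" by (simp add: power_divide power_mult [symmetric])
      also have "\<dots> \<le> \<tau>\<^sup>2" using \<tau>_ge w by (intro power_mono) auto
      finally show ?thesis .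
    qed
    have e2: "4 * (4 :: real) ^ n * exp (- (\<tau>\<^sup>2 * (real n)\<^sup>2)) \<le> 4 * exp (n * ln 4 - w ^ 88 * (real n)\<^sup>2 / 1024)"
    proof -
      have "w ^ 88 / 1024 * (real n)\<^sup>2 \<le> \<tau>\<^sup>2 * (real n)\<^sup>2" using \<tau>2 by (intro mult_right_mono) auto
      then have "exp (n * ln 4 - \<tau>\<^sup>2 * (real n)\<^sup>2) \<le> exp (n * ln 4 - w ^ 88 * (real n)\<^sup>2 / 1024)" by simp
      then show ?thesis by (simp add: exp4 exp_diff exp_minus field_simps)
    qed
    have e3: "4 * real n * exp (- 2 * (\<tau>\<^sup>2 * n)) \<le> 4 * real n * exp (- (w ^ 88 * n / 512))"
    proof -
      have "w ^ 88 / 1024 * n \<le> \<tau>\<^sup>2 * n" using \<tau>2 by (intro mult_right_mono) auto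
      then show ?thesis by (intro mult_left_mono) auto
    qed
    \<comment> \<open>The divisor is 5\<tau> with one factor 1 - \<alpha> removed, hence at least
      5\<tau>.\<close>
    have q_ge: "w ^ 44 / 10 \<le> 5 * w * \<delta> ^ 3 * \<alpha>\<^sup>2 * (1 - \<alpha>)"
    proof -
      have "0 \<le> w ^ 44" using w by simp
      then have "w ^ 44 / 10 \<le> 5 * (w ^ 44 / 32)" by simp
      also have "\<dots> \<le> 5 * \<tau>" using \<tau>_ge by simp
      also have "\<tau> = (w * \<delta> ^ 3 * \<alpha>\<^sup>2 * (1 - \<alpha>)) * (1 - \<alpha>)"
        by (simp add: \<tau>_def power2_eq_square)
      also have "5 * \<dots> \<le> 5 * ((w * \<delta> ^ 3 * \<alpha>\<^sup>2 * (1 - \<alpha>)) * 1)"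
        using w \<delta> \<alpha>0 by (intro mult_left_mono) auto
      finally show ?thesis by simp
    qed
    have "err \<le> (8 * exp (n * ln 4 - w ^ 36 * (real n)\<^sup>2 / 128 + (9 * (real n)\<^sup>2 * w ^ 48 + 3 / w ^ 16))
       + 4 * exp (n * ln 4 - w ^ 88 * (real n)\<^sup>2 / 1024) + 4 * n * exp (- (w ^ 88 * n / 512))) / (w ^ 44 / 10)"
      unfolding err_def l_def [symmetric] using e1 e2 e3 q_ge w
      by (intro frac_le add_mono) (auto intro!: add_nonneg_nonneg)
    then show ?thesis by (simp add: sandwich_error_def)
  qed
  have \<alpha>p: "p * (1 - w) \<le> \<alpha>" "\<alpha> \<le> p * (1 + w)"
  proof -
    have "p * (w / 1000) \<le> p * w" using p0 w by (intro mult_left_mono) auto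
    then show "p * (1 - w) \<le> \<alpha>" "\<alpha> \<le> p * (1 + w)"
      using a_p pw15(2) by (auto simp: abs_le_iff algebra_simps)
  qed
  have pww: "0 \<le> p * w" "p * (w * w) \<le> p * w" "0 \<le> p * (w * w)" using p0 w w1 by auto
  have p1b: "0 \<le> p1" "p1 \<le> \<alpha>" "p * (1 - 32 * w) \<le> p1"
  proof -
    show "0 \<le> p1" using \<delta> \<alpha>0 w1 by (simp add: p1_def)
    have "(1 - \<delta>) * (1 - 30 * w) \<le> 1" using \<delta> w w1 by (intro mult_le_one) auto
    then show "p1 \<le> \<alpha>" using \<alpha>0 mult_left_mono[of "(1 - \<delta>) * (1 - 30 * w)" 1 \<alpha>] by (simp add: p1_def mult_ac)
    have "p * (1 - 32 * w) \<le> p * ((1 - w) * (1 - w) * (1 - 30 * w))"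
    proof (rule mult_left_mono)
      have "(1 - w) * (1 - w) * (1 - 30 * w) = 1 - 32 * w + w * w * (61 - 30 * w)" by (simp add: algebra_simps)
      moreover have "0 \<le> w * w * (61 - 30 * w)" using w w1 by simp
      ultimately show "1 - 32 * w \<le> (1 - w) * (1 - w) * (1 - 30 * w)" by linarith
    qed (use p0 in simp)
    also have "\<dots> = (1 - w) * (p * (1 - w) * (1 - 30 * w))" by simp
    also have "\<dots> \<le> p1" unfolding p1_def
      using \<alpha>p(1) \<alpha>0 \<delta> w w1 p0 by (intro mult_mono mult_nonneg_nonneg) auto
    finally show "p * (1 - 32 * w) \<le> p1" .
  qed
  have p2b: "0 \<le> p2" "p2 \<le> 1" "p2 \<le> p * (1 + 43 * w)" "p * (1 - 2 * w) \<le> p2"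
  proof -
    let ?m = "min 1 (\<alpha> * (1 + 40 * w))"
    have "\<alpha> * 1 \<le> \<alpha> * (1 + 40 * w)" using \<alpha>0 w by (intro mult_left_mono) auto
    then have m: "\<alpha> \<le> ?m" "?m \<le> 1" "?m \<le> \<alpha> * (1 + 40 * w)" using \<alpha>0 by auto
    have m0: "0 \<le> ?m" using m(1) \<alpha>0 by linarith
    show "0 \<le> p2" unfolding p2_def using \<delta> m0 by (intro add_nonneg_nonneg mult_nonneg_nonneg) auto
    have "(1 - \<delta>) * ?m \<le> (1 - \<delta>) * 1" using \<delta> m by (intro mult_left_mono) auto
    then show "p2 \<le> 1" by (simp add: p2_def)
    have "(1 - \<delta>) * ?m \<le> 1 * (\<alpha> * (1 + 40 * w))" using \<delta> m m0 by (intro mult_mono) auto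
    \<comment> \<open>The summand 41 is 40 from the conditional probabilities plus 1 from \<delta>.
      Passing from \<alpha> to \<open>p * (1 + w)\<close> adds 1, and the quadratic term at most 1
      more.\<close>
    then have "p2 \<le> \<alpha> * (1 + 41 * w)" by (simp add: p2_def \<delta>_def algebra_simps)
    also have "\<dots> \<le> p * (1 + w) * (1 + 41 * w)" using \<alpha>p(2) w by (intro mult_right_mono) auto
    also have "\<dots> \<le> p * (1 + 43 * w)"
    proof -
      have "p * (w * (1000 * w)) \<le> p * (w * 1)" using w1 w p0 by (intro mult_left_mono) auto
      then show ?thesis using pww by (simp add: algebra_simps)
    qed
    finally show "p2 \<le> p * (1 + 43 * w)" .
    have "p * (1 - 2 * w) \<le> (1 - w) * (p * (1 - w))" using pww by (simp add: algebra_simps)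
    also have "\<dots> \<le> (1 - \<delta>) * ?m"
      using \<delta> w1 p0 m \<alpha>p(1) by (intro mult_mono) auto
    also have "\<dots> \<le> p2" using \<delta> by (simp add: p2_def)
    finally show "p * (1 - 2 * w) \<le> p2" .
  qed
  have "p1 \<in> {0..1}" "p2 \<in> {0..1}" using p1b p2b \<alpha>0 by auto
  moreover have "\<bar>p1 - p\<bar> \<le> 43 * w * p" "\<bar>p2 - p\<bar> \<le> 43 * w * p"
    using p1b p2b \<alpha>p pww by (auto simp: abs_le_iff algebra_simps)
  moreover have "1 - sandwich_error n w \<le> measure_pmf.prob J {(GL, G, GU). GL \<subseteq> G \<and> G \<subseteq> GU}"
    using J(2) err_le by linarith
  ultimately show ?thesis using J(1) by blast
qed


section \<open>Passage to the limit\<close>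

lemma max_deg_less:
  assumes "graphs_with_degrees n d \<noteq> {}" "1 \<le> n"
  shows "max_deg n d < n"
proof -
  obtain G where G: "G \<in> graphs_with_degrees n d" using assms(1) by auto
  have "d v < n" if v: "v \<in> {1..n}" for v
    using degree_compl[OF graphs_with_degreesD(1)[OF G] v] graphs_with_degreesD(2)[OF G v] assms(2) by linarith
  moreover have "max_deg n d \<in> d ` {1..n}" unfolding max_deg_def using assms(2) by (intro Max_in) auto
  ultimately show ?thesis by auto
qed

text \<open>The marginals are required for every \<open>n\<close>, also where the estimates have not
  yet set in; there any coupling will do.\<close>

lemma independent_coupling:
  "is_coupling3 (P \<bind> (\<lambda>x. Q \<bind> (\<lambda>y. map_pmf (\<lambda>z. (x, y, z)) R))) P Q R"
  by (simp add: is_coupling3_def map_bind_pmf map_pmf_comp bind_return_pmf')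

theorem theorem2p8:
  fixes d :: "nat \<Rightarrow> nat \<Rightarrow> nat"
  assumes "\<And>n. realisable n (d n)"
    and "near_regular d"
    and "(\<lambda>n. real (max_deg n (d n))) \<in> \<omega>(\<lambda>n. real n / sqrt (ln (real n)))"
    and "(\<lambda>n. real n - real (max_deg n (d n))) \<in> \<omega>(\<lambda>n. real n / sqrt (ln (real n)))"
    and "(\<lambda>n. real (deg_range n (d n))) \<in> O(\<lambda>n. real (max_deg n (d n)) / ln (real n))"
  shows "\<exists>(p1 :: nat \<Rightarrow> real) (p2 :: nat \<Rightarrow> real) (\<epsilon>1 :: nat \<Rightarrow> real) (\<epsilon>2 :: nat \<Rightarrow> real)
           (J :: nat \<Rightarrow> (nat set set \<times> nat set set \<times> nat set set) pmf).
         \<epsilon>1 \<in> o(\<lambda>_. 1) \<and> \<epsilon>2 \<in> o(\<lambda>_. 1) \<and>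
         (\<forall>n. p1 n \<in> {0..1} \<and> p1 n = (1 - \<epsilon>1 n) * real (max_deg n (d n)) / real n) \<and>
         (\<forall>n. p2 n \<in> {0..1} \<and> p2 n = (1 + \<epsilon>2 n) * real (max_deg n (d n)) / real n) \<and>
         (\<forall>n. is_coupling3 (J n) (binomial_random_graph n (p1 n))
                (degree_random_graph n (d n)) (binomial_random_graph n (p2 n))) \<and>
         (\<lambda>n. measure_pmf.prob (J n) {(GL, G, GU). GL \<subseteq> G \<and> G \<subseteq> GU}) \<longlonglongrightarrow> 1"
proof -
  have ne: "graphs_with_degrees n (d n) \<noteq> {}" for n using assms(1) by (simp add: realisable_def)
  define p where "p n = real (max_deg n (d n)) / real n" for n
  have p01: "0 \<le> p n" "p n \<le> 1" for n
  proof -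
    show "0 \<le> p n" by (simp add: p_def)
    show "p n \<le> 1"
    proof (cases "n = 0")
      case False
      then show ?thesis using max_deg_less[OF ne, of n] by (simp add: p_def)
    qed (simp add: p_def)
  qed
  define w where "w n = ln (real n) powr (-1 / 16)" for n :: nat
  obtain c where c: "eventually (\<lambda>n. norm (real (deg_range n (d n))) \<le>
      c * norm (real (max_deg n (d n)) / ln (real n))) sequentially"
    using assms(5) by (blast elim: landau_o.bigE)
  define C where "C = max 1 c"
  \<comment> \<open>Positivity of \<open>p n\<close> is included because the relative errors arise
    on division by \<open>p n\<close>.\<close>
  define good where "good n \<longleftrightarrow> 0 < p n \<and> (\<exists>p1 p2 J. p1 \<in> {0..1} \<and> p2 \<in> {0..1} \<and>
      \<bar>p1 - p n\<bar> \<le> 43 * w n * p n \<and> \<bar>p2 - p n\<bar> \<le> 43 * w n * p n \<and>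
      is_coupling3 J (binomial_random_graph n p1) (degree_random_graph n (d n)) (binomial_random_graph n p2) \<and>
      1 - sandwich_error n (w n) \<le> measure_pmf.prob J {(GL, G, GU). GL \<subseteq> G \<and> G \<subseteq> GU})" for n
  have w0: "w \<longlonglongrightarrow> 0" unfolding w_def by real_asymp
  then have "(\<lambda>n. 1000 * C\<^sup>2 * w n) \<longlonglongrightarrow> 0" by (rule tendsto_mult_right_zero)
  then have "eventually (\<lambda>n. 1000 * C\<^sup>2 * w n < 1) sequentially" by (rule order_tendstoD) simp
  moreover have "eventually (\<lambda>n. 1 \<le> real n * w n ^ 100) sequentially"
    unfolding w_def by real_asymp
  moreover have "eventually (\<lambda>n. real n * (2 * exp (- (2 * (real n * w n ^ 128)))) \<le> 1 / 4) sequentially"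
    unfolding w_def by real_asymp
  moreover have "eventually (\<lambda>n. 2 * exp (real n * ln 4 - w n ^ 32 * (real n)\<^sup>2 / 64) \<le> 1 / 4) sequentially"
    unfolding w_def by real_asymp
  moreover have "eventually (\<lambda>n. norm (real (max_deg n (d n))) \<ge> 4 * norm (real n / sqrt (ln (real n)))) sequentially"
    using assms(3) by (rule smallomegaD)
  moreover have "eventually (\<lambda>n. norm (real n - real (max_deg n (d n))) \<ge> 4 * norm (real n / sqrt (ln (real n)))) sequentially"
    using assms(4) by (rule smallomegaD)
  moreover note c
  moreover have "eventually (\<lambda>n::nat. 3 \<le> n) sequentially" by (rule eventually_ge_at_top)
  ultimately have ev_good: "eventually (\<lambda>n. good n) sequentially"
  proof eventually_elim
    case (elim n)
    have n0: "0 < real n" using elim by simp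
    have "exp 1 \<le> real n" using exp_le elim by linarith
    then have ln1: "1 \<le> ln (real n)" using n0 by (simp add: ln_ge_iff)
    then have w_pos: "0 < w n" by (simp add: w_def)
    have wk: "w n ^ k = ln (real n) powr (- real k / 16)" for k
      using ln1 by (simp add: w_def powr_powr flip: powr_realpow)
    have w16: "w n ^ 16 = 1 / ln (real n)" using ln1 by (simp add: wk powr_minus_divide)
    have w8: "w n ^ 8 = 1 / sqrt (ln (real n))"
      using ln1 by (simp add: wk powr_minus_divide powr_half_sqrt)
    have dense: "4 * w n ^ 8 \<le> p n" "4 * w n ^ 8 \<le> 1 - p n"
    proof -
      have sq: "norm (real n / sqrt (ln (real n))) = n * w n ^ 8" using ln1 n0 by (simp add: w8)
      have "4 * w n ^ 8 * n \<le> p n * n" using elim(5) n0 unfolding sq by (simp add: p_def mult_ac)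
      then show "4 * w n ^ 8 \<le> p n" using n0 by simp
      have "max_deg n (d n) < n" using max_deg_less[OF ne, of n] elim by simp
      then have "4 * (n * w n ^ 8) \<le> real n - real (max_deg n (d n))"
        using elim(6) unfolding sq by simp
      moreover have "real (max_deg n (d n)) = p n * n" using n0 by (simp add: p_def)
      ultimately have "4 * w n ^ 8 * n \<le> (1 - p n) * n" by (simp add: algebra_simps)
      then show "4 * w n ^ 8 \<le> 1 - p n" using n0 by simp
    qed
    have range: "real (deg_range n (d n)) \<le> C * real (max_deg n (d n)) * w n ^ 16"
    proof -
      have "real (deg_range n (d n)) \<le> c * (real (max_deg n (d n)) / ln (real n))"
        using elim(7) ln1 by simp
      also have "\<dots> \<le> C * (real (max_deg n (d n)) / ln (real n))"
        using ln1 by (intro mult_right_mono) (auto simp: C_def)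
      finally show ?thesis by (simp add: w16)
    qed
    have "0 < w n ^ 8" using w_pos by simp
    then have "0 < p n" using dense(1) by linarith
    moreover have "1 \<le> C" by (simp add: C_def)
    ultimately show ?case unfolding good_def
      using sandwich_quantitative[OF ne, of C "w n" n, folded p_def] w_pos elim(1-4) w16 dense range
      by (simp add: less_imp_le)
  qed
  \<comment> \<open>A specification that can be met for every \<open>n\<close>. Its clause for
    \<open>p n = 0\<close> keeps \<open>p1 n = (1 - \<epsilon>1 n) * p n\<close> and its companion
    exact at such \<open>n\<close>, among them \<open>n = 0\<close>, where \<open>p n\<close> is a
    quotient by zero and equals 0.\<close>
  define Q where "Q n p1 p2 J \<longleftrightarrow> p1 \<in> {0..1} \<and> p2 \<in> {0..1} \<and> (p n = 0 \<longrightarrow> p1 = 0 \<and> p2 = 0) \<and>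
      is_coupling3 J (binomial_random_graph n p1) (degree_random_graph n (d n)) (binomial_random_graph n p2) \<and>
      (good n \<longrightarrow> \<bar>p1 - p n\<bar> \<le> 43 * w n * p n \<and> \<bar>p2 - p n\<bar> \<le> 43 * w n * p n \<and>
        1 - sandwich_error n (w n) \<le> measure_pmf.prob J {(GL, G, GU). GL \<subseteq> G \<and> G \<subseteq> GU})" for n p1 p2 J
  have "\<exists>p1 p2 J. Q n p1 p2 J" for n
  proof (cases "good n")
    case True
    then show ?thesis unfolding good_def Q_def by auto
  next
    case False
    then show ?thesis unfolding Q_def
      using p01[of n] independent_coupling[of "binomial_random_graph n 0" "degree_random_graph n (d n)" "binomial_random_graph n (p n)"]
      by (intro exI[of _ 0] exI[of _ "p n"]) auto
  qed
  then obtain p1 p2 J where "\<And>n. Q n (p1 n) (p2 n) (J n)" by metis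
  then have P: "\<And>n. p1 n \<in> {0..1}" "\<And>n. p2 n \<in> {0..1}"
      "\<And>n. p n = 0 \<Longrightarrow> p1 n = 0 \<and> p2 n = 0"
    and J: "\<And>n. is_coupling3 (J n) (binomial_random_graph n (p1 n)) (degree_random_graph n (d n)) (binomial_random_graph n (p2 n))"
    and good: "\<And>n. good n \<Longrightarrow> \<bar>p1 n - p n\<bar> \<le> 43 * w n * p n \<and> \<bar>p2 n - p n\<bar> \<le> 43 * w n * p n \<and>
        1 - sandwich_error n (w n) \<le> measure_pmf.prob (J n) {(GL, G, GU). GL \<subseteq> G \<and> G \<subseteq> GU}"
    unfolding Q_def by blast+
  define \<epsilon>1 where "\<epsilon>1 n = (p n - p1 n) / p n" for n
  define \<epsilon>2 where "\<epsilon>2 n = (p2 n - p n) / p n" for n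
  have small: "f \<in> o(\<lambda>_. 1)" if "\<And>n. good n \<Longrightarrow> \<bar>f n\<bar> \<le> 43 * w n" for f :: "nat \<Rightarrow> real"
  proof (rule smalloI_tendsto)
    have "(\<lambda>n. 43 * w n) \<longlonglongrightarrow> 0" using w0 by (rule tendsto_mult_right_zero)
    then show "(\<lambda>n. f n / 1) \<longlonglongrightarrow> 0"
      by (rule Lim_null_comparison [rotated]) (use ev_good that in \<open>auto elim: eventually_mono\<close>)
  qed simp
  have e1: "\<epsilon>1 \<in> o(\<lambda>_. 1)"
  proof (rule small)
    fix n assume n: "good n"
    then have "0 < p n" by (simp add: good_def)
    then show "\<bar>\<epsilon>1 n\<bar> \<le> 43 * w n"
      using good[OF n] by (simp add: \<epsilon>1_def pos_divide_le_eq abs_minus_commute)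
  qed
  have e2: "\<epsilon>2 \<in> o(\<lambda>_. 1)"
  proof (rule small)
    fix n assume n: "good n"
    then have "0 < p n" by (simp add: good_def)
    then show "\<bar>\<epsilon>2 n\<bar> \<le> 43 * w n"
      using good[OF n] by (simp add: \<epsilon>2_def pos_divide_le_eq)
  qed
  have p_eq: "x * real (max_deg n (d n)) / real n = x * p n" for x n by (simp add: p_def)
  have eq1: "p1 n = (1 - \<epsilon>1 n) * real (max_deg n (d n)) / real n" for n
    unfolding p_eq using P(3)[of n] by (cases "p n = 0") (auto simp: \<epsilon>1_def field_simps)
  have eq2: "p2 n = (1 + \<epsilon>2 n) * real (max_deg n (d n)) / real n" for n
    unfolding p_eq using P(3)[of n] by (cases "p n = 0") (auto simp: \<epsilon>2_def field_simps)
  have lim: "(\<lambda>n. measure_pmf.prob (J n) {(GL, G, GU). GL \<subseteq> G \<and> G \<subseteq> GU}) \<longlonglongrightarrow> 1"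
  proof (rule tendsto_sandwich)
    \<comment> \<open>The powers of \<open>w\<close> are powers of ln n. So
      \<open>w ^ 36 * n ^ 2\<close> outgrows \<open>w ^ 48 * n ^ 2\<close> and
      \<open>n * ln 4\<close>, \<open>w ^ 88 * n ^ 2\<close> outgrows \<open>n * ln 4\<close>, and
      \<open>w ^ 88 * n\<close> outgrows ln n, with enough to spare for the polylogarithmic factor
      \<open>10 / w ^ 44\<close>.\<close>
    have "(\<lambda>n. sandwich_error (real n) (w n)) \<longlonglongrightarrow> 0"
      unfolding sandwich_error_def w_def by real_asymp
    from tendsto_diff[OF tendsto_const[of 1] this]
    show "(\<lambda>n. 1 - sandwich_error (real n) (w n)) \<longlonglongrightarrow> 1" by simp
    show "eventually (\<lambda>n. 1 - sandwich_error (real n) (w n) \<le>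
        measure_pmf.prob (J n) {(GL, G, GU). GL \<subseteq> G \<and> G \<subseteq> GU}) sequentially"
      using ev_good by (rule eventually_mono) (use good in blast)
  qed auto
  show ?thesis
    by (intro exI[of _ p1] exI[of _ p2] exI[of _ \<epsilon>1] exI[of _ \<epsilon>2] exI[of _ J] conjI allI e1 e2 P(1,2)
      eq1 eq2 J lim)
qed

end
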